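(* Let $\mathfrak U$ be a Grothendieck universe containing the set of integers, let $\mathfrak V$ be a Grothendieck universe strictly containing $\mathfrak U$, and let $I$ be a set in $\mathfrak V\smallsetminus\mathfrak U$. Let $\Gamma$ be the quiver with vertices $x$, $z$, and $y_i$ $(i\in I)$, and with arrows $\sigma_i\colon y_i\to x$ and $\tau_i\colon y_i\to z$ for each $i\in I$. Let $\mathcal C$ be the path category of $\Gamma$. Then the abelian category $\operatorname{Ab}(\operatorname{add}(\mathcal C))$, the abelian hull of the additive hull of $\mathcal C$, is a $\mathfrak U$-category, and there exists a Serre subcategory $\mathcal S\subseteq\operatorname{Ab}(\operatorname{add}(\mathcal C))$ such that the corresponding quotient $\operatorname{Ab}(\operatorname{add}(\mathcal C))/\mathcal S$ is not a $\mathfrak U$-category.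
   Context: $\mathfrak U$-category: a category such that for every pair of objects $X,Y$ the set $\operatorname{Hom}(X,Y)$ belongs to $\mathfrak U$. Path category: the objects of $\mathcal C$ are the vertices of $\Gamma$ and the morphisms are the paths in $\Gamma$, including the trivial path at each vertex. Additive hull: for a category $\mathcal C$, $\operatorname{add}(\mathcal C)$ is obtained by taking formal finite direct sums of the objects of the $\mathbb Z$-linearisation $\mathbb Z\mathcal C$ (same objects as $\mathcal C$, with $\operatorname{Hom}(X,Y)$ the free abelian group on $\operatorname{Hom}_{\mathcal C}(X,Y)$). Abelian hull: for an additive category $\mathcal D$, let $\operatorname{mod}(\mathcal D)$ be its completion under finite colimits, obtained by adding formal cokernels of the morphisms in $\mathcal D$; for instance, the category of coherent functors, i.e. additive functors $F\colon\mathcal D^{\mathrm{op}}\to\mathrm{Ab}$ into abelian groups admitting an exact presentation $\operatorname{Hom}(-,X)\to\operatorname{Hom}(-,Y)\to F\to 0$ with $X,Y\in\mathcal D$. The abelian hull of $\mathcal D$ is $\operatorname{Ab}(\mathcal D):=\operatorname{mod}\bigl((\operatorname{mod}(\mathcal D))^{\mathrm{op}}\bigr)^{\mathrm{op}}$, an abelian category. For any abelian category $\mathcal B$, restriction along the canonical inclusion $\mathcal D\to\operatorname{Ab}(\mathcal D)$ is an equivalence from exact functors $\operatorname{Ab}(\mathcal D)\to\mathcal B$ to additive functors $\mathcal D\to\mathcal B$. Abelian quotient: for an abelian category $\mathcal A$ and a Serre subcategory $\mathcal S$ (full, closed under subobjects, quotients and extensions), $\mathcal A/\mathcal S$ is the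 localisation of $\mathcal A$ with respect to the class of morphisms whose kernel and cokernel both lie in $\mathcal S$.
   Formalization: The set I in V∖U is required not to be in bijection with any member of U (for I = {U} the claim fails: all Hom-sets of any quotient are countable), and belonging to U is read up to bijection for Hom-sets and the integers. *)

theory Defs
  imports Main "HOL-Library.Equipollence" "HOL-Library.FuncSet" "HOL-Library.Poly_Mapping"
begin

section \<open>Grothendieck universes\<close>

text \<open>
  HOL has no ambient theory of sets in which universes could live, so they are taken inside an
  arbitrary model of set theory: a type \<^typ>\<open>'v\<close> of ``sets'' in which \<open>elts x\<close> is the extension
  of \<open>x\<close>. Separation and replacement are second order, i.e. they range over all HOL predicates
  and functions; choice is inherited from HOL.
\<close>

locale set_theory =
  fixes elts :: "'v \<Rightarrow> 'v set"
  assumes extensionality: "elts x = elts y \<Longrightarrow> x = y"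
    and foundation: "wf {(x, y). x \<in> elts y}"
    and separation: "A \<subseteq> elts x \<Longrightarrow> \<exists>y. elts y = A"
    and pairing: "\<exists>p. elts p = {x, y}"
    and union: "\<exists>u. elts u = (\<Union>y\<in>elts x. elts y)"
    and powerset: "\<exists>p. elts p = {y. elts y \<subseteq> elts x}"
    and replacement: "\<exists>y. elts y = f ` elts x"
    and infinity: "\<exists>w. infinite (elts w)"

definition grothendieck_universe :: "('v \<Rightarrow> 'v set) \<Rightarrow> 'v \<Rightarrow> bool" where
  "grothendieck_universe elts U \<longleftrightarrow>
     elts U \<noteq> {} \<and>
     (\<forall>x\<in>elts U. elts x \<subseteq> elts U) \<and>
     (\<forall>x\<in>elts U. \<forall>y\<in>elts U. \<exists>p\<in>elts U. elts p = {x, y}) \<and>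
     (\<forall>x\<in>elts U. \<exists>p\<in>elts U. elts p = {y. elts y \<subseteq> elts x}) \<and>
     (\<forall>i\<in>elts U. \<forall>f. f ` elts i \<subseteq> elts U \<longrightarrow>
        (\<exists>u\<in>elts U. elts u = (\<Union>j\<in>elts i. elts (f j))))"

text \<open>
  Free abelian groups, sets of paths, sets of cosets etc. are HOL sets over types other
  than \<^typ>\<open>'v\<close>, and their elements could be coded in \<^typ>\<open>'v\<close> in many ways. For such a set,
  belonging to the universe \<open>U\<close> is understood up to bijection.
\<close>

definition small :: "('v \<Rightarrow> 'v set) \<Rightarrow> 'v \<Rightarrow> 'a set \<Rightarrow> bool" where
  "small elts U A \<longleftrightarrow> (\<exists>u\<in>elts U. elts u \<approx> A)"

text \<open>
  For the subsets of \<open>U\<close>, being in bijection with a member of \<open>U\<close> and being a member of \<open>U\<close>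
  are the same. For other sets not being a member says nothing about size: the singleton of \<open>U\<close>
  is not in \<open>U\<close>. A set of \<open>V \ U\<close> thus means a member of \<open>V\<close> that is not \<open>small elts U\<close>.
\<close>

lemma (in set_theory) small_iff_mem:
  assumes U: "grothendieck_universe elts U" and x: "elts x \<subseteq> elts U"
  shows "small elts U (elts x) \<longleftrightarrow> x \<in> elts U"
proof
  assume "small elts U (elts x)"
  then obtain u f where u: "u \<in> elts U" and f: "bij_betw f (elts u) (elts x)"
    unfolding small_def eqpoll_def by blast
  have union_U: "\<forall>i\<in>elts U. \<forall>f. f ` elts i \<subseteq> elts U \<longrightarrow>
      (\<exists>u\<in>elts U. elts u = (\<Union>j\<in>elts i. elts (f j)))"
    using U unfolding grothendieck_universe_def by (elim conjE) assumption
  have "\<exists>s. s \<in> elts U \<and> elts s = {f j}" if "j \<in> elts u" for j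
  proof -
    have "f j \<in> elts U" using f x that by (auto simp: bij_betw_def)
    then show ?thesis using U unfolding grothendieck_universe_def by fastforce
  qed
  then obtain g where g: "\<And>j. j \<in> elts u \<Longrightarrow> g j \<in> elts U \<and> elts (g j) = {f j}"
    by metis
  have g_image: "g ` elts u \<subseteq> elts U" using g by auto
  obtain w where w: "w \<in> elts U" "elts w = (\<Union>j\<in>elts u. elts (g j))"
    using mp[OF spec[OF bspec[OF union_U u]] g_image] by (elim bexE)
  have "elts w = f ` elts u" using w(2) g by auto
  then have "elts w = elts x" using f by (simp add: bij_betw_def)
  then show "x \<in> elts U" using w(1) extensionality by blast
next
  assume "x \<in> elts U"
  then show "small elts U (elts x)" unfolding small_def by (meson eqpoll_refl)
qed


section \<open>Categories\<close>

text \<open>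
  Hom-sets are indexed by source and target and need not be disjoint; accordingly
  composition takes the three objects as arguments: \<open>Cmp C X Y Z g f\<close> is the composite
  of \<open>f : X \<rightarrow> Y\<close> and \<open>g : Y \<rightarrow> Z\<close>. Values outside the objects and Hom-sets are irrelevant.
\<close>

record ('o, 'm) cat =
  Ob :: "'o set"
  Hom :: "'o \<Rightarrow> 'o \<Rightarrow> 'm set"
  Idm :: "'o \<Rightarrow> 'm"
  Cmp :: "'o \<Rightarrow> 'o \<Rightarrow> 'o \<Rightarrow> 'm \<Rightarrow> 'm \<Rightarrow> 'm"

record ('o, 'm) addcat = "('o, 'm) cat" +
  Zer :: "'o \<Rightarrow> 'o \<Rightarrow> 'm"
  Pls :: "'o \<Rightarrow> 'o \<Rightarrow> 'm \<Rightarrow> 'm \<Rightarrow> 'm"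

definition category :: "('o, 'm, 'e) cat_scheme \<Rightarrow> bool" where
  "category C \<longleftrightarrow>
     (\<forall>X\<in>Ob C. Idm C X \<in> Hom C X X) \<and>
     (\<forall>X\<in>Ob C. \<forall>Y\<in>Ob C. \<forall>Z\<in>Ob C. \<forall>f\<in>Hom C X Y. \<forall>g\<in>Hom C Y Z. Cmp C X Y Z g f \<in> Hom C X Z) \<and>
     (\<forall>X\<in>Ob C. \<forall>Y\<in>Ob C. \<forall>f\<in>Hom C X Y.
        Cmp C X X Y f (Idm C X) = f \<and> Cmp C X Y Y (Idm C Y) f = f) \<and>
     (\<forall>W\<in>Ob C. \<forall>X\<in>Ob C. \<forall>Y\<in>Ob C. \<forall>Z\<in>Ob C.
        \<forall>f\<in>Hom C W X. \<forall>g\<in>Hom C X Y. \<forall>h\<in>Hom C Y Z.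
        Cmp C W Y Z h (Cmp C W X Y g f) = Cmp C W X Z (Cmp C X Y Z h g) f)"

definition preadditive :: "('o, 'm, 'e) addcat_scheme \<Rightarrow> bool" where
  "preadditive D \<longleftrightarrow> category D \<and>
     (\<forall>X\<in>Ob D. \<forall>Y\<in>Ob D.
        Zer D X Y \<in> Hom D X Y \<and>
        (\<forall>f\<in>Hom D X Y. Pls D X Y (Zer D X Y) f = f \<and>
           (\<exists>f'\<in>Hom D X Y. Pls D X Y f' f = Zer D X Y)) \<and>
        (\<forall>f\<in>Hom D X Y. \<forall>g\<in>Hom D X Y.
           Pls D X Y f g \<in> Hom D X Y \<and> Pls D X Y f g = Pls D X Y g f \<and>
           (\<forall>h\<in>Hom D X Y. Pls D X Y (Pls D X Y f g) h = Pls D X Y f (Pls D X Y g h)))) \<and>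
     (\<forall>X\<in>Ob D. \<forall>Y\<in>Ob D. \<forall>Z\<in>Ob D.
        (\<forall>f\<in>Hom D X Y. \<forall>f'\<in>Hom D X Y. \<forall>g\<in>Hom D Y Z.
           Cmp D X Y Z g (Pls D X Y f f') = Pls D X Z (Cmp D X Y Z g f) (Cmp D X Y Z g f')) \<and>
        (\<forall>f\<in>Hom D X Y. \<forall>g\<in>Hom D Y Z. \<forall>g'\<in>Hom D Y Z.
           Cmp D X Y Z (Pls D Y Z g g') f = Pls D X Z (Cmp D X Y Z g f) (Cmp D X Y Z g' f)))"

definition opposite :: "('o, 'm) addcat \<Rightarrow> ('o, 'm) addcat" where
  "opposite D = \<lparr>Ob = Ob D, Hom = (\<lambda>X Y. Hom D Y X), Idm = Idm D,
     Cmp = (\<lambda>X Y Z g f. Cmp D Z Y X f g),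
     Zer = (\<lambda>X Y. Zer D Y X), Pls = (\<lambda>X Y. Pls D Y X)\<rparr>"

definition universe_category :: "('v \<Rightarrow> 'v set) \<Rightarrow> 'v \<Rightarrow> ('o, 'm, 'e) cat_scheme \<Rightarrow> bool" where
  "universe_category elts U C \<longleftrightarrow> (\<forall>X\<in>Ob C. \<forall>Y\<in>Ob C. small elts U (Hom C X Y))"


section \<open>Path categories\<close>

record ('o, 'a) quiver =
  Verts :: "'o set"
  Arrows :: "'a set"
  Src :: "'a \<Rightarrow> 'o"
  Tgt :: "'a \<Rightarrow> 'o"

text \<open>A path is the list of its arrows in the order of traversal, \<open>[]\<close> being the trivial path.\<close>

fun is_path :: "('o, 'a) quiver \<Rightarrow> 'o \<Rightarrow> 'a list \<Rightarrow> 'o \<Rightarrow> bool" where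
  "is_path Q x [] y \<longleftrightarrow> x \<in> Verts Q \<and> x = y"
| "is_path Q x (a # p) y \<longleftrightarrow>
     x \<in> Verts Q \<and> a \<in> Arrows Q \<and> Src Q a = x \<and> is_path Q (Tgt Q a) p y"

definition path_category :: "('o, 'a) quiver \<Rightarrow> ('o, 'a list) cat" where
  "path_category Q = \<lparr>Ob = Verts Q, Hom = (\<lambda>x y. {p. is_path Q x p y}), Idm = (\<lambda>x. []),
     Cmp = (\<lambda>x y z q p. p @ q)\<rparr>"


section \<open>The additive hull\<close>

text \<open>
  \<open>'m \<Rightarrow>\<^sub>0 int\<close> is the free abelian group on \<open>'m\<close>, with basis \<^const>\<open>frag_of\<close>; \<^const>\<open>frag_extend\<close>
  is linear extension.
\<close>

definition linearisation :: "('o, 'm) cat \<Rightarrow> ('o, 'm \<Rightarrow>\<^sub>0 int) addcat" where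
  "linearisation C = \<lparr>Ob = Ob C, Hom = (\<lambda>X Y. {p. Poly_Mapping.keys p \<subseteq> Hom C X Y}),
     Idm = (\<lambda>X. frag_of (Idm C X)),
     Cmp = (\<lambda>X Y Z q p. frag_extend (\<lambda>f. frag_extend (\<lambda>g. frag_of (Cmp C X Y Z g f)) q) p),
     Zer = (\<lambda>X Y. 0), Pls = (\<lambda>X Y p q. p + q)\<rparr>"

primrec hom_sum :: "('o, 'm) addcat \<Rightarrow> 'o \<Rightarrow> 'o \<Rightarrow> (nat \<Rightarrow> 'm) \<Rightarrow> nat \<Rightarrow> 'm" where
  "hom_sum D X Y f 0 = Zer D X Y"
| "hom_sum D X Y f (Suc n) = Pls D X Y (hom_sum D X Y f n) (f n)"

text \<open>
  A list of objects stands for its formal direct sum. A morphism is a matrix whose \<open>(i, j)\<close> entry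
  goes from the \<open>j\<close>-th summand of the source to the \<open>i\<close>-th summand of the target.
\<close>

definition direct_sums :: "('o, 'm) addcat \<Rightarrow> ('o list, nat \<times> nat \<Rightarrow> 'm) addcat" where
  "direct_sums D = \<lparr>Ob = lists (Ob D),
     Hom = (\<lambda>xs ys. \<Pi>\<^sub>E (i, j)\<in>{..<length ys} \<times> {..<length xs}. Hom D (xs ! j) (ys ! i)),
     Idm = (\<lambda>xs. \<lambda>(i, j)\<in>{..<length xs} \<times> {..<length xs}.
              if i = j then Idm D (xs ! i) else Zer D (xs ! j) (xs ! i)),
     Cmp = (\<lambda>xs ys zs N M. \<lambda>(i, k)\<in>{..<length zs} \<times> {..<length xs}.
              hom_sum D (xs ! k) (zs ! i)
                (\<lambda>j. Cmp D (xs ! k) (ys ! j) (zs ! i) (N (i, j)) (M (j, k))) (length ys)),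
     Zer = (\<lambda>xs ys. \<lambda>(i, j)\<in>{..<length ys} \<times> {..<length xs}. Zer D (xs ! j) (ys ! i)),
     Pls = (\<lambda>xs ys M N. \<lambda>(i, j)\<in>{..<length ys} \<times> {..<length xs}.
              Pls D (xs ! j) (ys ! i) (M (i, j)) (N (i, j)))\<rparr>"

definition additive_hull :: "('o, 'm) cat \<Rightarrow> ('o list, nat \<times> nat \<Rightarrow> 'm \<Rightarrow>\<^sub>0 int) addcat" where
  "additive_hull C = direct_sums (linearisation C)"


section \<open>The abelian hull\<close>

text \<open>
  The object \<open>(X, Y, a)\<close> of \<open>fp_mod D\<close>, for \<open>a : X \<rightarrow> Y\<close> in \<open>D\<close>, is the formal cokernel of \<open>a\<close>; as a
  coherent functor it is the cokernel of \<open>Hom(-, a)\<close>. By Yoneda, a natural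
  transformation from the cokernel of \<open>Hom(-, a)\<close> to that of \<open>Hom(-, a')\<close> is given by
  some \<open>g : Y \<rightarrow> Y'\<close> such that \<open>g a\<close> factors through \<open>a'\<close>, and \<open>g\<close> is unique up to adding maps that
  factor through \<open>a'\<close>. Morphisms are thus the cosets \<^term>\<open>coker_class D Y X' Y' a' g\<close> of such \<open>g\<close>.
\<close>

definition coker_class :: "('o, 'm) addcat \<Rightarrow> 'o \<Rightarrow> 'o \<Rightarrow> 'o \<Rightarrow> 'm \<Rightarrow> 'm \<Rightarrow> 'm set" where
  "coker_class D Y X' Y' a' g = {Pls D Y Y' g (Cmp D Y X' Y' a' s) | s. s \<in> Hom D Y X'}"

definition fp_mod :: "('o, 'm) addcat \<Rightarrow> ('o \<times> 'o \<times> 'm, 'm set) addcat" where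
  "fp_mod D = \<lparr>Ob = {(X, Y, a). X \<in> Ob D \<and> Y \<in> Ob D \<and> a \<in> Hom D X Y},
     Hom = (\<lambda>(X, Y, a) (X', Y', a').
              {coker_class D Y X' Y' a' g | g. g \<in> Hom D Y Y' \<and>
                 (\<exists>h\<in>Hom D X X'. Cmp D X Y Y' g a = Cmp D X X' Y' a' h)}),
     Idm = (\<lambda>(X, Y, a). coker_class D Y X Y a (Idm D Y)),
     Cmp = (\<lambda>(X, Y, a) (X', Y', a') (X'', Y'', a'') G F.
              \<Union>g\<in>G. \<Union>f\<in>F. coker_class D Y X'' Y'' a'' (Cmp D Y Y' Y'' g f)),
     Zer = (\<lambda>(X, Y, a) (X', Y', a'). coker_class D Y X' Y' a' (Zer D Y Y')),
     Pls = (\<lambda>(X, Y, a) (X', Y', a') F G.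
              \<Union>f\<in>F. \<Union>g\<in>G. coker_class D Y X' Y' a' (Pls D Y Y' f g))\<rparr>"

definition abelian_hull ::
    "('o, 'm) addcat \<Rightarrow> (('o \<times> 'o \<times> 'm) \<times> ('o \<times> 'o \<times> 'm) \<times> 'm set, 'm set set) addcat" where
  "abelian_hull D = opposite (fp_mod (opposite (fp_mod D)))"


section \<open>Serre subcategories and quotients\<close>

definition is_mono :: "('o, 'm) addcat \<Rightarrow> 'o \<Rightarrow> 'o \<Rightarrow> 'm \<Rightarrow> bool" where
  "is_mono A X Y f \<longleftrightarrow> f \<in> Hom A X Y \<and>
     (\<forall>T\<in>Ob A. \<forall>u\<in>Hom A T X. \<forall>v\<in>Hom A T X. Cmp A T X Y f u = Cmp A T X Y f v \<longrightarrow> u = v)"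

definition is_epi :: "('o, 'm) addcat \<Rightarrow> 'o \<Rightarrow> 'o \<Rightarrow> 'm \<Rightarrow> bool" where
  "is_epi A X Y f \<longleftrightarrow> is_mono (opposite A) Y X f"

definition is_kernel :: "('o, 'm) addcat \<Rightarrow> 'o \<Rightarrow> 'o \<Rightarrow> 'm \<Rightarrow> 'o \<Rightarrow> 'm \<Rightarrow> bool" where
  "is_kernel A X Y f K k \<longleftrightarrow> f \<in> Hom A X Y \<and> K \<in> Ob A \<and> k \<in> Hom A K X \<and>
     Cmp A K X Y f k = Zer A K Y \<and>
     (\<forall>T\<in>Ob A. \<forall>t\<in>Hom A T X. Cmp A T X Y f t = Zer A T Y \<longrightarrow>
        (\<exists>!u. u \<in> Hom A T K \<and> Cmp A T K X k u = t))"

definition is_cokernel :: "('o, 'm) addcat \<Rightarrow> 'o \<Rightarrow> 'o \<Rightarrow> 'm \<Rightarrow> 'o \<Rightarrow> 'm \<Rightarrow> bool" where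
  "is_cokernel A X Y f C c \<longleftrightarrow> is_kernel (opposite A) Y X f C c"

definition short_exact :: "('o, 'm) addcat \<Rightarrow> 'o \<Rightarrow> 'o \<Rightarrow> 'o \<Rightarrow> 'm \<Rightarrow> 'm \<Rightarrow> bool" where
  "short_exact A X Y Z f g \<longleftrightarrow> is_kernel A Y Z g X f \<and> is_cokernel A X Y f Z g"

text \<open>A full subcategory is given by its class of objects.\<close>

definition serre_subcategory :: "('o, 'm) addcat \<Rightarrow> 'o set \<Rightarrow> bool" where
  "serre_subcategory A S \<longleftrightarrow> S \<subseteq> Ob A \<and> S \<noteq> {} \<and>
     (\<forall>X\<in>Ob A. \<forall>Y\<in>S. \<forall>f. is_mono A X Y f \<longrightarrow> X \<in> S) \<and>
     (\<forall>X\<in>S. \<forall>Y\<in>Ob A. \<forall>f. is_epi A X Y f \<longrightarrow> Y \<in> S) \<and>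
     (\<forall>X\<in>S. \<forall>Y\<in>Ob A. \<forall>Z\<in>S. \<forall>f g. short_exact A X Y Z f g \<longrightarrow> Y \<in> S)"

text \<open>
  The localisation of \<open>C\<close> with respect to a class \<open>W\<close> of morphisms, given by
  its subsets \<open>W X Y\<close> of the Hom-sets, is the construction of Gabriel and Zisman: adjoin to the
  morphisms of \<open>C\<close> a formal inverse \<open>Bwd X Y s : Y \<rightarrow> X\<close> of each \<open>s\<close> in \<open>W X Y\<close>, and divide the path
  category of the resulting quiver by the smallest congruence that makes \<open>C\<close> map functorially
  and makes the formal inverses inverses.
\<close>

datatype ('o, 'm) zarrow = Fwd 'o 'o 'm | Bwd 'o 'o 'm

fun zsrc :: "('o, 'm) zarrow \<Rightarrow> 'o" where
  "zsrc (Fwd X Y f) = X"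
| "zsrc (Bwd X Y s) = Y"

fun ztgt :: "('o, 'm) zarrow \<Rightarrow> 'o" where
  "ztgt (Fwd X Y f) = Y"
| "ztgt (Bwd X Y s) = X"

definition zquiver :: "('o, 'm, 'e) cat_scheme \<Rightarrow> ('o \<Rightarrow> 'o \<Rightarrow> 'm set) \<Rightarrow> ('o, ('o, 'm) zarrow) quiver"
  where
  "zquiver C W = \<lparr>Verts = Ob C,
     Arrows = {Fwd X Y f | X Y f. X \<in> Ob C \<and> Y \<in> Ob C \<and> f \<in> Hom C X Y} \<union>
              {Bwd X Y s | X Y s. X \<in> Ob C \<and> Y \<in> Ob C \<and> s \<in> W X Y},
     Src = zsrc, Tgt = ztgt\<rparr>"

inductive loc_rel :: "('o, 'm, 'e) cat_scheme \<Rightarrow> ('o \<Rightarrow> 'o \<Rightarrow> 'm set) \<Rightarrow>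
    'o \<Rightarrow> 'o \<Rightarrow> ('o, 'm) zarrow list \<Rightarrow> ('o, 'm) zarrow list \<Rightarrow> bool"
  for C W where
  refl: "is_path (zquiver C W) X p Y \<Longrightarrow> loc_rel C W X Y p p"
| sym: "loc_rel C W X Y p q \<Longrightarrow> loc_rel C W X Y q p"
| trans: "loc_rel C W X Y p q \<Longrightarrow> loc_rel C W X Y q r \<Longrightarrow> loc_rel C W X Y p r"
| concat: "loc_rel C W X Y p p' \<Longrightarrow> loc_rel C W Y Z q q' \<Longrightarrow> loc_rel C W X Z (p @ q) (p' @ q')"
| ident: "X \<in> Ob C \<Longrightarrow> loc_rel C W X X [Fwd X X (Idm C X)] []"
| comp: "X \<in> Ob C \<Longrightarrow> Y \<in> Ob C \<Longrightarrow> Z \<in> Ob C \<Longrightarrow> f \<in> Hom C X Y \<Longrightarrow> g \<in> Hom C Y Z \<Longrightarrow>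
    loc_rel C W X Z [Fwd X Y f, Fwd Y Z g] [Fwd X Z (Cmp C X Y Z g f)]"
| inv_right: "X \<in> Ob C \<Longrightarrow> Y \<in> Ob C \<Longrightarrow> s \<in> W X Y \<Longrightarrow> loc_rel C W X X [Fwd X Y s, Bwd X Y s] []"
| inv_left: "X \<in> Ob C \<Longrightarrow> Y \<in> Ob C \<Longrightarrow> s \<in> W X Y \<Longrightarrow> loc_rel C W Y Y [Bwd X Y s, Fwd X Y s] []"

definition localisation ::
    "('o, 'm, 'e) cat_scheme \<Rightarrow> ('o \<Rightarrow> 'o \<Rightarrow> 'm set) \<Rightarrow> ('o, ('o, 'm) zarrow list set) cat" where
  "localisation C W = \<lparr>Ob = Ob C,
     Hom = (\<lambda>X Y. {p. is_path (zquiver C W) X p Y} // {(p, q). loc_rel C W X Y p q}),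
     Idm = (\<lambda>X. {q. loc_rel C W X X [] q}),
     Cmp = (\<lambda>X Y Z G F. \<Union>q\<in>G. \<Union>p\<in>F. {r. loc_rel C W X Z (p @ q) r})\<rparr>"

definition serre_quotient ::
    "('o, 'm) addcat \<Rightarrow> 'o set \<Rightarrow> ('o, ('o, 'm) zarrow list set) cat" where
  "serre_quotient A S = localisation A
     (\<lambda>X Y. {f \<in> Hom A X Y. (\<exists>K\<in>S. \<exists>k. is_kernel A X Y f K k) \<and>
                             (\<exists>C\<in>S. \<exists>c. is_cokernel A X Y f C c)})"


section \<open>The quiver\<close>

datatype 'i vertex = Vx | Vz | Vy 'i

datatype 'i arrow = Sigma 'i | Tau 'i

fun arrow_src :: "'i arrow \<Rightarrow> 'i vertex" where
  "arrow_src (Sigma i) = Vy i"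
| "arrow_src (Tau i) = Vy i"

fun arrow_tgt :: "'i arrow \<Rightarrow> 'i vertex" where
  "arrow_tgt (Sigma i) = Vx"
| "arrow_tgt (Tau i) = Vz"

definition span_quiver :: "'i set \<Rightarrow> ('i vertex, 'i arrow) quiver" where
  "span_quiver I = \<lparr>Verts = {Vx, Vz} \<union> Vy ` I, Arrows = Sigma ` I \<union> Tau ` I,
     Src = arrow_src, Tgt = arrow_tgt\<rparr>"


section \<open>The constructions are categories\<close>

lemma categoryD:
  assumes "category C"
  shows "X \<in> Ob C \<Longrightarrow> Idm C X \<in> Hom C X X"
    and "\<lbrakk>X \<in> Ob C; Y \<in> Ob C; Z \<in> Ob C; f \<in> Hom C X Y; g \<in> Hom C Y Z\<rbrakk> \<Longrightarrow> Cmp C X Y Z g f \<in> Hom C X Z"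
    and "\<lbrakk>X \<in> Ob C; Y \<in> Ob C; f \<in> Hom C X Y\<rbrakk> \<Longrightarrow> Cmp C X X Y f (Idm C X) = f"
    and "\<lbrakk>X \<in> Ob C; Y \<in> Ob C; f \<in> Hom C X Y\<rbrakk> \<Longrightarrow> Cmp C X Y Y (Idm C Y) f = f"
    and "\<lbrakk>W \<in> Ob C; X \<in> Ob C; Y \<in> Ob C; Z \<in> Ob C; f \<in> Hom C W X; g \<in> Hom C X Y; h \<in> Hom C Y Z\<rbrakk>
      \<Longrightarrow> Cmp C W Y Z h (Cmp C W X Y g f) = Cmp C W X Z (Cmp C X Y Z h g) f"
  using assms unfolding category_def by simp_all

lemma preadditiveD:
  assumes "preadditive D"
  shows "category D"
    and "\<lbrakk>X \<in> Ob D; Y \<in> Ob D\<rbrakk> \<Longrightarrow> Zer D X Y \<in> Hom D X Y"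
    and "\<lbrakk>X \<in> Ob D; Y \<in> Ob D; f \<in> Hom D X Y\<rbrakk> \<Longrightarrow> Pls D X Y (Zer D X Y) f = f"
    and "\<lbrakk>X \<in> Ob D; Y \<in> Ob D; f \<in> Hom D X Y\<rbrakk> \<Longrightarrow> \<exists>f'\<in>Hom D X Y. Pls D X Y f' f = Zer D X Y"
    and "\<lbrakk>X \<in> Ob D; Y \<in> Ob D; f \<in> Hom D X Y; g \<in> Hom D X Y\<rbrakk> \<Longrightarrow> Pls D X Y f g \<in> Hom D X Y"
    and "\<lbrakk>X \<in> Ob D; Y \<in> Ob D; f \<in> Hom D X Y; g \<in> Hom D X Y\<rbrakk> \<Longrightarrow> Pls D X Y f g = Pls D X Y g f"
    and "\<lbrakk>X \<in> Ob D; Y \<in> Ob D; f \<in> Hom D X Y; g \<in> Hom D X Y; h \<in> Hom D X Y\<rbrakk>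
      \<Longrightarrow> Pls D X Y (Pls D X Y f g) h = Pls D X Y f (Pls D X Y g h)"
    and "\<lbrakk>X \<in> Ob D; Y \<in> Ob D; Z \<in> Ob D; f \<in> Hom D X Y; f' \<in> Hom D X Y; g \<in> Hom D Y Z\<rbrakk>
      \<Longrightarrow> Cmp D X Y Z g (Pls D X Y f f') = Pls D X Z (Cmp D X Y Z g f) (Cmp D X Y Z g f')"
    and "\<lbrakk>X \<in> Ob D; Y \<in> Ob D; Z \<in> Ob D; f \<in> Hom D X Y; g \<in> Hom D Y Z; g' \<in> Hom D Y Z\<rbrakk>
      \<Longrightarrow> Cmp D X Y Z (Pls D Y Z g g') f = Pls D X Z (Cmp D X Y Z g f) (Cmp D X Y Z g' f)"
  using assms unfolding preadditive_def by (simp_all, (elim conjE, metis)+)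

lemma is_path_Verts: "is_path Q x p y \<Longrightarrow> x \<in> Verts Q \<and> y \<in> Verts Q"
  by (induction p arbitrary: x) auto

lemma is_path_append: "is_path Q x p y \<Longrightarrow> is_path Q y q z \<Longrightarrow> is_path Q x (p @ q) z"
  by (induction p arbitrary: x) auto

lemma category_path_category: "category (path_category Q)"
  by (auto simp: category_def path_category_def is_path_append)

lemma preadditive_opposite:
  assumes D: "preadditive D" shows "preadditive (opposite D)"
  using categoryD[OF preadditiveD(1)[OF D]] preadditiveD[OF D]
  by (simp add: preadditive_def category_def opposite_def)

lemma preadditive_linearisation:
  assumes C: "category C" shows "preadditive (linearisation C)"
proof -
  note c = categoryD[OF C]
  define cmp where "cmp = (\<lambda>X Y Z q p.
    frag_extend (\<lambda>f. frag_extend (\<lambda>g. frag_of (Cmp C X Y Z g f)) q) p)"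
  have c_zero: "cmp X Y Z q 0 = 0" "cmp X Y Z 0 p = 0" for X Y Z q p
    by (simp_all add: cmp_def frag_extend_eq_0)
  have c_of: "cmp X Y Z (frag_of g) (frag_of f) = frag_of (Cmp C X Y Z g f)" for X Y Z f g
    by (simp add: cmp_def)
  have c_right: "cmp X Y Z q (p + p') = cmp X Y Z q p + cmp X Y Z q p'" for X Y Z q p p'
    by (simp add: cmp_def frag_extend_add)
  have c_left: "cmp X Y Z (q + q') p = cmp X Y Z q p + cmp X Y Z q' p" for X Y Z q q' p
    unfolding cmp_def frag_extend_add
    by (subst (1 2 3) frag_extend_def) (simp add: sum.distrib frag_cmul_distrib2)
  have c_right': "cmp X Y Z q (p - p') = cmp X Y Z q p - cmp X Y Z q p'" for X Y Z q p p'
    by (simp add: cmp_def frag_extend_diff)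
  have c_left': "cmp X Y Z (q - q') p = cmp X Y Z q p - cmp X Y Z q' p" for X Y Z q q' p
    using c_left[of X Y Z "q - q'" q' p] by simp
  have closed: "Poly_Mapping.keys (cmp X Y Z q p) \<subseteq> Hom C X Z"
    if o: "X \<in> Ob C" "Y \<in> Ob C" "Z \<in> Ob C" and p: "Poly_Mapping.keys p \<subseteq> Hom C X Y"
      and q: "Poly_Mapping.keys q \<subseteq> Hom C Y Z" for X Y Z p q
    using p
  proof (induction p rule: frag_induction)
    case zero show ?case by (simp add: c_zero)
  next
    case (one f)
    note f = this
    show ?case using q
    proof (induction q rule: frag_induction)
      case zero show ?case by (simp add: c_zero)
    next
      case (one g) show ?case using c(2)[OF o f one] by (simp add: c_of)
    next
      case (diff a b) then show ?case unfolding c_left' by (intro order_trans[OF keys_diff]) simp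
    qed
  next
    case (diff a b) then show ?case unfolding c_right' by (intro order_trans[OF keys_diff]) simp
  qed
  have idr: "cmp X X Y p (frag_of (Idm C X)) = p"
    if o: "X \<in> Ob C" "Y \<in> Ob C" and p: "Poly_Mapping.keys p \<subseteq> Hom C X Y" for X Y p
    using p
  proof (induction p rule: frag_induction)
    case zero show ?case by (simp add: c_zero)
  next
    case (one f) show ?case using c(3)[OF o one] by (simp add: c_of)
  next
    case (diff a b) then show ?case unfolding c_left' by simp
  qed
  have idl: "cmp X Y Y (frag_of (Idm C Y)) p = p"
    if o: "X \<in> Ob C" "Y \<in> Ob C" and p: "Poly_Mapping.keys p \<subseteq> Hom C X Y" for X Y p
    using p
  proof (induction p rule: frag_induction)
    case zero show ?case by (simp add: c_zero)
  next
    case (one f) show ?case using c(4)[OF o one] by (simp add: c_of)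
  next
    case (diff a b) then show ?case unfolding c_right' by simp
  qed
  have assoc: "cmp W Y Z r (cmp W X Y q p) = cmp W X Z (cmp X Y Z r q) p"
    if o: "W \<in> Ob C" "X \<in> Ob C" "Y \<in> Ob C" "Z \<in> Ob C"
      and p: "Poly_Mapping.keys p \<subseteq> Hom C W X" and q: "Poly_Mapping.keys q \<subseteq> Hom C X Y"
      and r: "Poly_Mapping.keys r \<subseteq> Hom C Y Z" for W X Y Z p q r
    using p
  proof (induction p rule: frag_induction)
    case zero show ?case by (simp add: c_zero)
  next
    case (one f)
    note f = this
    show ?case using q
    proof (induction q rule: frag_induction)
      case zero show ?case by (simp add: c_zero)
    next
      case (one g)
      note g = this
      show ?case using r
      proof (induction r rule: frag_induction)
        case zero show ?case by (simp add: c_zero)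
      next
        case (one h) show ?case using c(5)[OF o f g one] by (simp add: c_of)
      next
        case (diff a b) then show ?case unfolding c_left' by simp
      qed
    next
      case (diff a b) then show ?case unfolding c_left' c_right' by simp
    qed
  next
    case (diff a b) then show ?case unfolding c_right' by simp
  qed
  have plus: "Poly_Mapping.keys (p + q) \<subseteq> H"
    if "Poly_Mapping.keys p \<subseteq> H" "Poly_Mapping.keys q \<subseteq> H" for p q :: "'b \<Rightarrow>\<^sub>0 int" and H
    using that by (intro order_trans[OF Poly_Mapping.keys_add]) simp
  have neg: "\<exists>p'. Poly_Mapping.keys p' \<subseteq> H \<and> p' + p = 0"
    if "Poly_Mapping.keys p \<subseteq> H" for p :: "'b \<Rightarrow>\<^sub>0 int" and H
    using that by (intro exI[of _ "- p"]) simp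
  show ?thesis
    unfolding preadditive_def category_def linearisation_def cmp_def[symmetric]
    using closed idr idl assoc plus neg c(1)
    by (auto simp: c_left c_right add.commute add.assoc)
qed

lemma preadditive_rules:
  assumes D: "preadditive D"
  shows "\<lbrakk>X \<in> Ob D; Y \<in> Ob D; f \<in> Hom D X Y\<rbrakk> \<Longrightarrow> Pls D X Y f (Zer D X Y) = f"
    and "\<lbrakk>X \<in> Ob D; Y \<in> Ob D; f \<in> Hom D X Y; g \<in> Hom D X Y; h \<in> Hom D X Y;
      Pls D X Y h f = Pls D X Y h g\<rbrakk> \<Longrightarrow> f = g"
    and "\<lbrakk>X \<in> Ob D; Y \<in> Ob D; Z \<in> Ob D; f \<in> Hom D X Y\<rbrakk> \<Longrightarrow> Cmp D X Y Z (Zer D Y Z) f = Zer D X Z"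
    and "\<lbrakk>X \<in> Ob D; Y \<in> Ob D; Z \<in> Ob D; g \<in> Hom D Y Z\<rbrakk> \<Longrightarrow> Cmp D X Y Z g (Zer D X Y) = Zer D X Z"
    and "\<lbrakk>X \<in> Ob D; Y \<in> Ob D; a \<in> Hom D X Y; b \<in> Hom D X Y; c \<in> Hom D X Y; d \<in> Hom D X Y\<rbrakk> \<Longrightarrow>
      Pls D X Y (Pls D X Y a b) (Pls D X Y c d) = Pls D X Y (Pls D X Y a c) (Pls D X Y b d)"
proof -
  note p = preadditiveD[OF D] and c = categoryD[OF preadditiveD(1)[OF D]]
  show zero_right: "Pls D X Y f (Zer D X Y) = f" if "X \<in> Ob D" "Y \<in> Ob D" "f \<in> Hom D X Y" for X Y f
    using p(2,3) p(6)[of X Y f "Zer D X Y"] that by simp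
  show cancel: "f = g" if o: "X \<in> Ob D" "Y \<in> Ob D" "f \<in> Hom D X Y" "g \<in> Hom D X Y" "h \<in> Hom D X Y"
    and eq: "Pls D X Y h f = Pls D X Y h g" for X Y f g h
  proof -
    obtain h' where h': "h' \<in> Hom D X Y" "Pls D X Y h' h = Zer D X Y" using p(4) o by blast
    have "f = Pls D X Y h' (Pls D X Y h f)" using p(7)[of X Y h' h f] p(3) h' o by simp
    also have "\<dots> = g" unfolding eq using p(7)[of X Y h' h g] p(3) h' o by simp
    finally show ?thesis .
  qed
  show "Cmp D X Y Z (Zer D Y Z) f = Zer D X Z"
    if o: "X \<in> Ob D" "Y \<in> Ob D" "Z \<in> Ob D" "f \<in> Hom D X Y" for X Y Z f
  proof -
    let ?z = "Zer D Y Z"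
    have z: "?z \<in> Hom D Y Z" "Cmp D X Y Z ?z f \<in> Hom D X Z" using p(2) c(2) o by auto
    have "Pls D X Z (Cmp D X Y Z ?z f) (Cmp D X Y Z ?z f) = Cmp D X Y Z (Pls D Y Z ?z ?z) f"
      by (rule p(9)[OF o z(1) z(1), symmetric])
    also have "\<dots> = Pls D X Z (Cmp D X Y Z ?z f) (Zer D X Z)"
      unfolding p(3)[OF o(2,3) z(1)] by (rule zero_right[OF o(1,3) z(2), symmetric])
    finally show ?thesis by (rule cancel[OF o(1,3) z(2) p(2)[OF o(1,3)] z(2)])
  qed
  show "Cmp D X Y Z g (Zer D X Y) = Zer D X Z"
    if o: "X \<in> Ob D" "Y \<in> Ob D" "Z \<in> Ob D" "g \<in> Hom D Y Z" for X Y Z g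
  proof -
    let ?z = "Zer D X Y"
    have z: "?z \<in> Hom D X Y" "Cmp D X Y Z g ?z \<in> Hom D X Z" using p(2) c(2) o by auto
    have "Pls D X Z (Cmp D X Y Z g ?z) (Cmp D X Y Z g ?z) = Cmp D X Y Z g (Pls D X Y ?z ?z)"
      by (rule p(8)[OF o(1-3) z(1) z(1) o(4), symmetric])
    also have "\<dots> = Pls D X Z (Cmp D X Y Z g ?z) (Zer D X Z)"
      unfolding p(3)[OF o(1,2) z(1)] by (rule zero_right[OF o(1,3) z(2), symmetric])
    finally show ?thesis by (rule cancel[OF o(1,3) z(2) p(2)[OF o(1,3)] z(2)])
  qed
  show "Pls D X Y (Pls D X Y a b) (Pls D X Y c d) = Pls D X Y (Pls D X Y a c) (Pls D X Y b d)"
    if "X \<in> Ob D" "Y \<in> Ob D" "a \<in> Hom D X Y" "b \<in> Hom D X Y" "c \<in> Hom D X Y" "d \<in> Hom D X Y" for X Y a b c d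
    using that p(5)[of X Y] p(6)[of X Y b c] p(7)[of X Y a b "Pls D X Y c d"] p(7)[of X Y a c "Pls D X Y b d"]
      p(7)[of X Y b c d] p(7)[of X Y c b d]
    by simp
qed

lemma hom_sum_closed:
  assumes D: "preadditive D" and o: "X \<in> Ob D" "Y \<in> Ob D"
  shows "(\<And>j. j < n \<Longrightarrow> f j \<in> Hom D X Y) \<Longrightarrow> hom_sum D X Y f n \<in> Hom D X Y"
  by (induction n) (use preadditiveD(2,5)[OF D] o in auto)

lemma hom_sum_cong:
  "(\<And>j. j < n \<Longrightarrow> f j = g j) \<Longrightarrow> hom_sum D X Y f n = hom_sum D X Y g n"
  by (induction n) auto

lemma hom_sum_add:
  assumes D: "preadditive D" and o: "X \<in> Ob D" "Y \<in> Ob D"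
  shows "(\<And>j. j < n \<Longrightarrow> f j \<in> Hom D X Y) \<Longrightarrow> (\<And>j. j < n \<Longrightarrow> g j \<in> Hom D X Y) \<Longrightarrow>
    hom_sum D X Y (\<lambda>j. Pls D X Y (f j) (g j)) n = Pls D X Y (hom_sum D X Y f n) (hom_sum D X Y g n)"
proof (induction n)
  case 0 then show ?case using preadditiveD(2,3)[OF D] o by simp
next
  case (Suc n)
  then show ?case using hom_sum_closed[OF D o] preadditive_rules(5)[OF D o] by simp
qed

lemma hom_sum_zero:
  assumes D: "preadditive D" and o: "X \<in> Ob D" "Y \<in> Ob D"
  shows "(\<And>j. j < n \<Longrightarrow> f j = Zer D X Y) \<Longrightarrow> hom_sum D X Y f n = Zer D X Y"
  by (induction n) (use preadditiveD(2,3)[OF D] o in auto)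

lemma hom_sum_single:
  assumes D: "preadditive D" and o: "X \<in> Ob D" "Y \<in> Ob D"
  shows "k < n \<Longrightarrow> f k \<in> Hom D X Y \<Longrightarrow> (\<And>j. j < n \<Longrightarrow> j \<noteq> k \<Longrightarrow> f j = Zer D X Y) \<Longrightarrow>
    hom_sum D X Y f n = f k"
proof (induction n)
  case (Suc n)
  show ?case
  proof (cases "k = n")
    case True
    then show ?thesis using Suc.prems hom_sum_zero[OF D o, of n f] preadditiveD(3)[OF D] o by simp
  next
    case False
    then show ?thesis using Suc preadditive_rules(1)[OF D] o by simp
  qed
qed simp

lemma hom_sum_comp_left:
  assumes D: "preadditive D" and o: "X \<in> Ob D" "Y \<in> Ob D" "Z \<in> Ob D" and g: "g \<in> Hom D Y Z"
  shows "(\<And>j. j < n \<Longrightarrow> f j \<in> Hom D X Y) \<Longrightarrow>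
    Cmp D X Y Z g (hom_sum D X Y f n) = hom_sum D X Z (\<lambda>j. Cmp D X Y Z g (f j)) n"
  by (induction n)
    (use preadditive_rules(4)[OF D] preadditiveD(8)[OF D] hom_sum_closed[OF D] o g in auto)

lemma hom_sum_comp_right:
  assumes D: "preadditive D" and o: "X \<in> Ob D" "Y \<in> Ob D" "Z \<in> Ob D" and f: "f \<in> Hom D X Y"
  shows "(\<And>j. j < n \<Longrightarrow> g j \<in> Hom D Y Z) \<Longrightarrow>
    Cmp D X Y Z (hom_sum D Y Z g n) f = hom_sum D X Z (\<lambda>j. Cmp D X Y Z (g j) f) n"
  by (induction n)
    (use preadditive_rules(3)[OF D] preadditiveD(9)[OF D] hom_sum_closed[OF D] o f in auto)

lemma hom_sum_swap:
  assumes D: "preadditive D" and o: "X \<in> Ob D" "Y \<in> Ob D"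
  shows "(\<And>i j. i < m \<Longrightarrow> j < n \<Longrightarrow> f i j \<in> Hom D X Y) \<Longrightarrow>
    hom_sum D X Y (\<lambda>i. hom_sum D X Y (f i) n) m =
    hom_sum D X Y (\<lambda>j. hom_sum D X Y (\<lambda>i. f i j) m) n"
proof (induction m)
  case 0 then show ?case using hom_sum_zero[OF D o, of n "\<lambda>j. Zer D X Y"] by simp
next
  case (Suc m)
  then show ?case
    using hom_sum_add[OF D o, of n "\<lambda>j. hom_sum D X Y (\<lambda>i. f i j) m" "f m"] hom_sum_closed[OF D o]
    by simp
qed

lemma preadditive_direct_sums:
  assumes D: "preadditive D" shows "preadditive (direct_sums D)"
proof -
  note p = preadditiveD[OF D] and r = preadditive_rules[OF D]
    and c = categoryD[OF preadditiveD(1)[OF D]]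
  note hs = hom_sum_closed[OF D]
  have o: "xs ! i \<in> Ob D" if "xs \<in> lists (Ob D)" "i < length xs" for xs i
    using that by (auto simp: in_lists_conv_set)
  let ?H = "\<lambda>xs ys. \<Pi>\<^sub>E (i, j)\<in>{..<length ys} \<times> {..<length xs}. Hom D (xs ! j) (ys ! i)"
  have H: "M (i, j) \<in> Hom D (xs ! j) (ys ! i)"
    if "M \<in> ?H xs ys" "i < length ys" "j < length xs" for M xs ys i j
    using PiE_mem[OF that(1), of "(i, j)"] that by simp
  have HI: "(\<lambda>(i, j)\<in>{..<length ys} \<times> {..<length xs}. M i j) \<in> ?H xs ys"
    if "\<And>i j. i < length ys \<Longrightarrow> j < length xs \<Longrightarrow> M i j \<in> Hom D (xs ! j) (ys ! i)" for M xs ys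
    using that by auto
  have ext: "M = N" if "M \<in> ?H xs ys" "N \<in> ?H xs ys"
    "\<And>i j. i < length ys \<Longrightarrow> j < length xs \<Longrightarrow> M (i, j) = N (i, j)" for M N xs ys
    using that by (intro PiE_ext[of M _ _ N]) auto
  let ?D = "direct_sums D"
  have Ob: "Ob ?D = lists (Ob D)" and Hom: "Hom ?D = ?H"
    by (simp_all add: direct_sums_def)
  have cmp: "Cmp ?D xs ys zs N M (i, k) = hom_sum D (xs ! k) (zs ! i)
      (\<lambda>j. Cmp D (xs ! k) (ys ! j) (zs ! i) (N (i, j)) (M (j, k))) (length ys)"
    if "i < length zs" "k < length xs" for xs ys zs N M i k
    using that by (simp add: direct_sums_def)
  have idm: "Idm ?D xs (i, j) = (if i = j then Idm D (xs ! i) else Zer D (xs ! j) (xs ! i))"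
    if "i < length xs" "j < length xs" for xs i j
    using that by (simp add: direct_sums_def)
  have zer: "Zer ?D xs ys (i, j) = Zer D (xs ! j) (ys ! i)"
    if "i < length ys" "j < length xs" for xs ys i j
    using that by (simp add: direct_sums_def)
  have pls: "Pls ?D xs ys M N (i, j) = Pls D (xs ! j) (ys ! i) (M (i, j)) (N (i, j))"
    if "i < length ys" "j < length xs" for xs ys M N i j
    using that by (simp add: direct_sums_def)
  have cmp_in: "Cmp ?D xs ys zs N M \<in> ?H xs zs"
    if t: "xs \<in> lists (Ob D)" "ys \<in> lists (Ob D)" "zs \<in> lists (Ob D)" "M \<in> ?H xs ys" "N \<in> ?H ys zs"
    for xs ys zs M N
  proof -
    have "hom_sum D (xs ! k) (zs ! i) (\<lambda>j. Cmp D (xs ! k) (ys ! j) (zs ! i) (N (i, j)) (M (j, k)))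
        (length ys) \<in> Hom D (xs ! k) (zs ! i)" if "i < length zs" "k < length xs" for i k
      using that t by (intro hs o c(2)) (auto intro: o H)
    then show ?thesis unfolding direct_sums_def cat.simps by (rule HI)
  qed
  have idm_in: "Idm ?D xs \<in> ?H xs xs" if "xs \<in> lists (Ob D)" for xs
    unfolding direct_sums_def cat.simps using that by (intro HI) (simp add: c(1) p(2) o)
  have zer_in: "Zer ?D xs ys \<in> ?H xs ys" if "xs \<in> lists (Ob D)" "ys \<in> lists (Ob D)" for xs ys
    unfolding direct_sums_def addcat.simps using that by (intro HI) (simp add: p(2) o)
  have pls_in: "Pls ?D xs ys M N \<in> ?H xs ys"
    if "xs \<in> lists (Ob D)" "ys \<in> lists (Ob D)" "M \<in> ?H xs ys" "N \<in> ?H xs ys" for xs ys M N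
    unfolding direct_sums_def addcat.simps using that by (intro HI) (simp add: p(5) o H)
  have idr: "Cmp ?D xs xs ys M (Idm ?D xs) = M"
    if t: "xs \<in> lists (Ob D)" "ys \<in> lists (Ob D)" "M \<in> ?H xs ys" for xs ys M
  proof (rule ext[OF cmp_in[OF t(1,1,2) idm_in[OF t(1)] t(3)] t(3)])
    fix i k assume ik: "i < length ys" "k < length xs"
    let ?f = "\<lambda>j. Cmp D (xs ! k) (xs ! j) (ys ! i) (M (i, j)) (Idm ?D xs (j, k))"
    have h: "M (i, j) \<in> Hom D (xs ! j) (ys ! i)" if "j < length xs" for j using H t ik that by blast
    have k: "?f k = M (i, k)" using c(3) h o t ik by (simp add: idm)
    have "hom_sum D (xs ! k) (ys ! i) ?f (length xs) = ?f k"
    proof (rule hom_sum_single[OF D])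
      show "?f k \<in> Hom D (xs ! k) (ys ! i)" unfolding k using h ik by simp
      show "?f j = Zer D (xs ! k) (ys ! i)" if "j < length xs" "j \<noteq> k" for j
        using that ik t by (simp add: idm r(4) h o)
    qed (use o t ik in auto)
    then show "Cmp ?D xs xs ys M (Idm ?D xs) (i, k) = M (i, k)" using ik k by (simp add: cmp)
  qed
  have idl: "Cmp ?D xs ys ys (Idm ?D ys) M = M"
    if t: "xs \<in> lists (Ob D)" "ys \<in> lists (Ob D)" "M \<in> ?H xs ys" for xs ys M
  proof (rule ext[OF cmp_in[OF t(1,2,2,3) idm_in[OF t(2)]] t(3)])
    fix i k assume ik: "i < length ys" "k < length xs"
    let ?f = "\<lambda>j. Cmp D (xs ! k) (ys ! j) (ys ! i) (Idm ?D ys (i, j)) (M (j, k))"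
    have h: "M (j, k) \<in> Hom D (xs ! k) (ys ! j)" if "j < length ys" for j using H t ik that by blast
    have k: "?f i = M (i, k)" using c(4) h o t ik by (simp add: idm)
    have "hom_sum D (xs ! k) (ys ! i) ?f (length ys) = ?f i"
    proof (rule hom_sum_single[OF D])
      show "?f i \<in> Hom D (xs ! k) (ys ! i)" unfolding k using h ik by simp
      show "?f j = Zer D (xs ! k) (ys ! i)" if "j < length ys" "j \<noteq> i" for j
        using that ik t by (simp add: idm r(3) h o)
    qed (use o t ik in auto)
    then show "Cmp ?D xs ys ys (Idm ?D ys) M (i, k) = M (i, k)" using ik k by (simp add: cmp)
  qed
  have assoc: "Cmp ?D ws ys zs P (Cmp ?D ws xs ys N M) = Cmp ?D ws xs zs (Cmp ?D xs ys zs P N) M"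
    if t: "ws \<in> lists (Ob D)" "xs \<in> lists (Ob D)" "ys \<in> lists (Ob D)" "zs \<in> lists (Ob D)"
      "M \<in> ?H ws xs" "N \<in> ?H xs ys" "P \<in> ?H ys zs" for ws xs ys zs M N P
  proof (rule ext[OF cmp_in[OF t(1,3,4) cmp_in[OF t(1,2,3,5,6)] t(7)]
        cmp_in[OF t(1,2,4,5) cmp_in[OF t(2,3,4,6,7)]]])
    fix i l assume il: "i < length zs" "l < length ws"
    let ?c = "\<lambda>j k. Cmp D (ws ! l) (ys ! j) (zs ! i) (P (i, j))
                     (Cmp D (ws ! l) (xs ! k) (ys ! j) (N (j, k)) (M (k, l)))"
    have h: "M (k, l) \<in> Hom D (ws ! l) (xs ! k)" "N (j, k) \<in> Hom D (xs ! k) (ys ! j)"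
      "P (i, j) \<in> Hom D (ys ! j) (zs ! i)" if "k < length xs" "j < length ys" for j k
      using H[OF t(5)] H[OF t(6)] H[OF t(7)] il that by auto
    have h1: "M (k, l) \<in> Hom D (ws ! l) (xs ! k)" if "k < length xs" for k
      using H[OF t(5)] il that by auto
    have h3: "P (i, j) \<in> Hom D (ys ! j) (zs ! i)" if "j < length ys" for j
      using H[OF t(7)] il that by auto
    have oo: "ws ! l \<in> Ob D" "zs ! i \<in> Ob D" using o t il by auto
    have ox: "xs ! k \<in> Ob D" if "k < length xs" for k using o t that by auto
    have oy: "ys ! j \<in> Ob D" if "j < length ys" for j using o t that by auto
    have "Cmp ?D ws ys zs P (Cmp ?D ws xs ys N M) (i, l) = hom_sum D (ws ! l) (zs ! i)
        (\<lambda>j. hom_sum D (ws ! l) (zs ! i) (?c j) (length xs)) (length ys)"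
      unfolding cmp[OF il]
    proof (rule hom_sum_cong)
      fix j assume j: "j < length ys"
      show "Cmp D (ws ! l) (ys ! j) (zs ! i) (P (i, j)) (Cmp ?D ws xs ys N M (j, l)) =
          hom_sum D (ws ! l) (zs ! i) (?c j) (length xs)"
        unfolding cmp[OF j il(2)]
        by (rule hom_sum_comp_left[OF D oo(1) oy[OF j] oo(2) h3[OF j]])
          (rule c(2)[OF oo(1) ox oy[OF j] h1 h(2)[OF _ j]])
    qed
    also have "\<dots> = hom_sum D (ws ! l) (zs ! i)
        (\<lambda>k. hom_sum D (ws ! l) (zs ! i) (\<lambda>j. ?c j k) (length ys)) (length xs)"
    proof (rule hom_sum_swap[OF D oo])
      fix j k assume jk: "j < length ys" "k < length xs"
      show "?c j k \<in> Hom D (ws ! l) (zs ! i)"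
        by (intro c(2)[OF oo(1) oy[OF jk(1)] oo(2)] c(2)[OF oo(1) ox[OF jk(2)] oy[OF jk(1)]] h(2)[OF jk(2,1)] h1[OF jk(2)] h3[OF jk(1)])
    qed
    also have "\<dots> = Cmp ?D ws xs zs (Cmp ?D xs ys zs P N) M (i, l)"
      unfolding cmp[OF il]
    proof (rule hom_sum_cong)
      fix k assume k: "k < length xs"
      have "hom_sum D (ws ! l) (zs ! i) (\<lambda>j. ?c j k) (length ys) = hom_sum D (ws ! l) (zs ! i)
          (\<lambda>j. Cmp D (ws ! l) (xs ! k) (zs ! i)
             (Cmp D (xs ! k) (ys ! j) (zs ! i) (P (i, j)) (N (j, k))) (M (k, l))) (length ys)"
        by (rule hom_sum_cong) (rule c(5)[OF oo(1) ox[OF k] oy oo(2) h1[OF k] h(2)[OF k] h3])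
      also have "\<dots> = Cmp D (ws ! l) (xs ! k) (zs ! i) (Cmp ?D xs ys zs P N (i, k)) (M (k, l))"
        unfolding cmp[OF il(1) k]
        by (rule hom_sum_comp_right[OF D oo(1) ox[OF k] oo(2) h1[OF k], symmetric])
          (rule c(2)[OF ox[OF k] oy oo(2) h(2)[OF k] h3])
      finally show "hom_sum D (ws ! l) (zs ! i) (\<lambda>j. ?c j k) (length ys) =
          Cmp D (ws ! l) (xs ! k) (zs ! i) (Cmp ?D xs ys zs P N (i, k)) (M (k, l))" .
    qed
    finally show "Cmp ?D ws ys zs P (Cmp ?D ws xs ys N M) (i, l) =
        Cmp ?D ws xs zs (Cmp ?D xs ys zs P N) M (i, l)" .
  qed
  have cat: "category ?D"
    unfolding category_def Ob Hom by (intro conjI ballI idm_in cmp_in idr idl assoc)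
  have zl: "Pls ?D xs ys (Zer ?D xs ys) M = M"
    if t: "xs \<in> lists (Ob D)" "ys \<in> lists (Ob D)" "M \<in> ?H xs ys" for xs ys M
    by (rule ext[OF pls_in[OF t(1,2) zer_in[OF t(1,2)] t(3)] t(3)])
      (simp add: pls zer p(3)[OF o[OF t(1)] o[OF t(2)] H[OF t(3)]])
  have neg: "\<exists>N\<in>?H xs ys. Pls ?D xs ys N M = Zer ?D xs ys"
    if t: "xs \<in> lists (Ob D)" "ys \<in> lists (Ob D)" "M \<in> ?H xs ys" for xs ys M
  proof -
    have "\<exists>f. i < length ys \<longrightarrow> j < length xs \<longrightarrow> f \<in> Hom D (xs ! j) (ys ! i) \<and>
        Pls D (xs ! j) (ys ! i) f (M (i, j)) = Zer D (xs ! j) (ys ! i)" for i j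
      using p(4)[OF o[OF t(1)] o[OF t(2)] H[OF t(3)]] by blast
    then obtain N where N: "\<And>i j. i < length ys \<Longrightarrow> j < length xs \<Longrightarrow> N i j \<in> Hom D (xs ! j) (ys ! i) \<and>
        Pls D (xs ! j) (ys ! i) (N i j) (M (i, j)) = Zer D (xs ! j) (ys ! i)" by metis
    let ?N = "\<lambda>(i, j)\<in>{..<length ys} \<times> {..<length xs}. N i j"
    have N_in: "?N \<in> ?H xs ys" by (rule HI) (use N in blast)
    have "Pls ?D xs ys ?N M = Zer ?D xs ys"
      by (rule ext[OF pls_in[OF t(1,2) N_in t(3)] zer_in[OF t(1,2)]]) (simp add: pls zer N)
    with N_in show ?thesis by blast
  qed
  have comm: "Pls ?D xs ys M N = Pls ?D xs ys N M"
    if t: "xs \<in> lists (Ob D)" "ys \<in> lists (Ob D)" "M \<in> ?H xs ys" "N \<in> ?H xs ys" for xs ys M N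
    by (rule ext[OF pls_in[OF t] pls_in[OF t(1,2,4,3)]])
      (simp add: pls p(6)[OF o[OF t(1)] o[OF t(2)] H[OF t(3)] H[OF t(4)]])
  have passoc: "Pls ?D xs ys (Pls ?D xs ys M N) P = Pls ?D xs ys M (Pls ?D xs ys N P)"
    if t: "xs \<in> lists (Ob D)" "ys \<in> lists (Ob D)" "M \<in> ?H xs ys" "N \<in> ?H xs ys" "P \<in> ?H xs ys"
    for xs ys M N P
    by (rule ext[OF pls_in[OF t(1,2) pls_in[OF t(1-4)] t(5)] pls_in[OF t(1,2,3) pls_in[OF t(1,2,4,5)]]])
      (simp add: pls p(7)[OF o[OF t(1)] o[OF t(2)] H[OF t(3)] H[OF t(4)] H[OF t(5)]])
  have dist_right: "Cmp ?D xs ys zs N (Pls ?D xs ys M M') =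
      Pls ?D xs zs (Cmp ?D xs ys zs N M) (Cmp ?D xs ys zs N M')"
    if t: "xs \<in> lists (Ob D)" "ys \<in> lists (Ob D)" "zs \<in> lists (Ob D)"
      "M \<in> ?H xs ys" "M' \<in> ?H xs ys" "N \<in> ?H ys zs" for xs ys zs M M' N
  proof (rule ext[OF cmp_in[OF t(1,2,3) pls_in[OF t(1,2,4,5)] t(6)]
        pls_in[OF t(1,3) cmp_in[OF t(1,2,3,4,6)] cmp_in[OF t(1,2,3,5,6)]]])
    fix i k assume ik: "i < length zs" "k < length xs"
    have oo: "xs ! k \<in> Ob D" "zs ! i \<in> Ob D" using o t ik by auto
    have oy: "ys ! j \<in> Ob D" if "j < length ys" for j using o t that by auto
    note h = H[OF t(4) _ ik(2)] H[OF t(5) _ ik(2)] H[OF t(6) ik(1)]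
    show "Cmp ?D xs ys zs N (Pls ?D xs ys M M') (i, k) =
        Pls ?D xs zs (Cmp ?D xs ys zs N M) (Cmp ?D xs ys zs N M') (i, k)"
    proof -
      have "hom_sum D (xs ! k) (zs ! i) (\<lambda>j. Cmp D (xs ! k) (ys ! j) (zs ! i) (N (i, j)) (Pls ?D xs ys M M' (j, k))) (length ys) =
          hom_sum D (xs ! k) (zs ! i) (\<lambda>j. Pls D (xs ! k) (zs ! i)
            (Cmp D (xs ! k) (ys ! j) (zs ! i) (N (i, j)) (M (j, k)))
            (Cmp D (xs ! k) (ys ! j) (zs ! i) (N (i, j)) (M' (j, k)))) (length ys)"
      proof (rule hom_sum_cong)
        fix j assume j: "j < length ys"
        show "Cmp D (xs ! k) (ys ! j) (zs ! i) (N (i, j)) (Pls ?D xs ys M M' (j, k)) = Pls D (xs ! k) (zs ! i)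
            (Cmp D (xs ! k) (ys ! j) (zs ! i) (N (i, j)) (M (j, k)))
            (Cmp D (xs ! k) (ys ! j) (zs ! i) (N (i, j)) (M' (j, k)))"
          using p(8)[OF oo(1) oy[OF j] oo(2) h(1)[OF j] h(2)[OF j] h(3)[OF j]] by (simp add: pls[OF j ik(2)])
      qed
      also have "\<dots> = Pls D (xs ! k) (zs ! i)
          (hom_sum D (xs ! k) (zs ! i) (\<lambda>j. Cmp D (xs ! k) (ys ! j) (zs ! i) (N (i, j)) (M (j, k))) (length ys))
          (hom_sum D (xs ! k) (zs ! i) (\<lambda>j. Cmp D (xs ! k) (ys ! j) (zs ! i) (N (i, j)) (M' (j, k))) (length ys))"
        by (rule hom_sum_add[OF D oo]) (rule c(2)[OF oo(1) oy oo(2) h(1) h(3)], assumption+, rule c(2)[OF oo(1) oy oo(2) h(2) h(3)], assumption+)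
      finally show ?thesis unfolding cmp[OF ik] pls[OF ik] .
    qed
  qed
  have dist_left: "Cmp ?D xs ys zs (Pls ?D ys zs N N') M =
      Pls ?D xs zs (Cmp ?D xs ys zs N M) (Cmp ?D xs ys zs N' M)"
    if t: "xs \<in> lists (Ob D)" "ys \<in> lists (Ob D)" "zs \<in> lists (Ob D)"
      "M \<in> ?H xs ys" "N \<in> ?H ys zs" "N' \<in> ?H ys zs" for xs ys zs M N N'
  proof (rule ext[OF cmp_in[OF t(1,2,3,4) pls_in[OF t(2,3,5,6)]]
        pls_in[OF t(1,3) cmp_in[OF t(1,2,3,4,5)] cmp_in[OF t(1,2,3,4,6)]]])
    fix i k assume ik: "i < length zs" "k < length xs"
    have oo: "xs ! k \<in> Ob D" "zs ! i \<in> Ob D" using o t ik by auto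
    have oy: "ys ! j \<in> Ob D" if "j < length ys" for j using o t that by auto
    note h = H[OF t(4) _ ik(2)] H[OF t(5) ik(1)] H[OF t(6) ik(1)]
    show "Cmp ?D xs ys zs (Pls ?D ys zs N N') M (i, k) =
        Pls ?D xs zs (Cmp ?D xs ys zs N M) (Cmp ?D xs ys zs N' M) (i, k)"
    proof -
      have "hom_sum D (xs ! k) (zs ! i) (\<lambda>j. Cmp D (xs ! k) (ys ! j) (zs ! i) (Pls ?D ys zs N N' (i, j)) (M (j, k))) (length ys) =
          hom_sum D (xs ! k) (zs ! i) (\<lambda>j. Pls D (xs ! k) (zs ! i)
            (Cmp D (xs ! k) (ys ! j) (zs ! i) (N (i, j)) (M (j, k)))
            (Cmp D (xs ! k) (ys ! j) (zs ! i) (N' (i, j)) (M (j, k)))) (length ys)"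
      proof (rule hom_sum_cong)
        fix j assume j: "j < length ys"
        show "Cmp D (xs ! k) (ys ! j) (zs ! i) (Pls ?D ys zs N N' (i, j)) (M (j, k)) = Pls D (xs ! k) (zs ! i)
            (Cmp D (xs ! k) (ys ! j) (zs ! i) (N (i, j)) (M (j, k)))
            (Cmp D (xs ! k) (ys ! j) (zs ! i) (N' (i, j)) (M (j, k)))"
          using p(9)[OF oo(1) oy[OF j] oo(2) h(1)[OF j] h(2)[OF j] h(3)[OF j]] by (simp add: pls[OF ik(1) j])
      qed
      also have "\<dots> = Pls D (xs ! k) (zs ! i)
          (hom_sum D (xs ! k) (zs ! i) (\<lambda>j. Cmp D (xs ! k) (ys ! j) (zs ! i) (N (i, j)) (M (j, k))) (length ys))
          (hom_sum D (xs ! k) (zs ! i) (\<lambda>j. Cmp D (xs ! k) (ys ! j) (zs ! i) (N' (i, j)) (M (j, k))) (length ys))"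
        by (rule hom_sum_add[OF D oo]) (rule c(2)[OF oo(1) oy oo(2) h(1) h(2)], assumption+, rule c(2)[OF oo(1) oy oo(2) h(1) h(3)], assumption+)
      finally show ?thesis unfolding cmp[OF ik] pls[OF ik] .
    qed
  qed
  show ?thesis
    unfolding preadditive_def Ob Hom
    by (intro conjI ballI cat zer_in zl neg pls_in comm passoc dist_right dist_left)
qed

lemma preadditive_fp_mod:
  fixes D :: "('o, 'm) addcat"
  assumes D: "preadditive D" shows "preadditive (fp_mod D)"
proof -
  note p = preadditiveD[OF D] and r = preadditive_rules[OF D]
    and c = categoryD[OF preadditiveD(1)[OF D]]
  let ?O = "{(X, Y, a). X \<in> Ob D \<and> Y \<in> Ob D \<and> a \<in> Hom D X Y}"
  define cl where "cl = (\<lambda>(P :: 'o \<times> 'o \<times> 'm) (Q :: 'o \<times> 'o \<times> 'm) g. coker_class D (fst (snd P)) (fst Q) (fst (snd Q)) (snd (snd Q)) g)"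
  define adm where "adm = (\<lambda>(P :: 'o \<times> 'o \<times> 'm) (Q :: 'o \<times> 'o \<times> 'm) g. g \<in> Hom D (fst (snd P)) (fst (snd Q)) \<and>
     (\<exists>h\<in>Hom D (fst P) (fst Q).
        Cmp D (fst P) (fst (snd P)) (fst (snd Q)) g (snd (snd P)) =
        Cmp D (fst P) (fst Q) (fst (snd Q)) (snd (snd Q)) h))"
  let ?t = "\<lambda>P :: 'o \<times> 'o \<times> 'm. fst (snd P)"
  let ?s = "\<lambda>P :: 'o \<times> 'o \<times> 'm. fst P"
  let ?a = "\<lambda>P :: 'o \<times> 'o \<times> 'm. snd (snd P)"
  let ?c = "\<lambda>P Q R. Cmp D (?t P) (?t Q) (?t R)"
  let ?p = "\<lambda>P Q. Pls D (?t P) (?t Q)"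
  let ?z = "\<lambda>P Q. Zer D (?t P) (?t Q)"
  have Ob: "Ob (fp_mod D) = ?O" by (simp add: fp_mod_def)
  have Hom: "Hom (fp_mod D) P Q = {cl P Q g | g. adm P Q g}" for P Q
    by (simp add: fp_mod_def cl_def adm_def case_prod_beta)
  have Idm: "Idm (fp_mod D) P = cl P P (Idm D (?t P))" for P
    by (simp add: fp_mod_def cl_def case_prod_beta)
  have Cmp: "Cmp (fp_mod D) P Q R G F = (\<Union>g\<in>G. \<Union>f\<in>F. cl P R (?c P Q R g f))" for P Q R G F
    by (simp add: fp_mod_def cl_def case_prod_beta)
  have Zer: "Zer (fp_mod D) P Q = cl P Q (?z P Q)" for P Q
    by (simp add: fp_mod_def cl_def case_prod_beta)
  have Pls: "Pls (fp_mod D) P Q F G = (\<Union>f\<in>F. \<Union>g\<in>G. cl P Q (?p P Q f g))" for P Q F G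
    by (simp add: fp_mod_def cl_def case_prod_beta)
  have o: "?s P \<in> Ob D" "?t P \<in> Ob D" "?a P \<in> Hom D (?s P) (?t P)" if "P \<in> ?O" for P
    using that by auto
  have admH: "g \<in> Hom D (?t P) (?t Q)" if "adm P Q g" for P Q g using that by (simp add: adm_def)
  have cl_iff: "f \<in> cl P Q g \<longleftrightarrow>
      (\<exists>s\<in>Hom D (?t P) (?s Q). f = ?p P Q g (Cmp D (?t P) (?s Q) (?t Q) (?a Q) s))" for f P Q g
    by (auto simp: cl_def coker_class_def)
  have as: "Cmp D (?t P) (?s Q) (?t Q) (?a Q) s \<in> Hom D (?t P) (?t Q)"
    if "P \<in> ?O" "Q \<in> ?O" "s \<in> Hom D (?t P) (?s Q)" for P Q s
    by (rule c(2)[OF o(2)[OF that(1)] o(1)[OF that(2)] o(2)[OF that(2)] that(3) o(3)[OF that(2)]])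
  have cl_self: "g \<in> cl P Q g" if t: "P \<in> ?O" "Q \<in> ?O" "g \<in> Hom D (?t P) (?t Q)" for P Q g
    unfolding cl_iff
  proof (rule bexI)
    show "Zer D (?t P) (?s Q) \<in> Hom D (?t P) (?s Q)" by (rule p(2)[OF o(2)[OF t(1)] o(1)[OF t(2)]])
    show "g = ?p P Q g (Cmp D (?t P) (?s Q) (?t Q) (?a Q) (Zer D (?t P) (?s Q)))"
      using r(4)[OF o(2)[OF t(1)] o(1)[OF t(2)] o(2)[OF t(2)] o(3)[OF t(2)]]
        r(1)[OF o(2)[OF t(1)] o(2)[OF t(2)] t(3)] by simp
  qed
  have cl_sub: "cl P Q f \<subseteq> cl P Q g"
    if t: "P \<in> ?O" "Q \<in> ?O" "g \<in> Hom D (?t P) (?t Q)" and f: "f \<in> cl P Q g" for P Q f g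
  proof
    fix x assume "x \<in> cl P Q f"
    then obtain u where u: "u \<in> Hom D (?t P) (?s Q)"
      and x: "x = ?p P Q f (Cmp D (?t P) (?s Q) (?t Q) (?a Q) u)" unfolding cl_iff by blast
    obtain v where v: "v \<in> Hom D (?t P) (?s Q)"
      and f: "f = ?p P Q g (Cmp D (?t P) (?s Q) (?t Q) (?a Q) v)" using f unfolding cl_iff by blast
    note os = o(2)[OF t(1)] o(1)[OF t(2)] o(2)[OF t(2)]
    have "x = ?p P Q g (Cmp D (?t P) (?s Q) (?t Q) (?a Q) (Pls D (?t P) (?s Q) v u))"
      unfolding x f p(7)[OF os(1,3) t(3) as[OF t(1,2) v] as[OF t(1,2) u]]
        p(8)[OF os v u o(3)[OF t(2)]] ..
    then show "x \<in> cl P Q g" unfolding cl_iff using p(5)[OF os(1,2) v u] by blast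
  qed
  have cl_H: "f \<in> Hom D (?t P) (?t Q)"
    if t: "P \<in> ?O" "Q \<in> ?O" "g \<in> Hom D (?t P) (?t Q)" "f \<in> cl P Q g" for P Q f g
  proof -
    obtain v where "v \<in> Hom D (?t P) (?s Q)" "f = ?p P Q g (Cmp D (?t P) (?s Q) (?t Q) (?a Q) v)"
      using t(4) unfolding cl_iff by blast
    then show ?thesis using p(5)[OF o(2)[OF t(1)] o(2)[OF t(2)] t(3) as[OF t(1,2)]] by simp
  qed
  have cl_sym: "g \<in> cl P Q f"
    if t: "P \<in> ?O" "Q \<in> ?O" "g \<in> Hom D (?t P) (?t Q)" and f: "f \<in> cl P Q g" for P Q f g
  proof -
    note os = o(2)[OF t(1)] o(1)[OF t(2)] o(2)[OF t(2)]
    obtain v where v: "v \<in> Hom D (?t P) (?s Q)"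
      and f: "f = ?p P Q g (Cmp D (?t P) (?s Q) (?t Q) (?a Q) v)" using f unfolding cl_iff by blast
    obtain u where u: "u \<in> Hom D (?t P) (?s Q)" "Pls D (?t P) (?s Q) u v = Zer D (?t P) (?s Q)"
      using p(4)[OF os(1,2) v] by blast
    have "?p P Q f (Cmp D (?t P) (?s Q) (?t Q) (?a Q) u) =
        ?p P Q g (Cmp D (?t P) (?s Q) (?t Q) (?a Q) (Pls D (?t P) (?s Q) v u))"
      unfolding f p(7)[OF os(1,3) t(3) as[OF t(1,2) v] as[OF t(1,2) u(1)]]
        p(8)[OF os v u(1) o(3)[OF t(2)]] ..
    also have "\<dots> = g"
      unfolding p(6)[OF os(1,2) v u(1)] u(2) r(4)[OF os o(3)[OF t(2)]] by (rule r(1)[OF os(1,3) t(3)])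
    finally show ?thesis unfolding cl_iff using u(1) by force
  qed
  have cl_eq: "cl P Q f = cl P Q g"
    if t: "P \<in> ?O" "Q \<in> ?O" "g \<in> Hom D (?t P) (?t Q)" "f \<in> cl P Q g" for P Q f g
    by (rule equalityI[OF cl_sub[OF t] cl_sub[OF t(1,2) cl_H[OF t] cl_sym[OF t]]])
  have UN2: "(\<Union>f\<in>F. \<Union>g\<in>G. K f g) = k" if "f0 \<in> F" "g0 \<in> G" "\<And>f g. f \<in> F \<Longrightarrow> g \<in> G \<Longrightarrow> K f g = k"
    for F G :: "'m set" and K :: "'m \<Rightarrow> 'm \<Rightarrow> 'm set" and k f0 g0
    using that by auto
  have pls: "Pls (fp_mod D) P Q (cl P Q f) (cl P Q g) = cl P Q (?p P Q f g)"
    if t: "P \<in> ?O" "Q \<in> ?O" "adm P Q f" "adm P Q g" for P Q f g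
    unfolding Pls
  proof (rule UN2[OF cl_self[OF t(1,2) admH[OF t(3)]] cl_self[OF t(1,2) admH[OF t(4)]]])
    fix f' g' assume f': "f' \<in> cl P Q f" and g': "g' \<in> cl P Q g"
    note os = o(2)[OF t(1)] o(1)[OF t(2)] o(2)[OF t(2)]
    note fg = admH[OF t(3)] admH[OF t(4)]
    obtain u where u: "u \<in> Hom D (?t P) (?s Q)"
      and f: "f' = ?p P Q f (Cmp D (?t P) (?s Q) (?t Q) (?a Q) u)" using f' unfolding cl_iff by blast
    obtain v where v: "v \<in> Hom D (?t P) (?s Q)"
      and g: "g' = ?p P Q g (Cmp D (?t P) (?s Q) (?t Q) (?a Q) v)" using g' unfolding cl_iff by blast
    have "?p P Q f' g' = ?p P Q (?p P Q f g) (Cmp D (?t P) (?s Q) (?t Q) (?a Q) (Pls D (?t P) (?s Q) u v))"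
      unfolding f g r(5)[OF os(1,3) fg(1) as[OF t(1,2) u] fg(2) as[OF t(1,2) v]]
        p(8)[OF os u v o(3)[OF t(2)]] ..
    then have "?p P Q f' g' \<in> cl P Q (?p P Q f g)"
      unfolding cl_iff using p(5)[OF os(1,2) u v] by blast
    then show "cl P Q (?p P Q f' g') = cl P Q (?p P Q f g)"
      by (rule cl_eq[OF t(1,2) p(5)[OF os(1,3) fg]])
  qed
  have cmp: "Cmp (fp_mod D) P Q R (cl Q R g) (cl P Q f) = cl P R (?c P Q R g f)"
    if t: "P \<in> ?O" "Q \<in> ?O" "R \<in> ?O" "adm P Q f" "adm Q R g" for P Q R f g
    unfolding Cmp
  proof (rule UN2[OF cl_self[OF t(2,3) admH[OF t(5)]] cl_self[OF t(1,2) admH[OF t(4)]]])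
    fix f' g' assume f': "f' \<in> cl P Q f" and g': "g' \<in> cl Q R g"
    note oP = o[OF t(1)] and oQ = o[OF t(2)] and oR = o[OF t(3)]
    note fH = admH[OF t(4)] and gH = admH[OF t(5)]
    have f'H: "f' \<in> Hom D (?t P) (?t Q)" by (rule cl_H[OF t(1,2) fH f'])
    obtain u where u: "u \<in> Hom D (?t P) (?s Q)"
      and f: "f' = ?p P Q f (Cmp D (?t P) (?s Q) (?t Q) (?a Q) u)" using f' unfolding cl_iff by blast
    obtain v where v: "v \<in> Hom D (?t Q) (?s R)"
      and g: "g' = ?p Q R g (Cmp D (?t Q) (?s R) (?t R) (?a R) v)" using g' unfolding cl_iff by blast
    obtain h where h: "h \<in> Hom D (?s Q) (?s R)"
      and gh: "Cmp D (?s Q) (?t Q) (?t R) g (?a Q) = Cmp D (?s Q) (?s R) (?t R) (?a R) h"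
      using t(5) unfolding adm_def by blast
    let ?w1 = "Cmp D (?t P) (?s Q) (?s R) h u"
    let ?w2 = "Cmp D (?t P) (?t Q) (?s R) v f'"
    have w: "?w1 \<in> Hom D (?t P) (?s R)" "?w2 \<in> Hom D (?t P) (?s R)"
      by (rule c(2)[OF oP(2) oQ(1) oR(1) u h], rule c(2)[OF oP(2) oQ(2) oR(1) f'H v])
    have e1: "?c P Q R g f' = ?p P R (?c P Q R g f) (Cmp D (?t P) (?s R) (?t R) (?a R) ?w1)"
      unfolding f p(8)[OF oP(2) oQ(2) oR(2) fH as[OF t(1,2) u] gH]
        c(5)[OF oP(2) oQ(1,2) oR(2) u oQ(3) gH] gh
        c(5)[OF oP(2) oQ(1) oR(1,2) u h oR(3)] ..
    have e2: "?c P Q R (Cmp D (?t Q) (?s R) (?t R) (?a R) v) f' = Cmp D (?t P) (?s R) (?t R) (?a R) ?w2"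
      by (rule c(5)[OF oP(2) oQ(2) oR(1,2) f'H v oR(3), symmetric])
    have gf: "?c P Q R g f \<in> Hom D (?t P) (?t R)" by (rule c(2)[OF oP(2) oQ(2) oR(2) fH gH])
    have "?c P Q R g' f' = ?p P R (?c P Q R g f)
        (Cmp D (?t P) (?s R) (?t R) (?a R) (Pls D (?t P) (?s R) ?w1 ?w2))"
      unfolding g p(9)[OF oP(2) oQ(2) oR(2) f'H gH as[OF t(2,3) v]] e1 e2
        p(7)[OF oP(2) oR(2) gf as[OF t(1,3) w(1)] as[OF t(1,3) w(2)]]
        p(8)[OF oP(2) oR(1,2) w oR(3)] ..
    then have "?c P Q R g' f' \<in> cl P R (?c P Q R g f)"
      unfolding cl_iff using p(5)[OF oP(2) oR(1) w] by blast
    then show "cl P R (?c P Q R g' f') = cl P R (?c P Q R g f)" by (rule cl_eq[OF t(1,3) gf])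
  qed
  have adm_idm: "adm P P (Idm D (?t P))" if t: "P \<in> ?O" for P
    unfolding adm_def using c(1)[OF o(1)[OF t]] c(1)[OF o(2)[OF t]]
      c(3)[OF o[OF t]] c(4)[OF o[OF t]] by (auto intro!: bexI[of _ "Idm D (?s P)"])
  have adm_zer: "adm P Q (?z P Q)" if t: "P \<in> ?O" "Q \<in> ?O" for P Q
    unfolding adm_def
    using r(3)[OF o(1,2)[OF t(1)] o(2)[OF t(2)] o(3)[OF t(1)]]
      r(4)[OF o(1)[OF t(1)] o(1,2)[OF t(2)] o(3)[OF t(2)]]
      p(2)[OF o(2)[OF t(1)] o(2)[OF t(2)]] p(2)[OF o(1)[OF t(1)] o(1)[OF t(2)]]
    by (auto intro!: bexI[of _ "Zer D (?s P) (?s Q)"])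
  have adm_pls: "adm P Q (?p P Q f g)" if t: "P \<in> ?O" "Q \<in> ?O" "adm P Q f" "adm P Q g" for P Q f g
  proof -
    note oP = o[OF t(1)] and oQ = o[OF t(2)] and fg = admH[OF t(3)] admH[OF t(4)]
    obtain h where h: "h \<in> Hom D (?s P) (?s Q)"
      "Cmp D (?s P) (?t P) (?t Q) f (?a P) = Cmp D (?s P) (?s Q) (?t Q) (?a Q) h"
      using t(3) unfolding adm_def by blast
    obtain k where k: "k \<in> Hom D (?s P) (?s Q)"
      "Cmp D (?s P) (?t P) (?t Q) g (?a P) = Cmp D (?s P) (?s Q) (?t Q) (?a Q) k"
      using t(4) unfolding adm_def by blast
    have "Cmp D (?s P) (?t P) (?t Q) (?p P Q f g) (?a P) =
        Cmp D (?s P) (?s Q) (?t Q) (?a Q) (Pls D (?s P) (?s Q) h k)"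
      unfolding p(9)[OF oP(1,2) oQ(2) oP(3) fg] h(2) k(2) p(8)[OF oP(1) oQ(1,2) h(1) k(1) oQ(3)] ..
    then show ?thesis unfolding adm_def
      using p(5)[OF oP(2) oQ(2) fg] p(5)[OF oP(1) oQ(1) h(1) k(1)] by blast
  qed
  have adm_cmp: "adm P R (?c P Q R g f)"
    if t: "P \<in> ?O" "Q \<in> ?O" "R \<in> ?O" "adm P Q f" "adm Q R g" for P Q R f g
  proof -
    note oP = o[OF t(1)] and oQ = o[OF t(2)] and oR = o[OF t(3)]
    note fH = admH[OF t(4)] and gH = admH[OF t(5)]
    obtain h where h: "h \<in> Hom D (?s P) (?s Q)"
      "Cmp D (?s P) (?t P) (?t Q) f (?a P) = Cmp D (?s P) (?s Q) (?t Q) (?a Q) h"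
      using t(4) unfolding adm_def by blast
    obtain k where k: "k \<in> Hom D (?s Q) (?s R)"
      "Cmp D (?s Q) (?t Q) (?t R) g (?a Q) = Cmp D (?s Q) (?s R) (?t R) (?a R) k"
      using t(5) unfolding adm_def by blast
    have "Cmp D (?s P) (?t P) (?t R) (?c P Q R g f) (?a P) =
        Cmp D (?s P) (?s R) (?t R) (?a R) (Cmp D (?s P) (?s Q) (?s R) k h)"
      unfolding c(5)[OF oP(1,2) oQ(2) oR(2) oP(3) fH gH, symmetric] h(2)
        c(5)[OF oP(1) oQ(1,2) oR(2) h(1) oQ(3) gH] k(2)
        c(5)[OF oP(1) oQ(1) oR(1,2) h(1) k(1) oR(3)] ..
    then show ?thesis unfolding adm_def
      using c(2)[OF oP(2) oQ(2) oR(2) fH gH] c(2)[OF oP(1) oQ(1) oR(1) h(1) k(1)] by blast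
  qed
  have adm_neg: "\<exists>g. adm P Q g \<and> ?p P Q g f = ?z P Q" if t: "P \<in> ?O" "Q \<in> ?O" "adm P Q f" for P Q f
  proof -
    note oP = o[OF t(1)] and oQ = o[OF t(2)] and fH = admH[OF t(3)]
    obtain h where h: "h \<in> Hom D (?s P) (?s Q)"
      "Cmp D (?s P) (?t P) (?t Q) f (?a P) = Cmp D (?s P) (?s Q) (?t Q) (?a Q) h"
      using t(3) unfolding adm_def by blast
    obtain g where g: "g \<in> Hom D (?t P) (?t Q)" "?p P Q g f = ?z P Q" using p(4)[OF oP(2) oQ(2) fH] by blast
    obtain k where k: "k \<in> Hom D (?s P) (?s Q)" "Pls D (?s P) (?s Q) k h = Zer D (?s P) (?s Q)"
      using p(4)[OF oP(1) oQ(1) h(1)] by blast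
    let ?x = "Cmp D (?s P) (?t P) (?t Q) f (?a P)"
    let ?y = "Cmp D (?s P) (?t P) (?t Q) g (?a P)"
    let ?w = "Cmp D (?s P) (?s Q) (?t Q) (?a Q) k"
    have H: "?x \<in> Hom D (?s P) (?t Q)" "?y \<in> Hom D (?s P) (?t Q)" "?w \<in> Hom D (?s P) (?t Q)"
      by (rule c(2)[OF oP(1,2) oQ(2) oP(3) fH], rule c(2)[OF oP(1,2) oQ(2) oP(3) g(1)],
          rule c(2)[OF oP(1) oQ(1,2) k(1) oQ(3)])
    have "Pls D (?s P) (?t Q) ?y ?x = Zer D (?s P) (?t Q)"
      unfolding p(9)[OF oP(1,2) oQ(2) oP(3) g(1) fH, symmetric] g(2)
      by (rule r(3)[OF oP(1,2) oQ(2) oP(3)])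
    moreover have "Pls D (?s P) (?t Q) ?w ?x = Zer D (?s P) (?t Q)"
      unfolding h(2) p(8)[OF oP(1) oQ(1,2) k(1) h(1) oQ(3), symmetric] k(2)
      by (rule r(4)[OF oP(1) oQ(1,2) oQ(3)])
    ultimately have "Pls D (?s P) (?t Q) ?x ?y = Pls D (?s P) (?t Q) ?x ?w"
      unfolding p(6)[OF oP(1) oQ(2) H(2,1)] p(6)[OF oP(1) oQ(2) H(3,1)] by simp
    then have "?y = ?w" by (rule r(2)[OF oP(1) oQ(2) H(2,3,1)])
    then show ?thesis using g k(1) unfolding adm_def by blast
  qed
  have in_Hom: "cl P Q g \<in> Hom (fp_mod D) P Q" if "adm P Q g" for P Q g
    using that unfolding Hom by blast
  have cat: "category (fp_mod D)"
    unfolding category_def Ob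
  proof (intro conjI ballI)
    fix P assume "P \<in> ?O"
    then show "Idm (fp_mod D) P \<in> Hom (fp_mod D) P P" unfolding Idm by (rule in_Hom[OF adm_idm])
  next
    fix P Q R F G assume t: "P \<in> ?O" "Q \<in> ?O" "R \<in> ?O"
      and F: "F \<in> Hom (fp_mod D) P Q" and G: "G \<in> Hom (fp_mod D) Q R"
    obtain f where f: "F = cl P Q f" "adm P Q f" using F unfolding Hom by blast
    obtain g where g: "G = cl Q R g" "adm Q R g" using G unfolding Hom by blast
    show "Cmp (fp_mod D) P Q R G F \<in> Hom (fp_mod D) P R"
      unfolding f(1) g(1) cmp[OF t f(2) g(2)] by (rule in_Hom[OF adm_cmp[OF t f(2) g(2)]])
  next
    fix P Q F assume t: "P \<in> ?O" "Q \<in> ?O" and F: "F \<in> Hom (fp_mod D) P Q"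
    obtain f where f: "F = cl P Q f" "adm P Q f" using F unfolding Hom by blast
    show "Cmp (fp_mod D) P P Q F (Idm (fp_mod D) P) = F"
      unfolding f(1) Idm cmp[OF t(1,1,2) adm_idm[OF t(1)] f(2)]
        c(3)[OF o(2)[OF t(1)] o(2)[OF t(2)] admH[OF f(2)]] ..
    show "Cmp (fp_mod D) P Q Q (Idm (fp_mod D) Q) F = F"
      unfolding f(1) Idm cmp[OF t(1,2,2) f(2) adm_idm[OF t(2)]]
        c(4)[OF o(2)[OF t(1)] o(2)[OF t(2)] admH[OF f(2)]] ..
  next
    fix P Q R S F G H assume t: "P \<in> ?O" "Q \<in> ?O" "R \<in> ?O" "S \<in> ?O"
      and F: "F \<in> Hom (fp_mod D) P Q" and G: "G \<in> Hom (fp_mod D) Q R" and H: "H \<in> Hom (fp_mod D) R S"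
    obtain f where f: "F = cl P Q f" "adm P Q f" using F unfolding Hom by blast
    obtain g where g: "G = cl Q R g" "adm Q R g" using G unfolding Hom by blast
    obtain h where h: "H = cl R S h" "adm R S h" using H unfolding Hom by blast
    show "Cmp (fp_mod D) P R S H (Cmp (fp_mod D) P Q R G F) =
        Cmp (fp_mod D) P Q S (Cmp (fp_mod D) Q R S H G) F"
      unfolding f(1) g(1) h(1) cmp[OF t(1-3) f(2) g(2)] cmp[OF t(2-4) g(2) h(2)]
        cmp[OF t(1,3,4) adm_cmp[OF t(1-3) f(2) g(2)] h(2)]
        cmp[OF t(1,2,4) f(2) adm_cmp[OF t(2-4) g(2) h(2)]]
        c(5)[OF o(2)[OF t(1)] o(2)[OF t(2)] o(2)[OF t(3)] o(2)[OF t(4)] admH[OF f(2)] admH[OF g(2)] admH[OF h(2)]] ..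
  qed
  show ?thesis
    unfolding preadditive_def Ob
  proof (intro conjI ballI cat)
    fix P Q assume t: "P \<in> ?O" "Q \<in> ?O"
    show "Zer (fp_mod D) P Q \<in> Hom (fp_mod D) P Q" unfolding Zer by (rule in_Hom[OF adm_zer[OF t]])
    fix F assume F: "F \<in> Hom (fp_mod D) P Q"
    obtain f where f: "F = cl P Q f" "adm P Q f" using F unfolding Hom by blast
    show "Pls (fp_mod D) P Q (Zer (fp_mod D) P Q) F = F"
      unfolding f(1) Zer pls[OF t adm_zer[OF t] f(2)] p(3)[OF o(2)[OF t(1)] o(2)[OF t(2)] admH[OF f(2)]] ..
    obtain g where g: "adm P Q g" "?p P Q g f = ?z P Q" using adm_neg[OF t f(2)] by blast
    have "Pls (fp_mod D) P Q (cl P Q g) F = Zer (fp_mod D) P Q"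
      unfolding f(1) Zer pls[OF t g(1) f(2)] g(2) ..
    then show "\<exists>F'\<in>Hom (fp_mod D) P Q. Pls (fp_mod D) P Q F' F = Zer (fp_mod D) P Q"
      using in_Hom[OF g(1)] by blast
    fix G assume G: "G \<in> Hom (fp_mod D) P Q"
    obtain g where g: "G = cl P Q g" "adm P Q g" using G unfolding Hom by blast
    show "Pls (fp_mod D) P Q F G \<in> Hom (fp_mod D) P Q"
      unfolding f(1) g(1) pls[OF t f(2) g(2)] by (rule in_Hom[OF adm_pls[OF t f(2) g(2)]])
    show "Pls (fp_mod D) P Q F G = Pls (fp_mod D) P Q G F"
      unfolding f(1) g(1) pls[OF t f(2) g(2)] pls[OF t g(2) f(2)]
        p(6)[OF o(2)[OF t(1)] o(2)[OF t(2)] admH[OF f(2)] admH[OF g(2)]] ..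
    fix H assume H: "H \<in> Hom (fp_mod D) P Q"
    obtain h where h: "H = cl P Q h" "adm P Q h" using H unfolding Hom by blast
    show "Pls (fp_mod D) P Q (Pls (fp_mod D) P Q F G) H = Pls (fp_mod D) P Q F (Pls (fp_mod D) P Q G H)"
      unfolding f(1) g(1) h(1) pls[OF t f(2) g(2)] pls[OF t g(2) h(2)]
        pls[OF t adm_pls[OF t f(2) g(2)] h(2)] pls[OF t f(2) adm_pls[OF t g(2) h(2)]]
        p(7)[OF o(2)[OF t(1)] o(2)[OF t(2)] admH[OF f(2)] admH[OF g(2)] admH[OF h(2)]] ..
  next
    fix P Q R F F' G assume t: "P \<in> ?O" "Q \<in> ?O" "R \<in> ?O"
      and F: "F \<in> Hom (fp_mod D) P Q" and F': "F' \<in> Hom (fp_mod D) P Q" and G: "G \<in> Hom (fp_mod D) Q R"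
    obtain f where f: "F = cl P Q f" "adm P Q f" using F unfolding Hom by blast
    obtain f' where f': "F' = cl P Q f'" "adm P Q f'" using F' unfolding Hom by blast
    obtain g where g: "G = cl Q R g" "adm Q R g" using G unfolding Hom by blast
    show "Cmp (fp_mod D) P Q R G (Pls (fp_mod D) P Q F F') =
        Pls (fp_mod D) P R (Cmp (fp_mod D) P Q R G F) (Cmp (fp_mod D) P Q R G F')"
      unfolding f(1) f'(1) g(1) pls[OF t(1,2) f(2) f'(2)] cmp[OF t adm_pls[OF t(1,2) f(2) f'(2)] g(2)]
        cmp[OF t f(2) g(2)] cmp[OF t f'(2) g(2)]
        pls[OF t(1,3) adm_cmp[OF t f(2) g(2)] adm_cmp[OF t f'(2) g(2)]]
        p(8)[OF o(2)[OF t(1)] o(2)[OF t(2)] o(2)[OF t(3)] admH[OF f(2)] admH[OF f'(2)] admH[OF g(2)]] ..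
  next
    fix P Q R F G G' assume t: "P \<in> ?O" "Q \<in> ?O" "R \<in> ?O"
      and F: "F \<in> Hom (fp_mod D) P Q" and G: "G \<in> Hom (fp_mod D) Q R" and G': "G' \<in> Hom (fp_mod D) Q R"
    obtain f where f: "F = cl P Q f" "adm P Q f" using F unfolding Hom by blast
    obtain g where g: "G = cl Q R g" "adm Q R g" using G unfolding Hom by blast
    obtain g' where g': "G' = cl Q R g'" "adm Q R g'" using G' unfolding Hom by blast
    show "Cmp (fp_mod D) P Q R (Pls (fp_mod D) Q R G G') F =
        Pls (fp_mod D) P R (Cmp (fp_mod D) P Q R G F) (Cmp (fp_mod D) P Q R G' F)"
      unfolding f(1) g(1) g'(1) pls[OF t(2,3) g(2) g'(2)] cmp[OF t f(2) adm_pls[OF t(2,3) g(2) g'(2)]]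
        cmp[OF t f(2) g(2)] cmp[OF t f(2) g'(2)]
        pls[OF t(1,3) adm_cmp[OF t f(2) g(2)] adm_cmp[OF t f(2) g'(2)]]
        p(9)[OF o(2)[OF t(1)] o(2)[OF t(2)] o(2)[OF t(3)] admH[OF f(2)] admH[OF g(2)] admH[OF g'(2)]] ..
  qed
qed

lemma preadditive_additive_hull: "category C \<Longrightarrow> preadditive (additive_hull C)"
  unfolding additive_hull_def by (intro preadditive_direct_sums preadditive_linearisation)

lemma preadditive_abelian_hull: "preadditive D \<Longrightarrow> preadditive (abelian_hull D)"
  unfolding abelian_hull_def by (intro preadditive_opposite preadditive_fp_mod)

lemma loc_rel_is_path:
  assumes C: "category C" and W: "\<And>X Y. W X Y \<subseteq> Hom C X Y" and rel: "loc_rel C W X Y p q"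
  shows "is_path (zquiver C W) X p Y \<and> is_path (zquiver C W) X q Y"
  using rel
proof (induction rule: loc_rel.induct)
  case (ident X)
  then show ?case using categoryD(1)[OF C] by (simp add: zquiver_def)
next
  case (comp X Y Z f g)
  then show ?case using categoryD(2)[OF C, of X Y Z f g] by (simp add: zquiver_def)
qed (auto simp: is_path_append, (use W in \<open>auto simp: zquiver_def\<close>))

lemma equiv_loc_rel:
  assumes C: "category C" and W: "\<And>X Y. W X Y \<subseteq> Hom C X Y"
  shows "equiv {p. is_path (zquiver C W) X p Y} {(p, q). loc_rel C W X Y p q}"
proof (rule equivI)
  show "{(p, q). loc_rel C W X Y p q} \<subseteq>
      {p. is_path (zquiver C W) X p Y} \<times> {p. is_path (zquiver C W) X p Y}"
    using loc_rel_is_path[OF C W] by blast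
  show "refl_on {p. is_path (zquiver C W) X p Y} {(p, q). loc_rel C W X Y p q}"
    by (auto simp: refl_on_def intro: loc_rel.refl)
  show "sym {(p, q). loc_rel C W X Y p q}" by (auto simp: sym_def intro: loc_rel.sym)
  show "trans {(p, q). loc_rel C W X Y p q}" by (auto simp: trans_def intro: loc_rel.trans)
qed

lemma category_localisation:
  assumes C: "category C" and W: "\<And>X Y. W X Y \<subseteq> Hom C X Y" shows "category (localisation C W)"
proof -
  let ?P = "is_path (zquiver C W)"
  define cl where "cl = (\<lambda>X Y p. {q. loc_rel C W X Y p q})"
  have Ob: "Ob (localisation C W) = Ob C" by (simp add: localisation_def)
  have Hom: "Hom (localisation C W) X Y = {cl X Y p | p. ?P X p Y}" for X Y
    by (auto simp: localisation_def cl_def quotient_def)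
  have Idm: "Idm (localisation C W) X = cl X X []" for X
    by (simp add: localisation_def cl_def)
  have Cmp: "Cmp (localisation C W) X Y Z G F = (\<Union>q\<in>G. \<Union>p\<in>F. cl X Z (p @ q))" for X Y Z G F
    by (simp add: localisation_def cl_def)
  have cl_eq: "cl X Y p = cl X Y q" if "loc_rel C W X Y p q" for X Y p q
    unfolding cl_def using that by (blast intro: loc_rel.sym loc_rel.trans)
  have cmp: "Cmp (localisation C W) X Y Z (cl Y Z q) (cl X Y p) = cl X Z (p @ q)"
    if t: "?P X p Y" "?P Y q Z" for X Y Z p q
  proof -
    have "cl X Z (p' @ q') = cl X Z (p @ q)" if "p' \<in> cl X Y p" "q' \<in> cl Y Z q" for p' q'
      using that by (intro cl_eq[symmetric] loc_rel.concat) (auto simp: cl_def)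
    moreover have "p \<in> cl X Y p" "q \<in> cl Y Z q" using t by (auto simp: cl_def intro: loc_rel.refl)
    ultimately show ?thesis unfolding Cmp by blast
  qed
  have nil: "?P X [] X" if "X \<in> Ob C" for X using that by (simp add: zquiver_def)
  show ?thesis
    unfolding category_def Ob Hom
  proof (intro conjI ballI)
    fix X assume "X \<in> Ob C"
    then show "Idm (localisation C W) X \<in> {cl X X p | p. ?P X p X}" unfolding Idm using nil by blast
  next
    fix X Y Z F G assume "F \<in> {cl X Y p | p. ?P X p Y}" "G \<in> {cl Y Z p | p. ?P Y p Z}"
    then show "Cmp (localisation C W) X Y Z G F \<in> {cl X Z p | p. ?P X p Z}"
      using cmp is_path_append by (smt (verit, best) mem_Collect_eq)
  next
    fix X Y F assume o: "X \<in> Ob C" "Y \<in> Ob C" and "F \<in> {cl X Y p | p. ?P X p Y}"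
    then obtain p where p: "F = cl X Y p" "?P X p Y" by blast
    show "Cmp (localisation C W) X X Y F (Idm (localisation C W) X) = F"
      "Cmp (localisation C W) X Y Y (Idm (localisation C W) Y) F = F"
      using cmp[OF nil[OF o(1)] p(2)] cmp[OF p(2) nil[OF o(2)]] by (simp_all add: p Idm)
  next
    fix X Y Z U F G H assume F: "F \<in> {cl X Y p | p. ?P X p Y}"
      and G: "G \<in> {cl Y Z p | p. ?P Y p Z}" and H: "H \<in> {cl Z U p | p. ?P Z p U}"
    obtain p where p: "F = cl X Y p" "?P X p Y" using F by blast
    obtain q where q: "G = cl Y Z q" "?P Y q Z" using G by blast
    obtain r where r: "H = cl Z U r" "?P Z r U" using H by blast
    show "Cmp (localisation C W) X Z U H (Cmp (localisation C W) X Y Z G F) =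
        Cmp (localisation C W) X Y U (Cmp (localisation C W) Y Z U H G) F"
      by (simp add: p(1) q(1) r(1) cmp[OF p(2) q(2)] cmp[OF q(2) r(2)]
          cmp[OF is_path_append[OF p(2) q(2)] r(2)] cmp[OF p(2) is_path_append[OF q(2) r(2)]])
  qed
qed

end

theory Submission
  imports Defs "HOL-Library.Function_Algebras"
begin

text \<open>
  All Hom-sets of the path category have at most one element, so those of its additive
  hull are countable, and passing to formal cokernels or kernels only takes quotients of subsets; this
  gives the first claim.

  For the second claim let \<open>R\<close> be the polynomial ring over the integers with one variable \<open>t\<^sub>i\<close> for
  each \<open>i\<close> in \<open>I\<close>, and send every vertex to \<open>R\<close>, every \<open>\<sigma>\<^sub>i\<close> to the identity and \<open>\<tau>\<^sub>i\<close> to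
  multiplication by \<open>t\<^sub>i\<close>. This extends to an exact functor on the abelian hull. Its kernel \<open>S\<close> is a
  Serre subcategory containing the kernel and the cokernel of every \<open>\<sigma>\<^sub>i\<close>, and the functor factors
  through the quotient by \<open>S\<close>. There the fractions \<open>\<tau>\<^sub>i \<sigma>\<^sub>i\<inverse> : x \<rightarrow> z\<close> are pairwise different because
  the \<open>t\<^sub>i\<close> are, so \<open>I\<close> embeds into a single Hom-set.
\<close>


section \<open>Formal cokernels\<close>

text \<open>A HOL function cannot assign a different group type to each object, so all values of the
  functor are subquotients \<open>V X / N X\<close> of one fixed group. This form survives both
  completions: a formal cokernel enlarges the denominator \<open>N\<close>, a formal kernel shrinks
  the numerator \<open>V\<close>. The price is that morphisms act on representatives and the functor
  laws hold modulo \<open>N\<close> only. Exactness is expressed by what acts as zero on values. It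
  is tested on explicit objects built from direct sums in \<open>D\<close>, and in this form it
  already makes the kernel of the functor a Serre subcategory and makes the functor invert what the
  quotient inverts. The Hom-sets of the quotient consist of classes of zigzags. A backward arrow has
  no preferred inverse on representatives, but it has a converse relation; so the invariant of a
  class of zigzags is a relation on the fixed group, and the relation attached to an index
  \<open>i\<close> relates \<open>1\<close> to the variable of \<open>i\<close>. The polynomial ring
  may be as large as \<open>I\<close>: smallness concerns the Hom-sets of the hull, while the
  functor only serves to tell fractions apart.\<close>

lemma UN2_const:
  assumes "x \<in> A" "y \<in> B" "\<And>x y. y \<in> B \<Longrightarrow> x \<in> A \<Longrightarrow> f x y = C"
  shows "(\<Union>x\<in>A. \<Union>y\<in>B. f x y) = C"
  using assms by auto

locale preadditive_category =
  fixes D :: "('o, 'm) addcat"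
  assumes D: "preadditive D"
begin

lemmas closed = categoryD(1,2)[OF preadditiveD(1)[OF D]] preadditiveD(2,5)[OF D]
lemmas ident = categoryD(3,4)[OF preadditiveD(1)[OF D]]
lemmas assoc = categoryD(5)[OF preadditiveD(1)[OF D]]
lemmas zero = preadditiveD(3)[OF D] preadditive_rules(1,3,4)[OF D]
lemmas neg = preadditiveD(4)[OF D]
lemmas pls_commute = preadditiveD(6)[OF D]
lemmas pls_assoc = preadditiveD(7)[OF D]
lemmas distrib = preadditiveD(8,9)[OF D]
lemmas cancel = preadditive_rules(2)[OF D]

lemma pls_left_commute:
  "\<lbrakk>X \<in> Ob D; Y \<in> Ob D; f \<in> Hom D X Y; g \<in> Hom D X Y; h \<in> Hom D X Y\<rbrakk>
    \<Longrightarrow> Pls D X Y f (Pls D X Y g h) = Pls D X Y g (Pls D X Y f h)"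
  using pls_assoc[of X Y f g h] pls_assoc[of X Y g f h] pls_commute[of X Y f g] by simp

lemma neg_unique:
  assumes "X \<in> Ob D" "Y \<in> Ob D" "f \<in> Hom D X Y" "g \<in> Hom D X Y" "h \<in> Hom D X Y"
    and "Pls D X Y g f = Zer D X Y" "Pls D X Y h f = Zer D X Y"
  shows "g = h"
  using assms cancel[of X Y g h f] by (simp add: pls_commute)

lemma coker_class_self:
  assumes "Y \<in> Ob D" "X' \<in> Ob D" "Y' \<in> Ob D" "a' \<in> Hom D X' Y'" "g \<in> Hom D Y Y'"
  shows "g \<in> coker_class D Y X' Y' a' g"
proof -
  have "g = Pls D Y Y' g (Cmp D Y X' Y' a' (Zer D Y X'))"
    using assms by (simp add: zero)
  then show ?thesis unfolding coker_class_def using assms closed(3) by blast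
qed

lemma coker_class_mono:
  assumes o: "Y \<in> Ob D" "X' \<in> Ob D" "Y' \<in> Ob D" "a' \<in> Hom D X' Y'" "g \<in> Hom D Y Y'"
    and s: "s \<in> Hom D Y X'"
  shows "coker_class D Y X' Y' a' (Pls D Y Y' g (Cmp D Y X' Y' a' s)) \<subseteq> coker_class D Y X' Y' a' g"
proof
  fix f assume "f \<in> coker_class D Y X' Y' a' (Pls D Y Y' g (Cmp D Y X' Y' a' s))"
  then obtain t where t: "t \<in> Hom D Y X'"
    "f = Pls D Y Y' (Pls D Y Y' g (Cmp D Y X' Y' a' s)) (Cmp D Y X' Y' a' t)"
    unfolding coker_class_def by blast
  have "f = Pls D Y Y' g (Cmp D Y X' Y' a' (Pls D Y X' s t))"
    using o s t by (simp add: distrib pls_assoc closed)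
  then show "f \<in> coker_class D Y X' Y' a' g"
    unfolding coker_class_def using closed(4) o s t by blast
qed

text \<open>\<open>f\<close> is \<open>g\<close> translated by \<open>a' s\<close>; the negative of
  \<open>s\<close> translates back, so \<open>coker_class_mono\<close> applies in both
  directions.\<close>

lemma coker_class_eqI:
  assumes o: "Y \<in> Ob D" "X' \<in> Ob D" "Y' \<in> Ob D" "a' \<in> Hom D X' Y'" "g \<in> Hom D Y Y'"
    and f: "f \<in> coker_class D Y X' Y' a' g"
  shows "coker_class D Y X' Y' a' f = coker_class D Y X' Y' a' g"
proof -
  obtain s where s: "s \<in> Hom D Y X'" "f = Pls D Y Y' g (Cmp D Y X' Y' a' s)"
    using f unfolding coker_class_def by blast
  obtain t where t: "t \<in> Hom D Y X'" "Pls D Y X' t s = Zer D Y X'" using neg o s by blast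
  have "Pls D Y X' s t = Zer D Y X'" using t o s pls_commute by simp
  then have "g = Pls D Y Y' f (Cmp D Y X' Y' a' t)"
    using o s t by (simp add: pls_assoc closed distrib[symmetric] zero)
  then show ?thesis
    using coker_class_mono[OF o s(1)] coker_class_mono[OF o(1-4) _ t(1), of f] o s
    by (simp add: closed)
qed

lemma coker_class_eq_iff:
  assumes o: "Y \<in> Ob D" "X' \<in> Ob D" "Y' \<in> Ob D" "a' \<in> Hom D X' Y'"
    and fg: "f \<in> Hom D Y Y'" "g \<in> Hom D Y Y'"
  shows "coker_class D Y X' Y' a' f = coker_class D Y X' Y' a' g \<longleftrightarrow>
    (\<exists>s\<in>Hom D Y X'. f = Pls D Y Y' g (Cmp D Y X' Y' a' s))"
proof
  assume "coker_class D Y X' Y' a' f = coker_class D Y X' Y' a' g"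
  then have "f \<in> coker_class D Y X' Y' a' g" using coker_class_self[OF o fg(1)] by simp
  then show "\<exists>s\<in>Hom D Y X'. f = Pls D Y Y' g (Cmp D Y X' Y' a' s)"
    unfolding coker_class_def by blast
next
  assume "\<exists>s\<in>Hom D Y X'. f = Pls D Y Y' g (Cmp D Y X' Y' a' s)"
  then show "coker_class D Y X' Y' a' f = coker_class D Y X' Y' a' g"
    by (intro coker_class_eqI[OF o fg(2)]) (auto simp: coker_class_def)
qed

lemma coker_class_zero_iff:
  assumes o: "Y \<in> Ob D" "X' \<in> Ob D" "Y' \<in> Ob D" "a' \<in> Hom D X' Y'" and g: "g \<in> Hom D Y Y'"
  shows "coker_class D Y X' Y' a' g = coker_class D Y X' Y' a' (Zer D Y Y') \<longleftrightarrow>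
    (\<exists>s\<in>Hom D Y X'. g = Cmp D Y X' Y' a' s)"
  using coker_class_eq_iff[OF o g closed(3)] o by (auto simp: zero closed)

text \<open>A zero map imposes no relations. This is why the embedding of \<open>D\<close> sends
  \<open>f\<close> to \<open>{f}\<close>, and to \<open>{{f}}\<close> after the second
  completion.\<close>

lemma coker_class_zero_map:
  assumes "X \<in> Ob D" "X' \<in> Ob D" "Y' \<in> Ob D" "g \<in> Hom D X Y'"
  shows "coker_class D X X' Y' (Zer D X' Y') g = {g}"
proof -
  have "Pls D X Y' g (Cmp D X X' Y' (Zer D X' Y') s) = g" if "s \<in> Hom D X X'" for s
    using assms that by (simp add: zero)
  moreover have "Zer D X X' \<in> Hom D X X'" using assms closed(3) by simp
  ultimately show ?thesis unfolding coker_class_def Setcompr_eq_image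
    by (subst image_cong[OF HOL.refl, of _ _ "\<lambda>_. g"]) auto
qed

definition lifts :: "'o \<Rightarrow> 'o \<Rightarrow> 'm \<Rightarrow> 'o \<Rightarrow> 'o \<Rightarrow> 'm \<Rightarrow> 'm \<Rightarrow> bool" where
  "lifts X Y a X' Y' a' g \<longleftrightarrow>
     g \<in> Hom D Y Y' \<and> (\<exists>h\<in>Hom D X X'. Cmp D X Y Y' g a = Cmp D X X' Y' a' h)"

lemma Ob_fp_mod: "(X, Y, a) \<in> Ob (fp_mod D) \<longleftrightarrow> X \<in> Ob D \<and> Y \<in> Ob D \<and> a \<in> Hom D X Y"
  by (simp add: fp_mod_def)

lemma Hom_fp_mod:
  "Hom (fp_mod D) (X, Y, a) (X', Y', a') = coker_class D Y X' Y' a' ` Collect (lifts X Y a X' Y' a')"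
  by (simp add: fp_mod_def lifts_def[abs_def] setcompr_eq_image)

lemma Zer_fp_mod: "Zer (fp_mod D) (X, Y, a) (X', Y', a') = coker_class D Y X' Y' a' (Zer D Y Y')"
  by (simp add: fp_mod_def)

lemma Idm_fp_mod: "Idm (fp_mod D) (X, Y, a) = coker_class D Y X Y a (Idm D Y)"
  by (simp add: fp_mod_def)

text \<open>If \<open>h\<close> completes the square for \<open>g\<close> and \<open>f\<close> is
  \<open>g + a' s\<close>, then \<open>h + s a\<close> completes it for \<open>f\<close>. An
  arbitrary representative of a class may therefore be picked later.\<close>

lemma lifts_class:
  assumes o: "(X, Y, a) \<in> Ob (fp_mod D)" "(X', Y', a') \<in> Ob (fp_mod D)"
    and g: "lifts X Y a X' Y' a' g" and f: "f \<in> coker_class D Y X' Y' a' g"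
  shows "lifts X Y a X' Y' a' f"
proof -
  have o': "X \<in> Ob D" "Y \<in> Ob D" "a \<in> Hom D X Y" "X' \<in> Ob D" "Y' \<in> Ob D" "a' \<in> Hom D X' Y'"
    using o by (simp_all add: Ob_fp_mod)
  obtain h where h: "g \<in> Hom D Y Y'" "h \<in> Hom D X X'" "Cmp D X Y Y' g a = Cmp D X X' Y' a' h"
    using g unfolding lifts_def by blast
  obtain s where s: "s \<in> Hom D Y X'" "f = Pls D Y Y' g (Cmp D Y X' Y' a' s)"
    using f unfolding coker_class_def by blast
  have "Cmp D X Y Y' f a = Cmp D X X' Y' a' (Pls D X X' h (Cmp D X Y X' s a))"
    using o' s h by (simp add: distrib closed assoc)
  then show ?thesis unfolding lifts_def using o' s h closed by (metis (full_types))
qed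

text \<open>Replacing \<open>f\<close> by \<open>f + a' r\<close> changes the composite by
  \<open>g a' r = a'' h r\<close>, and replacing \<open>g\<close> by \<open>g + a'' s\<close>
  changes it by a map through \<open>a''\<close>. Hence all classes in the union that defines
  composition coincide.\<close>

lemma Cmp_fp_mod:
  assumes o: "(X, Y, a) \<in> Ob (fp_mod D)" "(X', Y', a') \<in> Ob (fp_mod D)" "(X'', Y'', a'') \<in> Ob (fp_mod D)"
    and f: "lifts X Y a X' Y' a' f" and g: "lifts X' Y' a' X'' Y'' a'' g"
  shows "Cmp (fp_mod D) (X, Y, a) (X', Y', a') (X'', Y'', a'')
      (coker_class D Y' X'' Y'' a'' g) (coker_class D Y X' Y' a' f) =
    coker_class D Y X'' Y'' a'' (Cmp D Y Y' Y'' g f)"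
proof -
  have o': "X \<in> Ob D" "Y \<in> Ob D" "a \<in> Hom D X Y" "X' \<in> Ob D" "Y' \<in> Ob D" "a' \<in> Hom D X' Y'"
    "X'' \<in> Ob D" "Y'' \<in> Ob D" "a'' \<in> Hom D X'' Y''"
    using o by (simp_all add: Ob_fp_mod)
  have f': "f \<in> Hom D Y Y'" and g': "g \<in> Hom D Y' Y''" using f g by (simp_all add: lifts_def)
  obtain h where h: "h \<in> Hom D X' X''" "Cmp D X' Y' Y'' g a' = Cmp D X' X'' Y'' a'' h"
    using g unfolding lifts_def by blast
  have "coker_class D Y X'' Y'' a'' (Cmp D Y Y' Y'' g1 f1) =
      coker_class D Y X'' Y'' a'' (Cmp D Y Y' Y'' g f)"
    if f1: "f1 \<in> coker_class D Y X' Y' a' f" and g1: "g1 \<in> coker_class D Y' X'' Y'' a'' g" for f1 g1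
  proof -
    obtain r where r: "r \<in> Hom D Y X'" "f1 = Pls D Y Y' f (Cmp D Y X' Y' a' r)"
      using f1 unfolding coker_class_def by blast
    obtain s where s: "s \<in> Hom D Y' X''" "g1 = Pls D Y' Y'' g (Cmp D Y' X'' Y'' a'' s)"
      using g1 unfolding coker_class_def by blast
    have f1': "f1 \<in> Hom D Y Y'" using o' r f' by (simp add: closed)
    let ?t = "Pls D Y X'' (Cmp D Y X' X'' h r) (Cmp D Y Y' X'' s f1)"
    have e: "Cmp D Y Y' Y'' g (Cmp D Y X' Y' a' r) = Cmp D Y X'' Y'' a'' (Cmp D Y X' X'' h r)"
      using o' r h g' by (simp add: assoc)
    have "Cmp D Y Y' Y'' g1 f1 =
      Pls D Y Y'' (Cmp D Y Y' Y'' g f1) (Cmp D Y X'' Y'' a'' (Cmp D Y Y' X'' s f1))"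
      using o' s f1' g' by (simp add: distrib closed assoc)
    also have "Cmp D Y Y' Y'' g f1 = Pls D Y Y'' (Cmp D Y Y' Y'' g f) (Cmp D Y X'' Y'' a'' (Cmp D Y X' X'' h r))"
      unfolding r(2) e[symmetric] using o' r f' g' by (simp add: distrib closed)
    finally have "Cmp D Y Y' Y'' g1 f1 = Pls D Y Y'' (Cmp D Y Y' Y'' g f) (Cmp D Y X'' Y'' a'' ?t)"
      using o' f' g' h r s f1' by (simp add: distrib closed pls_assoc)
    moreover have "?t \<in> Hom D Y X''" using o' h r s f1' by (simp add: closed)
    ultimately show ?thesis
      using o' f' g' by (intro coker_class_eqI) (auto simp: closed coker_class_def)
  qed
  then have "(\<Union>g1\<in>coker_class D Y' X'' Y'' a'' g. \<Union>f1\<in>coker_class D Y X' Y' a' f.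
      coker_class D Y X'' Y'' a'' (Cmp D Y Y' Y'' g1 f1)) = coker_class D Y X'' Y'' a'' (Cmp D Y Y' Y'' g f)"
    by (rule UN2_const[OF coker_class_self[OF o'(5,7,8,9) g'] coker_class_self[OF o'(2,4,5,6) f']])
  then show ?thesis by (simp add: fp_mod_def)
qed

lemma Pls_fp_mod:
  assumes o: "(X, Y, a) \<in> Ob (fp_mod D)" "(X', Y', a') \<in> Ob (fp_mod D)"
    and f: "f \<in> Hom D Y Y'" and g: "g \<in> Hom D Y Y'"
  shows "Pls (fp_mod D) (X, Y, a) (X', Y', a')
      (coker_class D Y X' Y' a' f) (coker_class D Y X' Y' a' g) =
    coker_class D Y X' Y' a' (Pls D Y Y' f g)"
proof -
  have o': "X \<in> Ob D" "Y \<in> Ob D" "a \<in> Hom D X Y" "X' \<in> Ob D" "Y' \<in> Ob D" "a' \<in> Hom D X' Y'"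
    using o by (simp_all add: Ob_fp_mod)
  have "coker_class D Y X' Y' a' (Pls D Y Y' f1 g1) = coker_class D Y X' Y' a' (Pls D Y Y' f g)"
    if g1: "g1 \<in> coker_class D Y X' Y' a' g" and f1: "f1 \<in> coker_class D Y X' Y' a' f" for f1 g1
  proof -
    obtain r where r: "r \<in> Hom D Y X'" "f1 = Pls D Y Y' f (Cmp D Y X' Y' a' r)"
      using f1 unfolding coker_class_def by blast
    obtain s where s: "s \<in> Hom D Y X'" "g1 = Pls D Y Y' g (Cmp D Y X' Y' a' s)"
      using g1 unfolding coker_class_def by blast
    have "Pls D Y Y' f1 g1 = Pls D Y Y' (Pls D Y Y' f g) (Cmp D Y X' Y' a' (Pls D Y X' r s))"
      using o' f g r s by (simp add: distrib closed pls_assoc pls_left_commute)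
    moreover have "Pls D Y X' r s \<in> Hom D Y X'" using o' r s by (simp add: closed)
    ultimately show ?thesis
      using o' f g by (intro coker_class_eqI) (auto simp: closed coker_class_def)
  qed
  then have "(\<Union>f1\<in>coker_class D Y X' Y' a' f. \<Union>g1\<in>coker_class D Y X' Y' a' g.
      coker_class D Y X' Y' a' (Pls D Y Y' f1 g1)) = coker_class D Y X' Y' a' (Pls D Y Y' f g)"
    by (rule UN2_const[OF coker_class_self[OF o'(2,4,5,6) f] coker_class_self[OF o'(2,4,5,6) g]])
  then show ?thesis by (simp add: fp_mod_def)
qed

end

lemma Ob_opposite [simp]: "Ob (opposite D) = Ob D"
  and Hom_opposite [simp]: "Hom (opposite D) X Y = Hom D Y X"
  and Idm_opposite [simp]: "Idm (opposite D) X = Idm D X"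
  and Cmp_opposite [simp]: "Cmp (opposite D) X Y Z g f = Cmp D Z Y X f g"
  and Zer_opposite [simp]: "Zer (opposite D) X Y = Zer D Y X"
  and Pls_opposite [simp]: "Pls (opposite D) X Y f g = Pls D Y X f g"
  and opposite_opposite [simp]: "opposite (opposite D) = D"
  by (simp_all add: opposite_def)

section \<open>Functors to subquotients\<close>

definition subgroup_set :: "'g::ab_group_add set \<Rightarrow> bool" where
  "subgroup_set A \<longleftrightarrow> 0 \<in> A \<and> (\<forall>v\<in>A. \<forall>w\<in>A. v - w \<in> A)"

lemma subgroup_setD:
  assumes "subgroup_set A"
  shows "0 \<in> A" and "v \<in> A \<Longrightarrow> w \<in> A \<Longrightarrow> v - w \<in> A" and "v \<in> A \<Longrightarrow> - v \<in> A"
    and "v \<in> A \<Longrightarrow> w \<in> A \<Longrightarrow> v + w \<in> A"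
proof -
  show z: "0 \<in> A" and d: "v \<in> A \<Longrightarrow> w \<in> A \<Longrightarrow> v - w \<in> A" for v w
    using assms by (auto simp: subgroup_set_def)
  show m: "v \<in> A \<Longrightarrow> - v \<in> A" for v using d[OF z, of v] by simp
  show "v \<in> A \<Longrightarrow> w \<in> A \<Longrightarrow> v + w \<in> A" for v w using d[OF _ m, of v w] by simp
qed

text \<open>The form in which laws that hold only modulo \<open>N\<close> are applied: a value may
  be replaced by a congruent one when membership in \<open>N\<close> is tested.\<close>

lemma subgroup_set_iff:
  assumes "subgroup_set A" "v - w \<in> A" shows "v \<in> A \<longleftrightarrow> w \<in> A"
  using subgroup_setD(2)[OF assms(1) _ assms(2), of v] subgroup_setD(4)[OF assms(1) assms(2), of w] by auto

text \<open>
  A functor to abelian groups whose value at \<open>X\<close> is the subquotient \<open>V X / N X\<close> of a fixed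
  group. Morphisms act on representatives, so the functor laws hold modulo \<open>N\<close> only.
\<close>

locale subquotient_functor = preadditive_category D for D :: "('o, 'm) addcat" +
  fixes V N :: "'o \<Rightarrow> 'g::ab_group_add set" and act :: "'o \<Rightarrow> 'o \<Rightarrow> 'm \<Rightarrow> 'g \<Rightarrow> 'g"
  assumes V: "X \<in> Ob D \<Longrightarrow> subgroup_set (V X)"
    and N: "X \<in> Ob D \<Longrightarrow> subgroup_set (N X)"
    and NV: "X \<in> Ob D \<Longrightarrow> v \<in> N X \<Longrightarrow> v \<in> V X"
    and act_V: "\<lbrakk>X \<in> Ob D; Y \<in> Ob D; f \<in> Hom D X Y; v \<in> V X\<rbrakk> \<Longrightarrow> act X Y f v \<in> V Y"
    and act_N: "\<lbrakk>X \<in> Ob D; Y \<in> Ob D; f \<in> Hom D X Y; v \<in> N X\<rbrakk> \<Longrightarrow> act X Y f v \<in> N Y"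
    and act_add: "\<lbrakk>X \<in> Ob D; Y \<in> Ob D; f \<in> Hom D X Y; v \<in> V X; w \<in> V X\<rbrakk>
      \<Longrightarrow> act X Y f (v + w) = act X Y f v + act X Y f w"
    and act_Idm: "\<lbrakk>X \<in> Ob D; v \<in> V X\<rbrakk> \<Longrightarrow> act X X (Idm D X) v - v \<in> N X"
    and act_Cmp: "\<lbrakk>X \<in> Ob D; Y \<in> Ob D; Z \<in> Ob D; f \<in> Hom D X Y; g \<in> Hom D Y Z; v \<in> V X\<rbrakk>
      \<Longrightarrow> act X Z (Cmp D X Y Z g f) v - act Y Z g (act X Y f v) \<in> N Z"
    and act_Pls: "\<lbrakk>X \<in> Ob D; Y \<in> Ob D; f \<in> Hom D X Y; g \<in> Hom D X Y; v \<in> V X\<rbrakk>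
      \<Longrightarrow> act X Y (Pls D X Y f g) v - (act X Y f v + act X Y g v) \<in> N Y"
begin

lemma act_zero: "X \<in> Ob D \<Longrightarrow> Y \<in> Ob D \<Longrightarrow> f \<in> Hom D X Y \<Longrightarrow> act X Y f 0 = 0"
  using act_add[of X Y f 0 0] subgroup_setD(1)[OF V] by simp

lemma act_minus:
  "X \<in> Ob D \<Longrightarrow> Y \<in> Ob D \<Longrightarrow> f \<in> Hom D X Y \<Longrightarrow> v \<in> V X \<Longrightarrow> act X Y f (- v) = - act X Y f v"
  using act_add[of X Y f v "- v"] subgroup_setD(3)[OF V] act_zero[of X Y f] by (simp add: minus_unique)

lemma act_diff:
  "X \<in> Ob D \<Longrightarrow> Y \<in> Ob D \<Longrightarrow> f \<in> Hom D X Y \<Longrightarrow> v \<in> V X \<Longrightarrow> w \<in> V X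
    \<Longrightarrow> act X Y f (v - w) = act X Y f v - act X Y f w"
  using act_add[of X Y f v "- w"] act_minus[of X Y f w] subgroup_setD(3)[OF V] by simp

text \<open>The zero morphism is its own double, so additivity modulo \<open>N\<close> puts the
  negative of its value into \<open>N Y\<close>.\<close>

lemma act_Zer:
  assumes "X \<in> Ob D" "Y \<in> Ob D" "v \<in> V X" shows "act X Y (Zer D X Y) v \<in> N Y"
proof -
  have "- act X Y (Zer D X Y) v \<in> N Y"
    using act_Pls[OF assms(1,2) closed(3)[OF assms(1,2)] closed(3)[OF assms(1,2)] assms(3)] assms
    by (simp add: zero closed)
  from subgroup_setD(3)[OF N[OF assms(2)] this] show ?thesis by simp
qed

end

text \<open>The laws on the nose: the form in which the functor is given on the additive hull,
  before any quotient is formed.\<close>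

locale additive_functor = preadditive_category D for D :: "('o, 'm) addcat" +
  fixes V :: "'o \<Rightarrow> 'g::ab_group_add set" and act :: "'o \<Rightarrow> 'o \<Rightarrow> 'm \<Rightarrow> 'g \<Rightarrow> 'g"
  assumes V: "X \<in> Ob D \<Longrightarrow> subgroup_set (V X)"
    and act_V: "\<lbrakk>X \<in> Ob D; Y \<in> Ob D; f \<in> Hom D X Y; v \<in> V X\<rbrakk> \<Longrightarrow> act X Y f v \<in> V Y"
    and act_add: "\<lbrakk>X \<in> Ob D; Y \<in> Ob D; f \<in> Hom D X Y; v \<in> V X; w \<in> V X\<rbrakk>
      \<Longrightarrow> act X Y f (v + w) = act X Y f v + act X Y f w"
    and act_Idm: "\<lbrakk>X \<in> Ob D; v \<in> V X\<rbrakk> \<Longrightarrow> act X X (Idm D X) v = v"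
    and act_Cmp: "\<lbrakk>X \<in> Ob D; Y \<in> Ob D; Z \<in> Ob D; f \<in> Hom D X Y; g \<in> Hom D Y Z; v \<in> V X\<rbrakk>
      \<Longrightarrow> act X Z (Cmp D X Y Z g f) v = act Y Z g (act X Y f v)"
    and act_Pls: "\<lbrakk>X \<in> Ob D; Y \<in> Ob D; f \<in> Hom D X Y; g \<in> Hom D X Y; v \<in> V X\<rbrakk>
      \<Longrightarrow> act X Y (Pls D X Y f g) v = act X Y f v + act X Y g v"
begin

sublocale strict: subquotient_functor D V "\<lambda>_. {0}" act
proof
  show "subgroup_set (V X)" if "X \<in> Ob D" for X using V that .
  show "act X Y f v \<in> {0}" if "X \<in> Ob D" "Y \<in> Ob D" "f \<in> Hom D X Y" "v \<in> {0}" for X Y f v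
    using act_add[OF that(1-3), of 0 0] that(4) subgroup_setD(1)[OF V[OF that(1)]] by simp
qed (auto simp: V act_V act_add act_Idm act_Cmp act_Pls subgroup_setD(1)[OF V] subgroup_set_def)

text \<open>The right exact extension: the formal cokernel of \<open>a : X \<rightarrow> Y\<close> goes to the cokernel of \<open>act X Y a\<close>.\<close>

definition fp_V :: "'o \<times> 'o \<times> 'm \<Rightarrow> 'g set" where
  "fp_V = (\<lambda>(X, Y, a). V Y)"

definition fp_N :: "'o \<times> 'o \<times> 'm \<Rightarrow> 'g set" where
  "fp_N = (\<lambda>(X, Y, a). act X Y a ` V X)"

text \<open>One representative is chosen per class, independently of the value acted on. So
  additivity in the value is exact, while identities, composites and sums of morphisms are respected
  modulo \<open>fp_N\<close>.\<close>

definition fp_act :: "'o \<times> 'o \<times> 'm \<Rightarrow> 'o \<times> 'o \<times> 'm \<Rightarrow> 'm set \<Rightarrow> 'g \<Rightarrow> 'g" where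
  "fp_act = (\<lambda>(X, Y, a) (X', Y', a') F. act Y Y' (SOME g. g \<in> F))"

lemma fp_NI: "w \<in> V X \<Longrightarrow> v = act X Y a w \<Longrightarrow> v \<in> fp_N (X, Y, a)"
  by (simp add: fp_N_def)

lemma subgroup_fp_N:
  assumes "P \<in> Ob (fp_mod D)" shows "subgroup_set (fp_N P)"
proof -
  obtain X Y a where P: "P = (X, Y, a)" by (cases P)
  have o: "X \<in> Ob D" "Y \<in> Ob D" "a \<in> Hom D X Y" using assms by (simp_all add: P Ob_fp_mod)
  note s = subgroup_setD[OF V[OF o(1)]]
  have "0 \<in> act X Y a ` V X" using s(1) strict.act_zero[OF o] by (metis imageI)
  moreover have "act X Y a v - act X Y a w \<in> act X Y a ` V X" if "v \<in> V X" "w \<in> V X" for v w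
    using strict.act_diff[OF o that] s(2)[OF that] by (metis imageI)
  ultimately show ?thesis by (auto simp: subgroup_set_def fp_N_def P)
qed

text \<open>The chosen representative differs from \<open>g\<close> by some \<open>a' s\<close>,
  whose values lie in the image of \<open>a'\<close>.\<close>

lemma fp_act_class:
  assumes o: "(X, Y, a) \<in> Ob (fp_mod D)" "(X', Y', a') \<in> Ob (fp_mod D)"
    and g: "g \<in> Hom D Y Y'" and v: "v \<in> V Y"
  shows "fp_act (X, Y, a) (X', Y', a') (coker_class D Y X' Y' a' g) v - act Y Y' g v
    \<in> fp_N (X', Y', a')"
proof -
  have o': "X \<in> Ob D" "Y \<in> Ob D" "a \<in> Hom D X Y" "X' \<in> Ob D" "Y' \<in> Ob D" "a' \<in> Hom D X' Y'"
    using o by (simp_all add: Ob_fp_mod)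
  have "(SOME f. f \<in> coker_class D Y X' Y' a' g) \<in> coker_class D Y X' Y' a' g"
    using coker_class_self[OF o'(2,4,5,6) g] by (rule someI)
  then obtain s where s: "s \<in> Hom D Y X'"
    "(SOME f. f \<in> coker_class D Y X' Y' a' g) = Pls D Y Y' g (Cmp D Y X' Y' a' s)"
    unfolding coker_class_def by blast
  show ?thesis
    using o' s g v by (simp add: fp_act_def s(2) fp_N_def act_Pls act_Cmp closed act_V)
qed

lemma fp_act_in_N_iff:
  assumes o: "(X, Y, a) \<in> Ob (fp_mod D)" "(X', Y', a') \<in> Ob (fp_mod D)"
    and g: "g \<in> Hom D Y Y'" and v: "v \<in> V Y"
  shows "fp_act (X, Y, a) (X', Y', a') (coker_class D Y X' Y' a' g) v \<in> fp_N (X', Y', a') \<longleftrightarrow>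
    act Y Y' g v \<in> fp_N (X', Y', a')"
  by (rule subgroup_set_iff[OF subgroup_fp_N[OF o(2)] fp_act_class[OF assms]])

text \<open>The square \<open>g a = a' h\<close> carries the image of \<open>a\<close> into the
  image of \<open>a'\<close>.\<close>

lemma act_fp_N:
  assumes o: "(X, Y, a) \<in> Ob (fp_mod D)" "(X', Y', a') \<in> Ob (fp_mod D)"
    and g: "lifts X Y a X' Y' a' g" and v: "v \<in> fp_N (X, Y, a)"
  shows "act Y Y' g v \<in> fp_N (X', Y', a')"
proof -
  have o': "X \<in> Ob D" "Y \<in> Ob D" "a \<in> Hom D X Y" "X' \<in> Ob D" "Y' \<in> Ob D" "a' \<in> Hom D X' Y'"
    using o by (simp_all add: Ob_fp_mod)
  obtain h where h: "g \<in> Hom D Y Y'" "h \<in> Hom D X X'" "Cmp D X Y Y' g a = Cmp D X X' Y' a' h"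
    using g unfolding lifts_def by blast
  obtain w where w: "w \<in> V X" "v = act X Y a w" using v by (auto simp: fp_N_def)
  have "act Y Y' g v = act X' Y' a' (act X X' h w)"
    using act_Cmp[OF o'(1,2,5,3) h(1) w(1)] act_Cmp[OF o'(1,4,5) h(2) o'(6) w(1)] w h(3) by simp
  then show ?thesis using act_V[OF o'(1,4) h(2) w(1)] by (simp add: fp_N_def)
qed

lemma fp_mod_HomE:
  assumes "F \<in> Hom (fp_mod D) (X, Y, a) (X', Y', a')"
  obtains g where "F = coker_class D Y X' Y' a' g" "lifts X Y a X' Y' a' g" "g \<in> Hom D Y Y'"
proof -
  from assms obtain g where "lifts X Y a X' Y' a' g" "F = coker_class D Y X' Y' a' g"
    unfolding Hom_fp_mod by blast
  then show thesis using that by (simp add: lifts_def)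
qed

lemma subquotient_functor_fp_mod: "subquotient_functor (fp_mod D) fp_V fp_N fp_act"
proof (intro subquotient_functor.intro subquotient_functor_axioms.intro)
  show "preadditive_category (fp_mod D)" by unfold_locales (rule preadditive_fp_mod[OF D])
  fix P assume P: "P \<in> Ob (fp_mod D)"
  obtain X Y a where [simp]: "P = (X, Y, a)" by (cases P)
  have oP: "X \<in> Ob D" "Y \<in> Ob D" "a \<in> Hom D X Y" using P by (simp_all add: Ob_fp_mod)
  show "subgroup_set (fp_V P)" using V oP by (simp add: fp_V_def)
  show "subgroup_set (fp_N P)" by (rule subgroup_fp_N[OF P])
  show "v \<in> fp_V P" if "v \<in> fp_N P" for v using that act_V[OF oP] by (auto simp: fp_V_def fp_N_def)
  show "fp_act P P (Idm (fp_mod D) P) v - v \<in> fp_N P" if "v \<in> fp_V P" for v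
    using fp_act_class[of X Y a X Y a "Idm D Y" v] P that oP
    by (simp add: Idm_fp_mod closed act_Idm fp_V_def)
  fix Q F assume Q: "Q \<in> Ob (fp_mod D)" and F: "F \<in> Hom (fp_mod D) P Q"
  obtain X' Y' a' where [simp]: "Q = (X', Y', a')" by (cases Q)
  have oQ: "X' \<in> Ob D" "Y' \<in> Ob D" "a' \<in> Hom D X' Y'" using Q by (simp_all add: Ob_fp_mod)
  obtain f where f: "F = coker_class D Y X' Y' a' f" "lifts X Y a X' Y' a' f" "f \<in> Hom D Y Y'"
    using F by (auto elim: fp_mod_HomE)
  have "(SOME f'. f' \<in> F) \<in> F" unfolding f(1)
    by (rule someI[of _ f], rule coker_class_self) (use oP oQ f in auto)
  then have some: "lifts X Y a X' Y' a' (SOME f'. f' \<in> F)"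
    using lifts_class[of X Y a X' Y' a' f] P Q f by simp
  then have some': "(SOME f'. f' \<in> F) \<in> Hom D Y Y'" by (simp add: lifts_def)
  show in_V: "fp_act P Q F v \<in> fp_V Q" if "v \<in> fp_V P" for v
    using that act_V[OF oP(2) oQ(2) some'] by (simp add: fp_V_def fp_act_def)
  show "fp_act P Q F v \<in> fp_N Q" if "v \<in> fp_N P" for v
    using act_fp_N[of X Y a X' Y' a' _ v] some that P Q by (simp add: fp_act_def)
  show "fp_act P Q F (v + w) = fp_act P Q F v + fp_act P Q F w" if "v \<in> fp_V P" "w \<in> fp_V P" for v w
    using that act_add[OF oP(2) oQ(2) some'] by (simp add: fp_V_def fp_act_def)
  {
    fix G v assume G: "G \<in> Hom (fp_mod D) P Q" and v: "v \<in> fp_V P"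
    obtain g where g: "G = coker_class D Y X' Y' a' g" "lifts X Y a X' Y' a' g" "g \<in> Hom D Y Y'"
      using G by (auto elim: fp_mod_HomE)
    have v': "v \<in> V Y" using v by (simp add: fp_V_def)
    have PG: "Pls (fp_mod D) P Q F G = coker_class D Y X' Y' a' (Pls D Y Y' f g)"
      using Pls_fp_mod[of X Y a X' Y' a' f g] P Q f g by simp
    have "fp_act P Q (Pls (fp_mod D) P Q F G) v - act Y Y' (Pls D Y Y' f g) v \<in> fp_N Q"
      using fp_act_class[of X Y a X' Y' a' "Pls D Y Y' f g" v] P Q f g v' oP oQ PG by (simp add: closed)
    moreover have "fp_act P Q F v - act Y Y' f v \<in> fp_N Q" "fp_act P Q G v - act Y Y' g v \<in> fp_N Q"
      using fp_act_class[of X Y a X' Y' a' _ v] P Q f g v' by simp_all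
    ultimately have "(fp_act P Q (Pls (fp_mod D) P Q F G) v - act Y Y' (Pls D Y Y' f g) v)
      - ((fp_act P Q F v - act Y Y' f v) + (fp_act P Q G v - act Y Y' g v)) \<in> fp_N Q"
      using subgroup_setD[OF subgroup_fp_N[OF Q]] by simp
    then show "fp_act P Q (Pls (fp_mod D) P Q F G) v - (fp_act P Q F v + fp_act P Q G v) \<in> fp_N Q"
      using act_Pls[OF oP(2) oQ(2) f(3) g(3) v'] by (simp add: algebra_simps)
  }
  fix R G v assume R: "R \<in> Ob (fp_mod D)" and G: "G \<in> Hom (fp_mod D) Q R" and v: "v \<in> fp_V P"
  obtain X'' Y'' a'' where [simp]: "R = (X'', Y'', a'')" by (cases R)
  have oR: "X'' \<in> Ob D" "Y'' \<in> Ob D" "a'' \<in> Hom D X'' Y''" using R by (simp_all add: Ob_fp_mod)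
  obtain g where g: "G = coker_class D Y' X'' Y'' a'' g" "lifts X' Y' a' X'' Y'' a'' g" "g \<in> Hom D Y' Y''"
    using G by (auto elim: fp_mod_HomE)
  have v': "v \<in> V Y" using v by (simp add: fp_V_def)
  let ?fv = "fp_act P Q F v"
  have fv: "?fv \<in> V Y'" using in_V[OF v] by (simp add: fp_V_def)
  have 1: "fp_act P R (Cmp (fp_mod D) P Q R G F) v - act Y Y'' (Cmp D Y Y' Y'' g f) v \<in> fp_N R"
    using fp_act_class[of X Y a X'' Y'' a'' "Cmp D Y Y' Y'' g f" v] P Q R f g oP oQ oR v'
    by (simp add: Cmp_fp_mod closed)
  have 2: "fp_act Q R G ?fv - act Y' Y'' g ?fv \<in> fp_N R"
    using fp_act_class[of X' Y' a' X'' Y'' a'' g ?fv] Q R g fv by simp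
  have "?fv - act Y Y' f v \<in> fp_N Q"
    using fp_act_class[of X Y a X' Y' a' f v] P Q f v' by simp
  then have "act Y' Y'' g (?fv - act Y Y' f v) \<in> fp_N R"
    using act_fp_N[of X' Y' a' X'' Y'' a'' g] Q R g by simp
  then have 3: "act Y' Y'' g ?fv - act Y' Y'' g (act Y Y' f v) \<in> fp_N R"
    using strict.act_diff[OF oQ(2) oR(2) g(3) fv act_V[OF oP(2) oQ(2) f(3) v']] by simp
  note s = subgroup_setD[OF subgroup_fp_N[OF R]]
  show "fp_act P R (Cmp (fp_mod D) P Q R G F) v - fp_act Q R G ?fv \<in> fp_N R"
    using s(2)[OF s(2)[OF 1 2] 3] act_Cmp[OF oP(2) oQ(2) oR(2) f(3) g(3) v'] by simp
qed

end

section \<open>Exactness of the extension to formal cokernels and kernels\<close>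

text \<open>Biproducts without the equation \<open>i p + j q = 1\<close>.\<close>

definition has_direct_sums :: "('o, 'm) addcat \<Rightarrow> bool" where
  "has_direct_sums D \<longleftrightarrow> (\<forall>X\<in>Ob D. \<forall>Y\<in>Ob D. \<exists>Z\<in>Ob D.
     \<exists>i\<in>Hom D X Z. \<exists>j\<in>Hom D Y Z. \<exists>p\<in>Hom D Z X. \<exists>q\<in>Hom D Z Y.
       Cmp D X Z X p i = Idm D X \<and> Cmp D Y Z Y q j = Idm D Y \<and>
       Cmp D X Z Y q i = Zer D X Y \<and> Cmp D Y Z X p j = Zer D Y X)"

text \<open>
  The universal properties are required on the level of values only: \<open>Z\<close> is large enough for
  a value killed by \<open>f\<close> and \<open>f'\<close> to be killed by \<open>m\<close>, and for a value killed by \<open>k\<close> to come from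
  a value killed by \<open>f'\<close>.
\<close>

locale exact_subquotient_functor = subquotient_functor D V N act
  for D :: "('o, 'm) addcat" and V N :: "'o \<Rightarrow> 'g::ab_group_add set" and act +
  assumes weak_product: "\<lbrakk>X \<in> Ob D; Y \<in> Ob D; Y' \<in> Ob D; f \<in> Hom D X Y; f' \<in> Hom D X Y'\<rbrakk> \<Longrightarrow>
      \<exists>Z\<in>Ob D. \<exists>m\<in>Hom D X Z. \<exists>p\<in>Hom D Z Y. \<exists>q\<in>Hom D Z Y'.
        Cmp D X Z Y p m = f \<and> Cmp D X Z Y' q m = f' \<and>
        (\<forall>v\<in>V X. act X Y f v \<in> N Y \<longrightarrow> act X Y' f' v \<in> N Y' \<longrightarrow> act X Z m v \<in> N Z)"
    and weak_pushout: "\<lbrakk>X \<in> Ob D; Y \<in> Ob D; Y' \<in> Ob D; f \<in> Hom D X Y; f' \<in> Hom D X Y'\<rbrakk> \<Longrightarrow>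
      \<exists>Z\<in>Ob D. \<exists>k\<in>Hom D Y Z. \<exists>m\<in>Hom D Y' Z. Cmp D X Y Z k f = Cmp D X Y' Z m f' \<and>
        (\<forall>v\<in>V Y. act Y Z k v \<in> N Z \<longrightarrow>
          (\<exists>u\<in>V X. act X Y f u - v \<in> N Y \<and> act X Y' f' u \<in> N Y'))"

section \<open>Weak products and weak pushouts of formal cokernels\<close>

context additive_functor
begin

lemma direct_sumE:
  assumes "has_direct_sums D" "X \<in> Ob D" "Y \<in> Ob D"
  obtains Z i j p q where "Z \<in> Ob D" "i \<in> Hom D X Z" "j \<in> Hom D Y Z" "p \<in> Hom D Z X" "q \<in> Hom D Z Y"
    "Cmp D X Z X p i = Idm D X" "Cmp D Y Z Y q j = Idm D Y"
    "Cmp D X Z Y q i = Zer D X Y" "Cmp D Y Z X p j = Zer D Y X"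
  using assms unfolding has_direct_sums_def by meson

lemma liftsI:
  "g \<in> Hom D Y Y' \<Longrightarrow> h \<in> Hom D X X' \<Longrightarrow> Cmp D X Y Y' g a = Cmp D X X' Y' a' h \<Longrightarrow>
    lifts X Y a X' Y' a' g"
  unfolding lifts_def by blast

lemma coker_class_in_Hom:
  "lifts X Y a X' Y' a' g \<Longrightarrow> coker_class D Y X' Y' a' g \<in> Hom (fp_mod D) (X, Y, a) (X', Y', a')"
  by (simp add: Hom_fp_mod)

text \<open>\<open>R\<close> is the direct sum of \<open>Q\<close> and \<open>Q'\<close>, presented
  by the sum of their presentations, and \<open>m\<close> has the components \<open>F\<close> and
  \<open>F'\<close>. If both components of a value are relations, the two preimages together show
  that the value itself is a relation.\<close>

lemma weak_product_fp_mod: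
  assumes sums: "has_direct_sums D"
    and P: "P \<in> Ob (fp_mod D)" "Q \<in> Ob (fp_mod D)" "Q' \<in> Ob (fp_mod D)"
    and F: "F \<in> Hom (fp_mod D) P Q" and F': "F' \<in> Hom (fp_mod D) P Q'"
  shows "\<exists>R\<in>Ob (fp_mod D). \<exists>m\<in>Hom (fp_mod D) P R. \<exists>p\<in>Hom (fp_mod D) R Q. \<exists>q\<in>Hom (fp_mod D) R Q'.
    Cmp (fp_mod D) P R Q p m = F \<and> Cmp (fp_mod D) P R Q' q m = F' \<and>
    (\<forall>v\<in>fp_V P. fp_act P Q F v \<in> fp_N Q \<longrightarrow> fp_act P Q' F' v \<in> fp_N Q' \<longrightarrow> fp_act P R m v \<in> fp_N R)"
proof -
  obtain X Y a where P': "P = (X, Y, a)" by (cases P)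
  obtain X1 Y1 b where Q1: "Q = (X1, Y1, b)" by (cases Q)
  obtain X2 Y2 c where Q2: "Q' = (X2, Y2, c)" by (cases Q')
  note PQ = P[unfolded P' Q1 Q2]
  have o: "X \<in> Ob D" "Y \<in> Ob D" "X1 \<in> Ob D" "Y1 \<in> Ob D" "X2 \<in> Ob D" "Y2 \<in> Ob D"
    and abc: "a \<in> Hom D X Y" "b \<in> Hom D X1 Y1" "c \<in> Hom D X2 Y2"
    using P by (simp_all add: P' Q1 Q2 Ob_fp_mod)
  obtain f where f: "F = coker_class D Y X1 Y1 b f" "lifts X Y a X1 Y1 b f" "f \<in> Hom D Y Y1"
    using F unfolding P' Q1 by (rule fp_mod_HomE)
  obtain g where g: "F' = coker_class D Y X2 Y2 c g" "lifts X Y a X2 Y2 c g" "g \<in> Hom D Y Y2"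
    using F' unfolding P' Q2 by (rule fp_mod_HomE)
  obtain h where h: "h \<in> Hom D X X1" "Cmp D X Y Y1 f a = Cmp D X X1 Y1 b h"
    using f(2) unfolding lifts_def by blast
  obtain k where k: "k \<in> Hom D X X2" "Cmp D X Y Y2 g a = Cmp D X X2 Y2 c k"
    using g(2) unfolding lifts_def by blast
  obtain U i1 i2 p1 p2 where U: "U \<in> Ob D" "i1 \<in> Hom D X1 U" "i2 \<in> Hom D X2 U" "p1 \<in> Hom D U X1" "p2 \<in> Hom D U X2"
    and ip: "Cmp D X1 U X1 p1 i1 = Idm D X1" "Cmp D X2 U X2 p2 i2 = Idm D X2"
      "Cmp D X1 U X2 p2 i1 = Zer D X1 X2" "Cmp D X2 U X1 p1 i2 = Zer D X2 X1"
    using sums o(3,5) by (rule direct_sumE)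
  obtain Z j1 j2 q1 q2 where Z: "Z \<in> Ob D" "j1 \<in> Hom D Y1 Z" "j2 \<in> Hom D Y2 Z" "q1 \<in> Hom D Z Y1" "q2 \<in> Hom D Z Y2"
    and jq: "Cmp D Y1 Z Y1 q1 j1 = Idm D Y1" "Cmp D Y2 Z Y2 q2 j2 = Idm D Y2"
      "Cmp D Y1 Z Y2 q2 j1 = Zer D Y1 Y2" "Cmp D Y2 Z Y1 q1 j2 = Zer D Y2 Y1"
    using sums o(4,6) by (rule direct_sumE)
  note facts = o abc f(3) g(3) h(1) k(1) U Z
  \<comment> \<open>\<open>d\<close> is the diagonal matrix with entries \<open>b\<close> and
    \<open>c\<close>; \<open>m\<close> is the column with entries \<open>f\<close> and
    \<open>g\<close>.\<close>
  define d where "d = Pls D U Z (Cmp D U X1 Z (Cmp D X1 Y1 Z j1 b) p1) (Cmp D U X2 Z (Cmp D X2 Y2 Z j2 c) p2)"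
  define m where "m = Pls D Y Z (Cmp D Y Y1 Z j1 f) (Cmp D Y Y2 Z j2 g)"
  have d: "d \<in> Hom D U Z" and m: "m \<in> Hom D Y Z"
    unfolding d_def m_def using facts by (simp_all add: closed)
  have q1d: "Cmp D U Z Y1 q1 d = Cmp D U X1 Y1 b p1"
    unfolding d_def using facts by (simp add: closed distrib assoc jq ident zero)
  have q2d: "Cmp D U Z Y2 q2 d = Cmp D U X2 Y2 c p2"
    unfolding d_def using facts by (simp add: closed distrib assoc jq ident zero)
  have q1m: "Cmp D Y Z Y1 q1 m = f"
    unfolding m_def using facts by (simp add: closed distrib assoc jq ident zero)
  have q2m: "Cmp D Y Z Y2 q2 m = g"
    unfolding m_def using facts by (simp add: closed distrib assoc jq ident zero)
  have di1: "Cmp D X1 U Z d i1 = Cmp D X1 Y1 Z j1 b"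
    unfolding d_def using facts
    by (simp add: closed distrib assoc[symmetric] ip ident zero)
  have di2: "Cmp D X2 U Z d i2 = Cmp D X2 Y2 Z j2 c"
    unfolding d_def using facts
    by (simp add: closed distrib assoc[symmetric] ip ident zero)
  let ?R = "(U, Z, d)"
  have R: "?R \<in> Ob (fp_mod D)" using U Z d by (simp add: Ob_fp_mod)
  have ma: "Cmp D X Y Z m a = Cmp D X U Z d (Pls D X U (Cmp D X X1 U i1 h) (Cmp D X X2 U i2 k))"
    unfolding m_def using facts d
    by (simp add: closed distrib assoc di1 di2) (simp add: closed assoc[symmetric] h(2) k(2))
  have lm: "lifts X Y a U Z d m"
    by (rule liftsI[OF m _ ma]) (use facts in \<open>simp add: closed\<close>)
  note l1 = liftsI[OF Z(4) U(4) q1d] and l2 = liftsI[OF Z(5) U(5) q2d]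
  have N: "fp_act P ?R (coker_class D Y U Z d m) v \<in> fp_N ?R"
    if v: "v \<in> fp_V P" and v1: "fp_act P Q F v \<in> fp_N Q" and v2: "fp_act P Q' F' v \<in> fp_N Q'" for v
  proof -
    have vY: "v \<in> V Y" using v by (simp add: fp_V_def P')
    have "act Y Y1 f v \<in> fp_N Q" "act Y Y2 g v \<in> fp_N Q'"
      using v1 v2 fp_act_in_N_iff[OF PQ(1,2) f(3) vY] fp_act_in_N_iff[OF PQ(1,3) g(3) vY]
      by (simp_all add: P' Q1 Q2 f(1) g(1))
    then obtain s t where s: "s \<in> V X1" "act Y Y1 f v = act X1 Y1 b s"
      and t: "t \<in> V X2" "act Y Y2 g v = act X2 Y2 c t"
      by (auto simp: fp_N_def Q1 Q2)
    \<comment> \<open>The preimages of the two components under \<open>b\<close> and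
      \<open>c\<close>, assembled into one preimage under \<open>d\<close>.\<close>
    let ?w = "act X1 U i1 s + act X2 U i2 t"
    have w: "?w \<in> V U"
      using facts s t by (intro subgroup_setD(4)[OF V]) (auto intro: act_V)
    have "act U Z d ?w = act X1 Z (Cmp D X1 U Z d i1) s + act X2 Z (Cmp D X2 U Z d i2) t"
      using facts s t d by (simp add: act_Cmp act_add act_V)
    also have "\<dots> = act Y Z m v"
      unfolding di1 di2 m_def using facts s t vY by (simp add: act_Cmp act_Pls closed)
    finally have "act Y Z m v \<in> fp_N ?R" by (intro fp_NI[OF w]) simp
    then show ?thesis using fp_act_in_N_iff[OF PQ(1) R m vY] by (simp add: P')
  qed
  show ?thesis
  proof (intro bexI conjI ballI impI)
    show "Cmp (fp_mod D) P ?R Q (coker_class D Z X1 Y1 b q1) (coker_class D Y U Z d m) = F"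
      unfolding P' Q1 Cmp_fp_mod[OF PQ(1) R PQ(2) lm l1] q1m f(1) ..
    show "Cmp (fp_mod D) P ?R Q' (coker_class D Z X2 Y2 c q2) (coker_class D Y U Z d m) = F'"
      unfolding P' Q2 Cmp_fp_mod[OF PQ(1) R PQ(3) lm l2] q2m g(1) ..
    show "coker_class D Z X2 Y2 c q2 \<in> Hom (fp_mod D) ?R Q'"
      "coker_class D Z X1 Y1 b q1 \<in> Hom (fp_mod D) ?R Q"
      "coker_class D Y U Z d m \<in> Hom (fp_mod D) P ?R"
      unfolding P' Q1 Q2 by (intro coker_class_in_Hom l1 l2 lm)+
  qed (use N R in auto)
qed

text \<open>\<open>R\<close> is the pushout: the direct sum of \<open>Q\<close> and
  \<open>Q'\<close> modulo the image of \<open>(F, F')\<close>. A value of \<open>Q\<close> that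
  dies in it is a pair \<open>(v, 0)\<close> in that image up to relations, which gives the required
  \<open>u\<close>.\<close>

lemma weak_pushout_fp_mod:
  assumes sums: "has_direct_sums D"
    and P: "P \<in> Ob (fp_mod D)" "Q \<in> Ob (fp_mod D)" "Q' \<in> Ob (fp_mod D)"
    and F: "F \<in> Hom (fp_mod D) P Q" and F': "F' \<in> Hom (fp_mod D) P Q'"
  shows "\<exists>R\<in>Ob (fp_mod D). \<exists>k\<in>Hom (fp_mod D) Q R. \<exists>m\<in>Hom (fp_mod D) Q' R.
    Cmp (fp_mod D) P Q R k F = Cmp (fp_mod D) P Q' R m F' \<and>
    (\<forall>v\<in>fp_V Q. fp_act Q R k v \<in> fp_N R \<longrightarrow>
      (\<exists>u\<in>fp_V P. fp_act P Q F u - v \<in> fp_N Q \<and> fp_act P Q' F' u \<in> fp_N Q'))"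
proof -
  obtain X Y a where P': "P = (X, Y, a)" by (cases P)
  obtain X1 Y1 b where Q1: "Q = (X1, Y1, b)" by (cases Q)
  obtain X2 Y2 c where Q2: "Q' = (X2, Y2, c)" by (cases Q')
  note PQ = P[unfolded P' Q1 Q2]
  have o: "X \<in> Ob D" "Y \<in> Ob D" "X1 \<in> Ob D" "Y1 \<in> Ob D" "X2 \<in> Ob D" "Y2 \<in> Ob D"
    and abc: "a \<in> Hom D X Y" "b \<in> Hom D X1 Y1" "c \<in> Hom D X2 Y2"
    using P by (simp_all add: P' Q1 Q2 Ob_fp_mod)
  obtain f where f: "F = coker_class D Y X1 Y1 b f" "lifts X Y a X1 Y1 b f" "f \<in> Hom D Y Y1"
    using F unfolding P' Q1 by (rule fp_mod_HomE)
  obtain g where g: "F' = coker_class D Y X2 Y2 c g" "lifts X Y a X2 Y2 c g" "g \<in> Hom D Y Y2"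
    using F' unfolding P' Q2 by (rule fp_mod_HomE)
  obtain U i1 i2 p1 p2 where U: "U \<in> Ob D" "i1 \<in> Hom D X1 U" "i2 \<in> Hom D X2 U" "p1 \<in> Hom D U X1" "p2 \<in> Hom D U X2"
    and ip: "Cmp D X1 U X1 p1 i1 = Idm D X1" "Cmp D X2 U X2 p2 i2 = Idm D X2"
      "Cmp D X1 U X2 p2 i1 = Zer D X1 X2" "Cmp D X2 U X1 p1 i2 = Zer D X2 X1"
    using sums o(3,5) by (rule direct_sumE)
  obtain W r1 r2 s1 s2 where W: "W \<in> Ob D" "r1 \<in> Hom D U W" "r2 \<in> Hom D Y W" "s1 \<in> Hom D W U" "s2 \<in> Hom D W Y"
    and rs: "Cmp D U W U s1 r1 = Idm D U" "Cmp D Y W Y s2 r2 = Idm D Y"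
      "Cmp D U W Y s2 r1 = Zer D U Y" "Cmp D Y W U s1 r2 = Zer D Y U"
    using sums U(1) o(2) by (rule direct_sumE)
  obtain Z j1 j2 q1 q2 where Z: "Z \<in> Ob D" "j1 \<in> Hom D Y1 Z" "j2 \<in> Hom D Y2 Z" "q1 \<in> Hom D Z Y1" "q2 \<in> Hom D Z Y2"
    and jq: "Cmp D Y1 Z Y1 q1 j1 = Idm D Y1" "Cmp D Y2 Z Y2 q2 j2 = Idm D Y2"
      "Cmp D Y1 Z Y2 q2 j1 = Zer D Y1 Y2" "Cmp D Y2 Z Y1 q1 j2 = Zer D Y2 Y1"
    using sums o(4,6) by (rule direct_sumE)
  \<comment> \<open>\<open>n\<close> is the negative of \<open>j2\<close>: dividing by the image of
    \<open>(f, g)\<close> makes the square commute only after one leg has changed sign.\<close>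
  obtain n where n: "n \<in> Hom D Y2 Z" "Pls D Y2 Z n j2 = Zer D Y2 Z" using neg[OF o(6) Z(1,3)] by blast
  note facts = o abc f(3) g(3) U W Z n(1)
  \<comment> \<open>\<open>d\<close> presents the direct sum of \<open>Q\<close> and
    \<open>Q'\<close>, and \<open>e\<close> is the map \<open>(f, g)\<close> into its generators.
    The cokernel of the joint map \<open>l\<close> imposes both kinds of relations.\<close>
  define d where "d = Pls D U Z (Cmp D U X1 Z (Cmp D X1 Y1 Z j1 b) p1) (Cmp D U X2 Z (Cmp D X2 Y2 Z j2 c) p2)"
  define e where "e = Pls D Y Z (Cmp D Y Y1 Z j1 f) (Cmp D Y Y2 Z j2 g)"
  define l where "l = Pls D W Z (Cmp D W U Z d s1) (Cmp D W Y Z e s2)"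
  have d: "d \<in> Hom D U Z" and e: "e \<in> Hom D Y Z"
    unfolding d_def e_def using facts by (simp_all add: closed)
  have l: "l \<in> Hom D W Z" unfolding l_def using facts d e by (simp add: closed)
  have q1d: "Cmp D U Z Y1 q1 d = Cmp D U X1 Y1 b p1"
    unfolding d_def using facts by (simp add: closed distrib assoc jq ident zero)
  have q2d: "Cmp D U Z Y2 q2 d = Cmp D U X2 Y2 c p2"
    unfolding d_def using facts by (simp add: closed distrib assoc jq ident zero)
  have q1e: "Cmp D Y Z Y1 q1 e = f"
    unfolding e_def using facts by (simp add: closed distrib assoc jq ident zero)
  have q2e: "Cmp D Y Z Y2 q2 e = g"
    unfolding e_def using facts by (simp add: closed distrib assoc jq ident zero)
  have di1: "Cmp D X1 U Z d i1 = Cmp D X1 Y1 Z j1 b"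
    unfolding d_def using facts by (simp add: closed distrib assoc[symmetric] ip ident zero)
  have di2: "Cmp D X2 U Z d i2 = Cmp D X2 Y2 Z j2 c"
    unfolding d_def using facts by (simp add: closed distrib assoc[symmetric] ip ident zero)
  have lr1: "Cmp D U W Z l r1 = d"
    unfolding l_def using facts d e by (simp add: closed distrib assoc[symmetric] rs ident zero)
  have lr2: "Cmp D Y W Z l r2 = e"
    unfolding l_def using facts d e by (simp add: closed distrib assoc[symmetric] rs ident zero)
  let ?R = "(W, Z, l)"
  have R: "?R \<in> Ob (fp_mod D)" using W Z l by (simp add: Ob_fp_mod)
  have "Cmp D X1 Y1 Z j1 b = Cmp D X1 W Z l (Cmp D X1 U W r1 i1)"
    using facts l by (simp add: assoc lr1 di1)
  then have lj1: "lifts X1 Y1 b W Z l j1"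
    by (rule liftsI[OF Z(2), rotated]) (use facts in \<open>simp add: closed\<close>)
  have nc0: "Pls D X2 Z (Cmp D X2 Y2 Z n c) (Cmp D X2 Y2 Z j2 c) = Zer D X2 Z"
    using distrib(2)[OF o(5,6) Z(1) abc(3) n(1) Z(3)] n(2) facts by (simp add: zero)
  \<comment> \<open>\<open>t\<close> is minus the inclusion of \<open>X2\<close> into
    \<open>W\<close>, so \<open>n c\<close> and \<open>l t\<close> are both additive inverses of
    \<open>j2 c\<close>.\<close>
  obtain t where t: "t \<in> Hom D X2 W" "Pls D X2 W t (Cmp D X2 U W r1 i2) = Zer D X2 W"
    using neg[of X2 W "Cmp D X2 U W r1 i2"] facts by (auto simp: closed)
  have "Pls D X2 Z (Cmp D X2 W Z l t) (Cmp D X2 Y2 Z j2 c) = Zer D X2 Z"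
    using distrib(1)[of X2 W Z t "Cmp D X2 U W r1 i2" l] t facts l
    by (simp add: closed zero assoc lr1 di2)
  then have "Cmp D X2 Y2 Z n c = Cmp D X2 W Z l t"
    using nc0 facts t l by - (rule neg_unique[of X2 Z "Cmp D X2 Y2 Z j2 c"], simp_all add: closed)
  then have ln: "lifts X2 Y2 c W Z l n" by (rule liftsI[OF n(1) t(1)])
  have ng: "Pls D Y Z (Cmp D Y Y2 Z n g) (Cmp D Y Y2 Z j2 g) = Zer D Y Z"
    using distrib(2)[OF o(2,6) Z(1) g(3) n(1) Z(3)] n(2) facts by (simp add: zero)
  \<comment> \<open>As \<open>e = j1 f + j2 g\<close> and \<open>n\<close> is minus
    \<open>j2\<close>, the maps \<open>j1 f\<close> and \<open>n g\<close> differ by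
    \<open>e\<close>, which factors through \<open>l\<close>.\<close>
  have "Cmp D Y Y1 Z j1 f = Pls D Y Z (Cmp D Y Y2 Z n g) (Cmp D Y W Z l r2)"
    unfolding lr2 e_def using facts ng
    by (simp add: closed pls_left_commute[of Y Z _ "Cmp D Y Y1 Z j1 f"] zero)
  then have cls: "coker_class D Y W Z l (Cmp D Y Y1 Z j1 f) = coker_class D Y W Z l (Cmp D Y Y2 Z n g)"
    using facts l by (subst coker_class_eq_iff) (auto simp: closed)
  have ex: "\<exists>u\<in>fp_V P. fp_act P Q F u - v \<in> fp_N Q \<and> fp_act P Q' F' u \<in> fp_N Q'"
    if v: "v \<in> fp_V Q" and vN: "fp_act Q ?R (coker_class D Y1 W Z l j1) v \<in> fp_N ?R" for v
  proof -
    have vY: "v \<in> V Y1" using v by (simp add: fp_V_def Q1)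
    have "act Y1 Z j1 v \<in> fp_N ?R"
      using vN fp_act_in_N_iff[OF PQ(2) R Z(2) vY] by (simp add: Q1)
    then obtain w where w: "w \<in> V W" "act Y1 Z j1 v = act W Z l w" by (auto simp: fp_N_def)
    \<comment> \<open>The two components of the preimage \<open>w\<close>: \<open>x\<close> accounts
      for the relations of \<open>Q\<close> and \<open>Q'\<close>, and \<open>u\<close> is the
      wanted value of \<open>P\<close>.\<close>
    define x where "x = act W U s1 w"
    define u where "u = act W Y s2 w"
    have x: "x \<in> V U" and u: "u \<in> V Y" unfolding x_def u_def using w facts by (auto intro: act_V)
    have lw: "act Y1 Z j1 v = act U Z d x + act Y Z e u"
      unfolding w(2) l_def x_def u_def using facts d e w by (simp add: act_Pls act_Cmp closed)
    \<comment> \<open>Projecting to \<open>Y1\<close> recovers \<open>v\<close> as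
      \<open>f u\<close> up to the image of \<open>b\<close>. Projecting to \<open>Y2\<close>,
      further down, gives \<open>0\<close>, hence \<open>g u\<close> in the image of
      \<open>c\<close>.\<close>
    have "v = act Z Y1 q1 (act Y1 Z j1 v)"
      using facts vY by (simp add: act_Cmp[symmetric] jq act_Idm)
    also have "\<dots> = act X1 Y1 b (act U X1 p1 x) + act Y Y1 f u"
      unfolding lw using facts d e x u
      by (simp add: act_add act_V act_Cmp[symmetric] q1d q1e)
    finally have "act Y Y1 f u - v = act X1 Y1 b (- act U X1 p1 x)"
      using facts x by (simp add: strict.act_minus act_V)
    then have 1: "act Y Y1 f u - v \<in> fp_N Q"
      using subgroup_setD(3)[OF V[OF o(3)] act_V[OF U(1) o(3) U(4) x]] by (auto simp: Q1 intro: fp_NI)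
    have "0 = act Z Y2 q2 (act Y1 Z j1 v)"
      using facts vY strict.act_Zer[OF o(4,6) vY] by (simp add: act_Cmp[symmetric] jq)
    also have "\<dots> = act X2 Y2 c (act U X2 p2 x) + act Y Y2 g u"
      unfolding lw using facts d e x u
      by (simp add: act_add act_V act_Cmp[symmetric] q2d q2e)
    finally have "act Y Y2 g u = act X2 Y2 c (- act U X2 p2 x)"
      using facts x by (simp add: strict.act_minus act_V eq_neg_iff_add_eq_0 add.commute)
    then have 2: "act Y Y2 g u \<in> fp_N Q'"
      using subgroup_setD(3)[OF V[OF o(5)] act_V[OF U(1) o(5) U(5) x]] by (auto simp: Q2 intro: fp_NI)
    have "fp_act P Q F u - act Y Y1 f u \<in> fp_N Q"
      using fp_act_class[OF PQ(1,2) f(3) u] by (simp add: P' Q1 f(1))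
    from subgroup_setD(4)[OF subgroup_fp_N[OF P(2)] this 1]
    have "fp_act P Q F u - v \<in> fp_N Q" by simp
    moreover have "fp_act P Q' F' u \<in> fp_N Q'"
      using 2 fp_act_in_N_iff[OF PQ(1,3) g(3) u] by (simp add: P' Q2 g(1))
    moreover have "u \<in> fp_V P" using u by (simp add: P' fp_V_def)
    ultimately show ?thesis by blast
  qed
  have comm: "Cmp (fp_mod D) P Q ?R (coker_class D Y1 W Z l j1) F =
      Cmp (fp_mod D) P Q' ?R (coker_class D Y2 W Z l n) F'"
    unfolding P' Q1 Q2 f(1) g(1) Cmp_fp_mod[OF PQ(1,2) R f(2) lj1] Cmp_fp_mod[OF PQ(1,3) R g(2) ln]
    by (rule cls)
  have n_in: "coker_class D Y2 W Z l n \<in> Hom (fp_mod D) Q' ?R"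
    and j1_in: "coker_class D Y1 W Z l j1 \<in> Hom (fp_mod D) Q ?R"
    unfolding Q1 Q2 by (intro coker_class_in_Hom ln lj1)+
  show ?thesis
    by (rule bexI[OF _ R], rule bexI[OF _ j1_in], rule bexI[OF _ n_in]) (simp add: comm ex)
qed

lemma exact_subquotient_functor_fp_mod:
  assumes "has_direct_sums D"
  shows "exact_subquotient_functor (fp_mod D) fp_V fp_N fp_act"
  using subquotient_functor_fp_mod weak_product_fp_mod[OF assms] weak_pushout_fp_mod[OF assms]
  by (intro exact_subquotient_functor.intro exact_subquotient_functor_axioms.intro) auto

end

text \<open>
  Exactness without reference to chosen kernels: if every morphism killed by \<open>f\<close> acts as zero, then
  \<open>f\<close> acts injectively, and dually.
\<close>

locale exact_functor = subquotient_functor D V N act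
  for D :: "('o, 'm) addcat" and V N :: "'o \<Rightarrow> 'g::ab_group_add set" and act +
  assumes exact_mono: "\<lbrakk>X \<in> Ob D; Y \<in> Ob D; f \<in> Hom D X Y;
      \<And>T t v. \<lbrakk>T \<in> Ob D; t \<in> Hom D T X; Cmp D T X Y f t = Zer D T Y; v \<in> V T\<rbrakk> \<Longrightarrow> act T X t v \<in> N X;
      v \<in> V X; act X Y f v \<in> N Y\<rbrakk> \<Longrightarrow> v \<in> N X"
    and exact_epi: "\<lbrakk>X \<in> Ob D; Y \<in> Ob D; f \<in> Hom D X Y;
      \<And>T t v. \<lbrakk>T \<in> Ob D; t \<in> Hom D Y T; Cmp D X Y T t f = Zer D X T; v \<in> V Y\<rbrakk> \<Longrightarrow> act Y T t v \<in> N T;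
      v \<in> V Y\<rbrakk> \<Longrightarrow> \<exists>u\<in>V X. act X Y f u - v \<in> N Y"

section \<open>The extension to formal kernels and its exactness\<close>

context exact_subquotient_functor
begin

sublocale opp: preadditive_category "opposite D"
  by unfold_locales (rule preadditive_opposite[OF D])

text \<open>
  Because of the two opposites, the object \<open>(P, Q, a)\<close> is the formal kernel of \<open>a : Q \<rightarrow> P\<close>, and
  a morphism to \<open>(P', Q', a')\<close> is the class of some \<open>g : Q \<rightarrow> Q'\<close>, modulo maps factoring through \<open>a\<close>.
\<close>

abbreviation copresented :: "('o \<times> 'o \<times> 'm, 'm set) addcat" where
  "copresented \<equiv> opposite (fp_mod (opposite D))"

text \<open>The kernel of the map that \<open>a\<close> induces between subquotients, again as a
  subquotient: the numerator shrinks, the denominator \<open>N Q\<close> stays.\<close>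

definition cp_V :: "'o \<times> 'o \<times> 'm \<Rightarrow> 'g set" where
  "cp_V = (\<lambda>(P, Q, a). {v \<in> V Q. act Q P a v \<in> N P})"

definition cp_N :: "'o \<times> 'o \<times> 'm \<Rightarrow> 'g set" where
  "cp_N = (\<lambda>(P, Q, a). N Q)"

definition cp_act :: "'o \<times> 'o \<times> 'm \<Rightarrow> 'o \<times> 'o \<times> 'm \<Rightarrow> 'm set \<Rightarrow> 'g \<Rightarrow> 'g" where
  "cp_act = (\<lambda>(P, Q, a) (P', Q', a') F. act Q Q' (SOME g. g \<in> F))"

lemma Ob_copresented: "(P, Q, a) \<in> Ob copresented \<longleftrightarrow> P \<in> Ob D \<and> Q \<in> Ob D \<and> a \<in> Hom D Q P"
  by (simp add: opp.Ob_fp_mod)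

lemma in_cp_V: "v \<in> cp_V (P, Q, a) \<longleftrightarrow> v \<in> V Q \<and> act Q P a v \<in> N P"
  and in_cp_N: "v \<in> cp_N (P, Q, a) \<longleftrightarrow> v \<in> N Q"
  by (simp_all add: cp_V_def cp_N_def)

lemma opp_liftsI:
  "\<lbrakk>g \<in> Hom D Q Q'; h \<in> Hom D P P'; Cmp D Q Q' P' a' g = Cmp D Q P P' h a\<rbrakk>
    \<Longrightarrow> opp.lifts P' Q' a' P Q a g"
  unfolding opp.lifts_def by auto

lemma copresented_HomE:
  assumes "F \<in> Hom copresented (P, Q, a) (P', Q', a')"
  obtains g h where "F = coker_class (opposite D) Q' P Q a g" "opp.lifts P' Q' a' P Q a g"
    "g \<in> Hom D Q Q'" "h \<in> Hom D P P'" "Cmp D Q Q' P' a' g = Cmp D Q P P' h a"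
proof -
  from assms obtain g where g: "opp.lifts P' Q' a' P Q a g" "F = coker_class (opposite D) Q' P Q a g"
    unfolding Hom_opposite opp.Hom_fp_mod by blast
  from g(1) obtain h where "g \<in> Hom D Q Q'" "h \<in> Hom D P P'" "Cmp D Q Q' P' a' g = Cmp D Q P P' h a"
    unfolding opp.lifts_def Hom_opposite Cmp_opposite by blast
  with g show thesis using that by blast
qed

lemma copresented_HomI:
  "\<lbrakk>g \<in> Hom D Q Q'; h \<in> Hom D P P'; Cmp D Q Q' P' a' g = Cmp D Q P P' h a\<rbrakk>
    \<Longrightarrow> coker_class (opposite D) Q' P Q a g \<in> Hom copresented (P, Q, a) (P', Q', a')"
  unfolding Hom_opposite opp.Hom_fp_mod by (intro imageI) (simp add: opp_liftsI)

text \<open>\<open>g'\<close> and \<open>g\<close> differ by a composite \<open>s a\<close>, and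
  \<open>a\<close> already sends \<open>v\<close> into \<open>N P\<close>, which \<open>s\<close>
  maps into \<open>N Q'\<close>.\<close>

lemma act_class_mod:
  assumes o: "P \<in> Ob D" "Q \<in> Ob D" "Q' \<in> Ob D" "a \<in> Hom D Q P" and g: "g \<in> Hom D Q Q'"
    and g': "g' \<in> coker_class (opposite D) Q' P Q a g"
    and v: "v \<in> V Q" "act Q P a v \<in> N P"
  shows "act Q Q' g' v - act Q Q' g v \<in> N Q'"
proof -
  obtain s where s: "s \<in> Hom D P Q'" "g' = Pls D Q Q' g (Cmp D Q P Q' s a)"
    using g' unfolding coker_class_def by auto
  let ?sa = "Cmp D Q P Q' s a"
  have sa: "?sa \<in> Hom D Q Q'" using o s by (simp add: closed)
  note n = subgroup_setD[OF N[OF o(3)]]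
  have "act Q Q' ?sa v - act P Q' s (act Q P a v) \<in> N Q'" by (rule act_Cmp[OF o(2,1,3,4) s(1) v(1)])
  from n(4)[OF this act_N[OF o(1,3) s(1) v(2)]] have "act Q Q' ?sa v \<in> N Q'" by simp
  from n(4)[OF act_Pls[OF o(2,3) g sa v(1)] this] show ?thesis
    unfolding s(2) by (simp add: algebra_simps)
qed

lemma cp_act_class:
  assumes o: "(P, Q, a) \<in> Ob copresented" "(P', Q', a') \<in> Ob copresented"
    and g: "g \<in> Hom D Q Q'" and v: "v \<in> cp_V (P, Q, a)"
  shows "cp_act (P, Q, a) (P', Q', a') (coker_class (opposite D) Q' P Q a g) v - act Q Q' g v \<in> N Q'"
proof -
  have o': "P \<in> Ob D" "Q \<in> Ob D" "a \<in> Hom D Q P" "P' \<in> Ob D" "Q' \<in> Ob D" "a' \<in> Hom D Q' P'"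
    using o unfolding Ob_copresented by simp_all
  have "(SOME f. f \<in> coker_class (opposite D) Q' P Q a g) \<in> coker_class (opposite D) Q' P Q a g"
    by (rule someI, rule opp.coker_class_self) (use o' g in auto)
  from act_class_mod[OF o'(1,2,5,3) g this] show ?thesis
    using v by (simp add: cp_act_def in_cp_V)
qed

lemma cp_act_in_N_iff:
  assumes o: "(P, Q, a) \<in> Ob copresented" "(P', Q', a') \<in> Ob copresented"
    and g: "g \<in> Hom D Q Q'" and v: "v \<in> cp_V (P, Q, a)"
  shows "cp_act (P, Q, a) (P', Q', a') (coker_class (opposite D) Q' P Q a g) v \<in> N Q' \<longleftrightarrow>
    act Q Q' g v \<in> N Q'"
  by (rule subgroup_set_iff[OF N cp_act_class[OF assms]]) (use o(2) in \<open>simp add: opp.Ob_fp_mod\<close>)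

text \<open>The square trades \<open>a' g\<close> for \<open>h a\<close>, and \<open>h\<close>
  preserves the denominators.\<close>

lemma act_cp_V:
  assumes o: "P \<in> Ob D" "Q \<in> Ob D" "a \<in> Hom D Q P" "P' \<in> Ob D" "Q' \<in> Ob D" "a' \<in> Hom D Q' P'"
    and g: "g \<in> Hom D Q Q'" "h \<in> Hom D P P'" "Cmp D Q Q' P' a' g = Cmp D Q P P' h a"
    and v: "v \<in> V Q" "act Q P a v \<in> N P"
  shows "act Q' P' a' (act Q Q' g v) \<in> N P'"
proof -
  have "act Q P' (Cmp D Q P P' h a) v - act P P' h (act Q P a v) \<in> N P'"
    by (rule act_Cmp[OF o(2,1,4,3) g(2) v(1)])
  from subgroup_set_iff[OF N[OF o(4)] this] act_N[OF o(1,4) g(2) v(2)]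
  have "act Q P' (Cmp D Q Q' P' a' g) v \<in> N P'" unfolding g(3) by simp
  then show ?thesis using subgroup_set_iff[OF N[OF o(4)] act_Cmp[OF o(2,5,4) g(1) o(6) v(1)]] by simp
qed

lemma preadditive_copresented: "preadditive copresented"
  by (intro preadditive_opposite preadditive_fp_mod D)

lemma subquotient_functor_copresented: "subquotient_functor copresented cp_V cp_N cp_act"
proof (intro subquotient_functor.intro subquotient_functor_axioms.intro)
  show "preadditive_category copresented" by unfold_locales (rule preadditive_copresented)
  fix X assume X: "X \<in> Ob copresented"
  obtain P Q a where X': "X = (P, Q, a)" by (cases X)
  have oX: "P \<in> Ob D" "Q \<in> Ob D" "a \<in> Hom D Q P" using X unfolding X' Ob_copresented by simp_all
  note X1 = X[unfolded X']
  show "subgroup_set (cp_V X)"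
    using subgroup_setD[OF V[OF oX(2)]] subgroup_setD[OF N[OF oX(1)]]
    by (auto simp: X' subgroup_set_def in_cp_V act_zero[OF oX(2,1,3)] act_diff[OF oX(2,1,3)])
  show "subgroup_set (cp_N X)" using N[OF oX(2)] by (simp add: X' cp_N_def)
  show "v \<in> cp_V X" if "v \<in> cp_N X" for v
    using that NV[OF oX(2)] act_N[OF oX(2,1,3)] by (simp add: X' in_cp_V in_cp_N)
  show "cp_act X X (Idm copresented X) v - v \<in> cp_N X" if v: "v \<in> cp_V X" for v
  proof -
    have "cp_act X X (Idm copresented X) v - act Q Q (Idm D Q) v \<in> N Q"
      using cp_act_class[OF X1 X1 closed(1)[OF oX(2)]] v by (simp add: X' opp.Idm_fp_mod)
    moreover have "act Q Q (Idm D Q) v - v \<in> N Q" using act_Idm[OF oX(2)] v by (simp add: X' in_cp_V)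
    ultimately show ?thesis using subgroup_setD(4)[OF N[OF oX(2)]] by (fastforce simp: X' in_cp_N)
  qed
  fix Y F assume Y: "Y \<in> Ob copresented" and F: "F \<in> Hom copresented X Y"
  obtain P' Q' a' where Y': "Y = (P', Q', a')" by (cases Y)
  have oY: "P' \<in> Ob D" "Q' \<in> Ob D" "a' \<in> Hom D Q' P'" using Y unfolding Y' Ob_copresented by simp_all
  note Y1 = Y[unfolded Y']
  obtain f h where f: "F = coker_class (opposite D) Q' P Q a f" "opp.lifts P' Q' a' P Q a f"
    "f \<in> Hom D Q Q'" "h \<in> Hom D P P'" "Cmp D Q Q' P' a' f = Cmp D Q P P' h a"
    using F unfolding X' Y' by (rule copresented_HomE)
  have "(SOME f'. f' \<in> F) \<in> F" unfolding f(1)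
    by (rule someI, rule opp.coker_class_self) (use oX oY f in auto)
  then have "opp.lifts P' Q' a' P Q a (SOME f'. f' \<in> F)"
    using opp.lifts_class[of P' Q' a' P Q a f] X Y f(1,2) unfolding X' Y' by simp
  then obtain h' where some: "(SOME f'. f' \<in> F) \<in> Hom D Q Q'" "h' \<in> Hom D P P'"
    "Cmp D Q Q' P' a' (SOME f'. f' \<in> F) = Cmp D Q P P' h' a"
    unfolding opp.lifts_def Hom_opposite Cmp_opposite by blast
  define f' where "f' = (SOME f'. f' \<in> F)"
  note some' = some[folded f'_def]
  have act_eq: "cp_act X Y F v = act Q Q' f' v" for v by (simp add: X' Y' cp_act_def f'_def)
  show in_V: "cp_act X Y F v \<in> cp_V Y" if "v \<in> cp_V X" for v
  proof -
    have v: "v \<in> V Q" "act Q P a v \<in> N P" using that by (simp_all add: X' in_cp_V)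
    show ?thesis unfolding act_eq unfolding Y' in_cp_V
      by (rule conjI[OF act_V[OF oX(2) oY(2) some'(1) v(1)] act_cp_V[OF oX oY some' v]])
  qed
  show "cp_act X Y F v \<in> cp_N Y" if "v \<in> cp_N X" for v
    using act_N[OF oX(2) oY(2) some'(1)] that by (simp add: act_eq) (simp add: X' Y' in_cp_N)
  show "cp_act X Y F (v + w) = cp_act X Y F v + cp_act X Y F w" if "v \<in> cp_V X" "w \<in> cp_V X" for v w
    unfolding act_eq by (rule act_add[OF oX(2) oY(2) some'(1)]) (use that in \<open>simp_all add: X' in_cp_V\<close>)
  {
    fix G v assume G: "G \<in> Hom copresented X Y" and v: "v \<in> cp_V X"
    obtain g k where g: "G = coker_class (opposite D) Q' P Q a g" "opp.lifts P' Q' a' P Q a g"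
      "g \<in> Hom D Q Q'" "k \<in> Hom D P P'" "Cmp D Q Q' P' a' g = Cmp D Q P P' k a"
      using G unfolding X' Y' by (rule copresented_HomE)
    have vQ: "v \<in> V Q" using v by (simp add: X' in_cp_V)
    have "Pls copresented X Y F G = coker_class (opposite D) Q' P Q a (Pls D Q Q' f g)"
      using opp.Pls_fp_mod[of P' Q' a' P Q a f g] X1 Y1 f g by (simp add: X' Y')
    then have 1: "cp_act X Y (Pls copresented X Y F G) v - act Q Q' (Pls D Q Q' f g) v \<in> N Q'"
      using cp_act_class[OF X1 Y1 closed(4)[OF oX(2) oY(2) f(3) g(3)]] v by (simp add: X' Y')
    have 2: "cp_act X Y F v - act Q Q' f v \<in> N Q'" "cp_act X Y G v - act Q Q' g v \<in> N Q'"
      using cp_act_class[OF X1 Y1 f(3)] cp_act_class[OF X1 Y1 g(3)] v by (simp_all add: X' Y' f(1) g(1))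
    note n = subgroup_setD[OF N[OF oY(2)]]
    from n(2)[OF n(4)[OF 1 act_Pls[OF oX(2) oY(2) f(3) g(3) vQ]] n(4)[OF 2]]
    show "cp_act X Y (Pls copresented X Y F G) v - (cp_act X Y F v + cp_act X Y G v) \<in> cp_N Y"
      unfolding Y' in_cp_N by (simp add: algebra_simps)
  }
  fix Z G v assume Z: "Z \<in> Ob copresented" and G: "G \<in> Hom copresented Y Z" and v: "v \<in> cp_V X"
  obtain P'' Q'' a'' where Z': "Z = (P'', Q'', a'')" by (cases Z)
  have oZ: "P'' \<in> Ob D" "Q'' \<in> Ob D" "a'' \<in> Hom D Q'' P''" using Z unfolding Z' Ob_copresented by simp_all
  note Z1 = Z[unfolded Z']
  obtain g k where g: "G = coker_class (opposite D) Q'' P' Q' a' g" "opp.lifts P'' Q'' a'' P' Q' a' g"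
    "g \<in> Hom D Q' Q''" "k \<in> Hom D P' P''" "Cmp D Q' Q'' P'' a'' g = Cmp D Q' P' P'' k a'"
    using G unfolding Y' Z' by (rule copresented_HomE)
  have vQ: "v \<in> V Q" using v by (simp add: X' in_cp_V)
  let ?fv = "cp_act X Y F v"
  have fv: "?fv \<in> V Q'" "?fv \<in> cp_V (P', Q', a')" using in_V[OF v] by (simp_all add: Y' in_cp_V)
  have gf: "Cmp D Q Q' Q'' g f \<in> Hom D Q Q''" using oX oY oZ f g by (simp add: closed)
  have "Cmp copresented X Y Z G F = coker_class (opposite D) Q'' P Q a (Cmp D Q Q' Q'' g f)"
    using opp.Cmp_fp_mod[of P'' Q'' a'' P' Q' a' P Q a g f] X1 Y1 Z1 f g by (simp add: X' Y' Z')
  then have 1: "cp_act X Z (Cmp copresented X Y Z G F) v - act Q Q'' (Cmp D Q Q' Q'' g f) v \<in> N Q''"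
    using cp_act_class[OF X1 Z1 gf] v by (simp add: X' Z')
  have 2: "cp_act Y Z G ?fv - act Q' Q'' g ?fv \<in> N Q''"
    using cp_act_class[OF Y1 Z1 g(3) fv(2)] by (simp add: Y' Z' g(1))
  have fvQ: "act Q Q' f v \<in> V Q'" by (rule act_V[OF oX(2) oY(2) f(3) vQ])
  have "?fv - act Q Q' f v \<in> N Q'"
    using cp_act_class[OF X1 Y1 f(3)] v by (simp add: X' Y' f(1))
  from act_N[OF oY(2) oZ(2) g(3) this]
  have 3: "act Q' Q'' g ?fv - act Q' Q'' g (act Q Q' f v) \<in> N Q''"
    unfolding act_diff[OF oY(2) oZ(2) g(3) fv(1) fvQ] .
  note n = subgroup_setD[OF N[OF oZ(2)]]
  from n(2)[OF n(2)[OF n(4)[OF 1 act_Cmp[OF oX(2) oY(2) oZ(2) f(3) g(3) vQ]] 3] 2]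
  show "cp_act X Z (Cmp copresented X Y Z G F) v - cp_act Y Z G ?fv \<in> cp_N Z"
    unfolding Z' in_cp_N by simp
qed

text \<open>The test object is the formal kernel of the weak product of \<open>a\<close> and \<open>g\<close>.\<close>

lemma copresented_mono:
  assumes X: "X \<in> Ob copresented" and Y: "Y \<in> Ob copresented" and F: "F \<in> Hom copresented X Y"
    and null: "\<And>T t v. \<lbrakk>T \<in> Ob copresented; t \<in> Hom copresented T X;
      Cmp copresented T X Y F t = Zer copresented T Y; v \<in> cp_V T\<rbrakk> \<Longrightarrow> cp_act T X t v \<in> cp_N X"
    and v: "v \<in> cp_V X" "cp_act X Y F v \<in> cp_N Y"
  shows "v \<in> cp_N X"
proof -
  obtain P Q a where X': "X = (P, Q, a)" by (cases X)
  obtain P' Q' a' where Y': "Y = (P', Q', a')" by (cases Y)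
  note X1 = X[unfolded X'] and Y1 = Y[unfolded Y']
  have oX: "P \<in> Ob D" "Q \<in> Ob D" "a \<in> Hom D Q P" using X unfolding X' Ob_copresented by simp_all
  have oY: "P' \<in> Ob D" "Q' \<in> Ob D" "a' \<in> Hom D Q' P'" using Y unfolding Y' Ob_copresented by simp_all
  obtain g h where g: "F = coker_class (opposite D) Q' P Q a g" "opp.lifts P' Q' a' P Q a g"
    "g \<in> Hom D Q Q'" "h \<in> Hom D P P'" "Cmp D Q Q' P' a' g = Cmp D Q P P' h a"
    using F unfolding X' Y' by (rule copresented_HomE)
  obtain Z m p q where Z: "Z \<in> Ob D" "m \<in> Hom D Q Z" "p \<in> Hom D Z P" "q \<in> Hom D Z Q'"
    "Cmp D Q Z P p m = a" "Cmp D Q Z Q' q m = g"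
    and mN: "\<And>v. v \<in> V Q \<Longrightarrow> act Q P a v \<in> N P \<Longrightarrow> act Q Q' g v \<in> N Q' \<Longrightarrow> act Q Z m v \<in> N Z"
    using weak_product[OF oX(2,1) oY(2) oX(3) g(3)] by metis
  let ?T = "(Z, Q, m)"
  \<comment> \<open>The inclusion of the formal kernel of \<open>m\<close> into that of
    \<open>a\<close>, represented by the identity of \<open>Q\<close>. It exists because
    \<open>a = p m\<close>.\<close>
  let ?t = "coker_class (opposite D) Q Z Q m (Idm D Q)"
  have T: "?T \<in> Ob copresented" unfolding Ob_copresented using Z oX by simp
  have eq: "Cmp D Q Q P a (Idm D Q) = Cmp D Q Z P p m" using Z oX by (simp add: ident)
  have t: "?t \<in> Hom copresented ?T X"
    unfolding X' by (rule copresented_HomI[OF closed(1)[OF oX(2)] Z(3) eq])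
  have lt: "opp.lifts P Q a Z Q m (Idm D Q)"
    by (rule opp_liftsI[OF closed(1)[OF oX(2)] Z(3) eq])
  have "Cmp copresented ?T X Y F ?t = coker_class (opposite D) Q' Z Q m g"
    using opp.Cmp_fp_mod[of P' Q' a' P Q a Z Q m g "Idm D Q"] X1 Y1 T g(1,2,3) lt oX oY
    by (simp add: X' Y' ident)
  \<comment> \<open>Morphisms out of \<open>?T\<close> are taken modulo maps through
    \<open>m\<close>, and \<open>g = q m\<close>.\<close>
  also have "\<dots> = Zer copresented ?T Y"
    using opp.coker_class_zero_iff[of Q' Z Q m g] Z oX oY g(3) by (auto simp: Y' opp.Zer_fp_mod)
  finally have zero: "Cmp copresented ?T X Y F ?t = Zer copresented ?T Y" .
  have vQ: "v \<in> V Q" "act Q P a v \<in> N P" using v(1) by (simp_all add: X' in_cp_V)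
  have "act Q Q' g v \<in> N Q'"
    using v cp_act_in_N_iff[OF X1 Y1 g(3)] by (simp add: X' Y' g(1) in_cp_N)
  \<comment> \<open>\<open>v\<close> is itself a value at the test object, and \<open>?t\<close>
    acts on it as the identity modulo \<open>N\<close>, so \<open>null\<close> yields the
    claim.\<close>
  then have vT: "v \<in> cp_V ?T" using mN vQ by (simp add: in_cp_V)
  have "cp_act ?T X ?t v \<in> N Q" using null[OF T t zero vT] by (simp add: X' in_cp_N)
  then have "act Q Q (Idm D Q) v \<in> N Q"
    using cp_act_in_N_iff[OF T X1 closed(1)[OF oX(2)] vT] by (simp add: X')
  then show ?thesis using subgroup_set_iff[OF N[OF oX(2)] act_Idm[OF oX(2) vQ(1)]] by (simp add: X' in_cp_N)
qed

text \<open>The test morphism goes to the weak pushout of \<open>g\<close> and \<open>a\<close>.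
  Since \<open>k g = m a\<close> and maps through \<open>a\<close> vanish on \<open>X\<close>, its
  composite with \<open>F\<close> is zero. So \<open>k\<close> kills \<open>v\<close>, and the
  pushout returns a \<open>u\<close> with \<open>g u\<close> congruent to \<open>v\<close> and
  \<open>a u\<close> congruent to zero; the latter says that \<open>u\<close> is a value at
  \<open>X\<close>.\<close>

lemma copresented_epi:
  assumes X: "X \<in> Ob copresented" and Y: "Y \<in> Ob copresented" and F: "F \<in> Hom copresented X Y"
    and null: "\<And>T t v. \<lbrakk>T \<in> Ob copresented; t \<in> Hom copresented Y T;
      Cmp copresented X Y T t F = Zer copresented X T; v \<in> cp_V Y\<rbrakk> \<Longrightarrow> cp_act Y T t v \<in> cp_N T"
    and v: "v \<in> cp_V Y"
  shows "\<exists>u\<in>cp_V X. cp_act X Y F u - v \<in> cp_N Y"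
proof -
  obtain P Q a where X': "X = (P, Q, a)" by (cases X)
  obtain P' Q' a' where Y': "Y = (P', Q', a')" by (cases Y)
  note X1 = X[unfolded X'] and Y1 = Y[unfolded Y']
  have oX: "P \<in> Ob D" "Q \<in> Ob D" "a \<in> Hom D Q P" using X unfolding X' Ob_copresented by simp_all
  have oY: "P' \<in> Ob D" "Q' \<in> Ob D" "a' \<in> Hom D Q' P'" using Y unfolding Y' Ob_copresented by simp_all
  obtain g h where g: "F = coker_class (opposite D) Q' P Q a g" "opp.lifts P' Q' a' P Q a g"
    "g \<in> Hom D Q Q'" "h \<in> Hom D P P'" "Cmp D Q Q' P' a' g = Cmp D Q P P' h a"
    using F unfolding X' Y' by (rule copresented_HomE)
  obtain Z k m where Z: "Z \<in> Ob D" "k \<in> Hom D Q' Z" "m \<in> Hom D P Z"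
    "Cmp D Q Q' Z k g = Cmp D Q P Z m a"
    and ex: "\<And>v. v \<in> V Q' \<Longrightarrow> act Q' Z k v \<in> N Z \<Longrightarrow>
      \<exists>u\<in>V Q. act Q Q' g u - v \<in> N Q' \<and> act Q P a u \<in> N P"
    using weak_pushout[OF oX(2) oY(2) oX(1) g(3) oX(3)] by metis
  \<comment> \<open>The formal kernel of a zero map is all of \<open>Z\<close>, so every map from
    \<open>Q'\<close> to \<open>Z\<close> represents a morphism from \<open>Y\<close> into
    it.\<close>
  let ?T = "(Z, Z, Zer D Z Z)"
  let ?t = "coker_class (opposite D) Z P' Q' a' k"
  have z: "Zer D Z Z \<in> Hom D Z Z" "Zer D P' Z \<in> Hom D P' Z" using closed(3) Z oY by simp_all
  have T: "?T \<in> Ob copresented" unfolding Ob_copresented using Z z by simp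
  have eq: "Cmp D Q' Z Z (Zer D Z Z) k = Cmp D Q' P' Z (Zer D P' Z) a'"
    using Z oY by (simp add: zero)
  have t: "?t \<in> Hom copresented Y ?T" unfolding Y' by (rule copresented_HomI[OF Z(2) z(2) eq])
  have lt: "opp.lifts Z Z (Zer D Z Z) P' Q' a' k" by (rule opp_liftsI[OF Z(2) z(2) eq])
  have "Cmp copresented X Y ?T ?t F = coker_class (opposite D) Z P Q a (Cmp D Q Q' Z k g)"
    using opp.Cmp_fp_mod[of Z Z "Zer D Z Z" P' Q' a' P Q a k g] X1 Y1 T g(1,2,3) lt
    by (simp add: X' Y')
  also have "\<dots> = Zer copresented X ?T"
    using opp.coker_class_zero_iff[of Z P Q a "Cmp D Q Q' Z k g"] Z oX oY g(3)
    by (auto simp: X' opp.Zer_fp_mod closed)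
  finally have zero: "Cmp copresented X Y ?T ?t F = Zer copresented X ?T" .
  have vQ: "v \<in> V Q'" using v by (simp add: Y' in_cp_V)
  have "cp_act Y ?T ?t v \<in> N Z" using null[OF T t zero v] by (simp add: in_cp_N)
  then have "act Q' Z k v \<in> N Z"
    using cp_act_in_N_iff[OF Y1 T Z(2)] v by (simp add: Y')
  then obtain u where u: "u \<in> V Q" "act Q Q' g u - v \<in> N Q'" "act Q P a u \<in> N P"
    using ex[OF vQ] by blast
  have uX: "u \<in> cp_V X" using u by (simp add: X' in_cp_V)
  have "cp_act X Y F u - act Q Q' g u \<in> N Q'"
    using cp_act_class[OF X1 Y1 g(3)] uX by (simp add: X' Y' g(1))
  from subgroup_setD(4)[OF N[OF oY(2)] this u(2)] have "cp_act X Y F u - v \<in> cp_N Y"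
    by (simp add: Y' in_cp_N)
  then show ?thesis using uX by blast
qed

lemma exact_functor_copresented: "exact_functor copresented cp_V cp_N cp_act"
proof (intro exact_functor.intro exact_functor_axioms.intro)
  show "subquotient_functor copresented cp_V cp_N cp_act" by (rule subquotient_functor_copresented)
qed (rule copresented_mono copresented_epi; assumption)+

end

section \<open>The Serre quotient by the kernel of an exact functor\<close>

context exact_functor
begin

text \<open>The kernel of the functor, which becomes the Serre subcategory: the subquotient at
  \<open>X\<close> is zero.\<close>

definition acyclic :: "'o set" where
  "acyclic = {X \<in> Ob D. V X \<subseteq> N X}"

text \<open>Every morphism killed by \<open>f\<close> factors through \<open>K\<close>, where all
  values vanish; so it acts as zero and \<open>exact_mono\<close> applies.\<close>

lemma injective_if_acyclic_kernel:
  assumes o: "X \<in> Ob D" "Y \<in> Ob D" and K: "is_kernel D X Y f K k" "K \<in> acyclic"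
    and v: "v \<in> V X" "act X Y f v \<in> N Y"
  shows "v \<in> N X"
proof (rule exact_mono[OF o _ _ v])
  show f: "f \<in> Hom D X Y" using K(1) by (simp add: is_kernel_def)
  fix T t v assume t: "T \<in> Ob D" "t \<in> Hom D T X" "Cmp D T X Y f t = Zer D T Y" and v: "v \<in> V T"
  have k: "K \<in> Ob D" "k \<in> Hom D K X" using K(1) by (simp_all add: is_kernel_def)
  obtain u where u: "u \<in> Hom D T K" "Cmp D T K X k u = t"
    using K(1) t unfolding is_kernel_def by blast
  have "act T K u v \<in> N K" using act_V[OF t(1) k(1) u(1) v] K(2) by (auto simp: acyclic_def)
  then have "act K X k (act T K u v) \<in> N X" by (rule act_N[OF k(1) o(1) k(2)])
  then show "act T X t v \<in> N X"
    using subgroup_set_iff[OF N[OF o(1)] act_Cmp[OF t(1) k(1) o(1) u(1) k(2) v]] u(2) by simp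
qed

text \<open>Dually, every morphism that kills \<open>f\<close> factors through \<open>C\<close> and
  acts as zero.\<close>

lemma surjective_if_acyclic_cokernel:
  assumes o: "X \<in> Ob D" "Y \<in> Ob D" and C: "is_cokernel D X Y f C c" "C \<in> acyclic" and v: "v \<in> V Y"
  shows "\<exists>u\<in>V X. act X Y f u - v \<in> N Y"
proof (rule exact_epi[OF o _ _ v])
  show f: "f \<in> Hom D X Y" using C(1) by (simp add: is_cokernel_def is_kernel_def)
  fix T t v assume t: "T \<in> Ob D" "t \<in> Hom D Y T" "Cmp D X Y T t f = Zer D X T" and v: "v \<in> V Y"
  have c: "C \<in> Ob D" "c \<in> Hom D Y C" using C(1) by (simp_all add: is_cokernel_def is_kernel_def)
  obtain u where u: "u \<in> Hom D C T" "Cmp D Y C T u c = t"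
    using C(1) t unfolding is_cokernel_def is_kernel_def by (metis Hom_opposite Cmp_opposite Zer_opposite Ob_opposite)
  have "act Y C c v \<in> N C" using act_V[OF o(2) c v] C(2) by (auto simp: acyclic_def)
  then have "act C T u (act Y C c v) \<in> N T" by (rule act_N[OF c(1) t(1) u(1)])
  then show "act Y T t v \<in> N T"
    using subgroup_set_iff[OF N[OF t(1)] act_Cmp[OF o(2) c(1) t(1) c(2) u(1) v]] u(2) by simp
qed

text \<open>A monomorphism kills only the zero morphism, so it acts injectively, here into a group
  that vanishes.\<close>

lemma is_mono_acyclic:
  assumes o: "X \<in> Ob D" and Y: "Y \<in> acyclic" and f: "is_mono D X Y f"
  shows "X \<in> acyclic"
proof -
  have oY: "Y \<in> Ob D" "V Y \<subseteq> N Y" using Y by (simp_all add: acyclic_def)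
  have fH: "f \<in> Hom D X Y" using f by (simp add: is_mono_def)
  have "v \<in> N X" if v: "v \<in> V X" for v
  proof (rule exact_mono[OF o oY(1) fH _ v])
    show "act X Y f v \<in> N Y" using act_V[OF o oY(1) fH v] oY(2) by blast
    fix T t v assume t: "T \<in> Ob D" "t \<in> Hom D T X" "Cmp D T X Y f t = Zer D T Y" and v: "v \<in> V T"
    have z: "Zer D T X \<in> Hom D T X" by (rule closed(3)[OF t(1) o])
    have "Cmp D T X Y f t = Cmp D T X Y f (Zer D T X)" using t(3) zero(4)[OF t(1) o oY(1) fH] by simp
    then have "t = Zer D T X" using f t(1,2) z unfolding is_mono_def by blast
    then show "act T X t v \<in> N X" using act_Zer[OF t(1) o v] by simp
  qed
  then show ?thesis using o by (auto simp: acyclic_def)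
qed

lemma is_epi_acyclic:
  assumes X: "X \<in> acyclic" and o: "Y \<in> Ob D" and f: "is_epi D X Y f"
  shows "Y \<in> acyclic"
proof -
  have oX: "X \<in> Ob D" "V X \<subseteq> N X" using X by (simp_all add: acyclic_def)
  have fH: "f \<in> Hom D X Y" using f by (simp add: is_epi_def is_mono_def)
  have "v \<in> N Y" if v: "v \<in> V Y" for v
  proof -
    have "\<exists>u\<in>V X. act X Y f u - v \<in> N Y"
    proof (rule exact_epi[OF oX(1) o fH _ v])
      fix T t v assume t: "T \<in> Ob D" "t \<in> Hom D Y T" "Cmp D X Y T t f = Zer D X T" and v: "v \<in> V Y"
      have z: "Zer D Y T \<in> Hom D Y T" by (rule closed(3)[OF o t(1)])
      have "Cmp D X Y T t f = Cmp D X Y T (Zer D Y T) f" using t(3) zero(3)[OF oX(1) o t(1) fH] by simp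
      then have "t = Zer D Y T" using f t(1,2) z unfolding is_epi_def is_mono_def by simp
      then show "act Y T t v \<in> N T" using act_Zer[OF o t(1) v] by simp
    qed
    then obtain u where u: "u \<in> V X" "act X Y f u - v \<in> N Y" by blast
    have "act X Y f u \<in> N Y" using act_N[OF oX(1) o fH] u(1) oX(2) by blast
    then show ?thesis using subgroup_set_iff[OF N[OF o] u(2)] by blast
  qed
  then show ?thesis using o by (auto simp: acyclic_def)
qed

text \<open>\<open>X\<close> is an acyclic kernel of \<open>g\<close>, so \<open>g\<close> acts
  injectively, and its values lie in the vanishing group at \<open>Z\<close>.\<close>

lemma short_exact_acyclic:
  assumes X: "X \<in> acyclic" and o: "Y \<in> Ob D" and Z: "Z \<in> acyclic" and fg: "short_exact D X Y Z f g"
  shows "Y \<in> acyclic"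
proof -
  have oZ: "Z \<in> Ob D" "V Z \<subseteq> N Z" using Z by (simp_all add: acyclic_def)
  have K: "is_kernel D Y Z g X f" using fg by (simp add: short_exact_def)
  have g: "g \<in> Hom D Y Z" using K by (simp add: is_kernel_def)
  have "v \<in> N Y" if v: "v \<in> V Y" for v
    using injective_if_acyclic_kernel[OF o oZ(1) K X v] act_V[OF o oZ(1) g v] oZ(2) by blast
  then show ?thesis using o by (auto simp: acyclic_def)
qed

lemma serre_subcategory_acyclic:
  assumes "X \<in> acyclic" shows "serre_subcategory D acyclic"
proof -
  have "acyclic \<subseteq> Ob D" by (auto simp: acyclic_def)
  then show ?thesis unfolding serre_subcategory_def
    using assms is_mono_acyclic is_epi_acyclic short_exact_acyclic by blast
qed

text \<open>
  The functor takes values in subquotients of one group, so a formal composite of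
  morphisms and inverses acts as a relation on that group.
\<close>

fun arrow_rel :: "('o, 'm) zarrow \<Rightarrow> ('g \<times> 'g) set" where
  "arrow_rel (Fwd X Y f) = {(v, w). v \<in> V X \<and> w \<in> V Y \<and> act X Y f v - w \<in> N Y}"
| "arrow_rel (Bwd X Y f) = {(w, v). v \<in> V X \<and> w \<in> V Y \<and> act X Y f v - w \<in> N Y}"

text \<open>The identity map of the subquotient \<open>V X / N X\<close>, as a relation between
  representatives.\<close>

definition mod_rel :: "'o \<Rightarrow> ('g \<times> 'g) set" where
  "mod_rel X = {(v, w). v \<in> V X \<and> w \<in> V X \<and> v - w \<in> N X}"

primrec path_rel :: "'o \<Rightarrow> ('o, 'm) zarrow list \<Rightarrow> ('g \<times> 'g) set" where
  "path_rel X [] = mod_rel X"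
| "path_rel X (a # p) = arrow_rel a O path_rel (ztgt a) p"

lemma mod_rel_relcomp:
  assumes "X \<in> Ob D" shows "mod_rel X O mod_rel X = mod_rel X"
proof -
  note n = subgroup_setD[OF N[OF assms]]
  have "v - x \<in> N X" if "v - w \<in> N X" "w - x \<in> N X" for v w x using n(4)[OF that] by simp
  then show ?thesis using n(1) by (auto simp: mod_rel_def relcomp_unfold)
qed

text \<open>\<open>path_rel\<close> puts \<open>mod_rel\<close> at the end of every path, so arrows
  have to absorb it from either side for concatenation to become relational composition.\<close>

lemma Fwd_mod_rel:
  assumes o: "X \<in> Ob D" "Y \<in> Ob D" and f: "f \<in> Hom D X Y"
  shows "mod_rel X O arrow_rel (Fwd X Y f) = arrow_rel (Fwd X Y f)"
    and "arrow_rel (Fwd X Y f) O mod_rel Y = arrow_rel (Fwd X Y f)"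
proof -
  note nX = subgroup_setD[OF N[OF o(1)]] and nY = subgroup_setD[OF N[OF o(2)]]
  have 1: "act X Y f v - w \<in> N Y"
    if "v \<in> V X" "x \<in> V X" "v - x \<in> N X" "act X Y f x - w \<in> N Y" for v x w
    using nY(4)[OF act_N[OF o f that(3)] that(4)] act_diff[OF o f that(1,2)] by simp
  show "mod_rel X O arrow_rel (Fwd X Y f) = arrow_rel (Fwd X Y f)"
    using nX(1) 1 by (fastforce simp: mod_rel_def relcomp_unfold)
  have 2: "act X Y f v - w \<in> N Y" if "act X Y f v - x \<in> N Y" "x - w \<in> N Y" for v x w
    using nY(4)[OF that] by simp
  show "arrow_rel (Fwd X Y f) O mod_rel Y = arrow_rel (Fwd X Y f)"
    using nY(1) 2 by (fastforce simp: mod_rel_def relcomp_unfold)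
qed

lemma arrow_rel_Bwd: "arrow_rel (Bwd X Y f) = (arrow_rel (Fwd X Y f))\<inverse>"
  by auto

lemma mod_rel_converse:
  assumes "X \<in> Ob D" shows "(mod_rel X)\<inverse> = mod_rel X"
  using subgroup_setD(3)[OF N[OF assms]] by (fastforce simp: mod_rel_def)

lemma Bwd_mod_rel:
  assumes o: "X \<in> Ob D" "Y \<in> Ob D" and f: "f \<in> Hom D X Y"
  shows "mod_rel Y O arrow_rel (Bwd X Y f) = arrow_rel (Bwd X Y f)"
    and "arrow_rel (Bwd X Y f) O mod_rel X = arrow_rel (Bwd X Y f)"
  using arg_cong[OF Fwd_mod_rel(2)[OF assms], of converse] arg_cong[OF Fwd_mod_rel(1)[OF assms], of converse]
  unfolding arrow_rel_Bwd converse_relcomp mod_rel_converse[OF o(1)] mod_rel_converse[OF o(2)]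
  by blast+

lemma Fwd_comp:
  assumes o: "X \<in> Ob D" "Y \<in> Ob D" "Z \<in> Ob D" and f: "f \<in> Hom D X Y" and g: "g \<in> Hom D Y Z"
  shows "arrow_rel (Fwd X Y f) O arrow_rel (Fwd Y Z g) = arrow_rel (Fwd X Z (Cmp D X Y Z g f))"
proof -
  note n = subgroup_setD[OF N[OF o(3)]]
  have c: "act X Z (Cmp D X Y Z g f) v - act Y Z g (act X Y f v) \<in> N Z" if "v \<in> V X" for v
    by (rule act_Cmp[OF o f g that])
  have 1: "act X Z (Cmp D X Y Z g f) v - x \<in> N Z"
    if v: "v \<in> V X" "w \<in> V Y" "act X Y f v - w \<in> N Y" "act Y Z g w - x \<in> N Z" for v w x
  proof -
    have "act Y Z g (act X Y f v) - act Y Z g w \<in> N Z"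
      using act_N[OF o(2,3) g v(3)] act_diff[OF o(2,3) g act_V[OF o(1,2) f v(1)] v(2)] by simp
    from n(4)[OF n(4)[OF c[OF v(1)] this] v(4)] show ?thesis by simp
  qed
  have 2: "\<exists>w. w \<in> V Y \<and> act X Y f v - w \<in> N Y \<and> act Y Z g w - x \<in> N Z"
    if v: "v \<in> V X" "act X Z (Cmp D X Y Z g f) v - x \<in> N Z" for v x
    using n(2)[OF v(2) c[OF v(1)]] act_V[OF o(1,2) f v(1)] subgroup_setD(1)[OF N[OF o(2)]]
      n(3) by (intro exI[of _ "act X Y f v"]) (use n(2)[OF v(2) c[OF v(1)]] in simp)
  show ?thesis
  proof (intro equalityI subrelI)
    fix v x assume "(v, x) \<in> arrow_rel (Fwd X Y f) O arrow_rel (Fwd Y Z g)"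
    then show "(v, x) \<in> arrow_rel (Fwd X Z (Cmp D X Y Z g f))" using 1 by auto
  next
    fix v x assume v: "(v, x) \<in> arrow_rel (Fwd X Z (Cmp D X Y Z g f))"
    then obtain w where "w \<in> V Y" "act X Y f v - w \<in> N Y" "act Y Z g w - x \<in> N Z" using 2 by auto
    then show "(v, x) \<in> arrow_rel (Fwd X Y f) O arrow_rel (Fwd Y Z g)" using v by auto
  qed
qed

text \<open>A map that is bijective on subquotients has its converse relation as two-sided inverse,
  with no choice of an inverse map. Injectivity gives the first equation, surjectivity the
  second.\<close>

lemma invertible_relcomp:
  assumes o: "X \<in> Ob D" "Y \<in> Ob D" and f: "f \<in> Hom D X Y"
    and inj: "\<And>v. v \<in> V X \<Longrightarrow> act X Y f v \<in> N Y \<Longrightarrow> v \<in> N X"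
    and surj: "\<And>v. v \<in> V Y \<Longrightarrow> \<exists>u\<in>V X. act X Y f u - v \<in> N Y"
  shows "arrow_rel (Fwd X Y f) O arrow_rel (Bwd X Y f) = mod_rel X"
    and "arrow_rel (Bwd X Y f) O arrow_rel (Fwd X Y f) = mod_rel Y"
proof -
  note nY = subgroup_setD[OF N[OF o(2)]] and vX = subgroup_setD[OF V[OF o(1)]]
  show "arrow_rel (Fwd X Y f) O arrow_rel (Bwd X Y f) = mod_rel X"
  proof (intro equalityI subrelI)
    fix v v' assume "(v, v') \<in> arrow_rel (Fwd X Y f) O arrow_rel (Bwd X Y f)"
    then obtain w where v: "v \<in> V X" "v' \<in> V X" and w: "act X Y f v - w \<in> N Y" "act X Y f v' - w \<in> N Y"
      by auto
    have "act X Y f (v - v') \<in> N Y" using nY(2)[OF w] act_diff[OF o f v] by simp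
    then show "(v, v') \<in> mod_rel X" using inj[OF vX(2)[OF v]] v by (simp add: mod_rel_def)
  next
    fix v v' assume "(v, v') \<in> mod_rel X"
    then have v: "v \<in> V X" "v' \<in> V X" "v - v' \<in> N X" by (simp_all add: mod_rel_def)
    have "act X Y f v - act X Y f v' \<in> N Y" using act_N[OF o f v(3)] act_diff[OF o f v(1,2)] by simp
    then have "(v, act X Y f v') \<in> arrow_rel (Fwd X Y f)" "(act X Y f v', v') \<in> arrow_rel (Bwd X Y f)"
      using v act_V[OF o f v(2)] nY(1) by auto
    then show "(v, v') \<in> arrow_rel (Fwd X Y f) O arrow_rel (Bwd X Y f)" by (rule relcompI)
  qed
  show "arrow_rel (Bwd X Y f) O arrow_rel (Fwd X Y f) = mod_rel Y"
  proof (intro equalityI subrelI)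
    fix w w' assume "(w, w') \<in> arrow_rel (Bwd X Y f) O arrow_rel (Fwd X Y f)"
    then obtain v where w: "w \<in> V Y" "w' \<in> V Y" and v: "act X Y f v - w \<in> N Y" "act X Y f v - w' \<in> N Y"
      by auto
    show "(w, w') \<in> mod_rel Y" using nY(2)[OF v(2) v(1)] w by (simp add: mod_rel_def)
  next
    fix w w' assume "(w, w') \<in> mod_rel Y"
    then have w: "w \<in> V Y" "w' \<in> V Y" "w - w' \<in> N Y" by (simp_all add: mod_rel_def)
    obtain u where u: "u \<in> V X" "act X Y f u - w \<in> N Y" using surj[OF w(1)] by blast
    have "act X Y f u - w' \<in> N Y" using nY(4)[OF u(2) w(3)] by simp
    then have "(w, u) \<in> arrow_rel (Bwd X Y f)" "(u, w') \<in> arrow_rel (Fwd X Y f)"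
      using u w by auto
    then show "(w, w') \<in> arrow_rel (Bwd X Y f) O arrow_rel (Fwd X Y f)" by (rule relcompI)
  qed
qed

lemma zquiver_arrowE:
  assumes W: "\<And>X Y. W X Y \<subseteq> Hom D X Y" and a: "a \<in> Arrows (zquiver D W)"
  obtains X Y f where "X \<in> Ob D" "Y \<in> Ob D" "f \<in> Hom D X Y" "a = Fwd X Y f \<or> a = Bwd X Y f"
proof -
  from a obtain X Y f where "X \<in> Ob D" "Y \<in> Ob D" "f \<in> Hom D X Y \<and> a = Fwd X Y f \<or> f \<in> W X Y \<and> a = Bwd X Y f"
    unfolding zquiver_def by auto
  then show thesis using that[of X Y f] W by blast
qed

lemma arrow_rel_mod_rel:
  assumes W: "\<And>X Y. W X Y \<subseteq> Hom D X Y" and a: "a \<in> Arrows (zquiver D W)"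
  shows "mod_rel (zsrc a) O arrow_rel a = arrow_rel a" and "arrow_rel a O mod_rel (ztgt a) = arrow_rel a"
proof -
  obtain X Y f where o: "X \<in> Ob D" "Y \<in> Ob D" "f \<in> Hom D X Y" and a: "a = Fwd X Y f \<or> a = Bwd X Y f"
    using zquiver_arrowE[OF W a] .
  show "mod_rel (zsrc a) O arrow_rel a = arrow_rel a"
    using Fwd_mod_rel(1)[OF o] Bwd_mod_rel(1)[OF o] a zsrc.simps by metis
  show "arrow_rel a O mod_rel (ztgt a) = arrow_rel a"
    using Fwd_mod_rel(2)[OF o] Bwd_mod_rel(2)[OF o] a ztgt.simps by metis
qed

lemma path_rel_append:
  assumes W: "\<And>X Y. W X Y \<subseteq> Hom D X Y"
  shows "is_path (zquiver D W) X p Y \<Longrightarrow> is_path (zquiver D W) Y q Z \<Longrightarrow>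
    path_rel X (p @ q) = path_rel X p O path_rel Y q"
proof (induction p arbitrary: X)
  case Nil
  then have X: "X = Y" "X \<in> Ob D" by (auto simp: zquiver_def)
  show ?case
  proof (cases q)
    case Nil then show ?thesis using X mod_rel_relcomp by simp
  next
    case (Cons a p)
    \<comment> \<open>The empty path contributes a \<open>mod_rel\<close>, which the first arrow of
      \<open>q\<close> absorbs.\<close>
    have "mod_rel Y O arrow_rel a = arrow_rel a"
      using Nil.prems(2) arrow_rel_mod_rel(1)[OF W, of a] by (simp add: Cons) (simp add: zquiver_def)
    then show ?thesis using X by (simp add: Cons O_assoc[symmetric])
  qed
next
  case (Cons a p)
  then show ?case by (simp add: O_assoc zquiver_def)
qed

text \<open>The functor factors through the localisation: each generator of the congruence is
  respected, the two inversion rules because the morphisms in \<open>W\<close> act bijectively on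
  subquotients.\<close>

lemma path_rel_loc_rel:
  assumes W: "\<And>X Y. W X Y \<subseteq> Hom D X Y"
    and inj: "\<And>X Y f v. \<lbrakk>X \<in> Ob D; Y \<in> Ob D; f \<in> W X Y; v \<in> V X; act X Y f v \<in> N Y\<rbrakk> \<Longrightarrow> v \<in> N X"
    and surj: "\<And>X Y f v. \<lbrakk>X \<in> Ob D; Y \<in> Ob D; f \<in> W X Y; v \<in> V Y\<rbrakk> \<Longrightarrow> \<exists>u\<in>V X. act X Y f u - v \<in> N Y"
    and rel: "loc_rel D W X Y p q"
  shows "path_rel X p = path_rel X q"
  using rel
proof (induction rule: loc_rel.induct)
  case (concat X Y p p' Z q q')
  note path = loc_rel_is_path[OF preadditiveD(1)[OF D] W]
  show ?case
    using path[OF concat.hyps(1)] path[OF concat.hyps(2)] concat.IH path_rel_append[OF W]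
    by metis
next
  case (ident X)
  have id: "Idm D X \<in> Hom D X X" by (rule closed(1)[OF ident])
  have 1: "v - w \<in> N X \<longleftrightarrow> act X X (Idm D X) v - w \<in> N X" if "v \<in> V X" for v w
    using subgroup_set_iff[OF N[OF ident], of "act X X (Idm D X) v - w" "v - w"] act_Idm[OF ident that]
    by simp
  have "arrow_rel (Fwd X X (Idm D X)) = mod_rel X" by (auto simp: mod_rel_def 1)
  then show ?case using mod_rel_relcomp[OF ident] by simp
next
  case (comp X Y Z f g)
  then show ?case using Fwd_comp[of X Y Z f g] by (simp add: O_assoc[symmetric])
next
  case (inv_right X Y s)
  have "s \<in> Hom D X Y" using inv_right W by blast
  from invertible_relcomp(1)[OF inv_right(1,2) this inj[OF inv_right] surj[OF inv_right]]
  show ?case using mod_rel_relcomp[OF inv_right(1)] by (simp add: O_assoc[symmetric])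
next
  case (inv_left X Y s)
  have "s \<in> Hom D X Y" using inv_left W by blast
  from invertible_relcomp(2)[OF inv_left(1,2) this inj[OF inv_left] surj[OF inv_left]]
  show ?case using mod_rel_relcomp[OF inv_left(2)] by (simp add: O_assoc[symmetric])
qed auto

end

section \<open>The embedding into formal cokernels, with the kernels and cokernels of embedded
  morphisms\<close>

context preadditive_category
begin

text \<open>Dividing \<open>X\<close> by the image of a zero map leaves \<open>X\<close>. The zero
  endomorphism provides such a map without reference to a zero object.\<close>

abbreviation embed :: "'o \<Rightarrow> 'o \<times> 'o \<times> 'm" where
  "embed X \<equiv> (X, X, Zer D X X)"

lemma embed_in_Ob: "X \<in> Ob D \<Longrightarrow> embed X \<in> Ob (fp_mod D)"
  by (simp add: Ob_fp_mod closed)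

lemma lifts_embed:
  assumes "X \<in> Ob D" "Y \<in> Ob D" "f \<in> Hom D X Y"
  shows "lifts X X (Zer D X X) Y Y (Zer D Y Y) f"
  unfolding lifts_def using assms closed(3)[OF assms(1,2)]
  by (auto simp: zero intro!: bexI[of _ "Zer D X Y"])

lemma singleton_in_Hom_embed:
  assumes "X \<in> Ob D" "Y \<in> Ob D" "f \<in> Hom D X Y"
  shows "{f} \<in> Hom (fp_mod D) (embed X) (embed Y)"
  unfolding Hom_fp_mod using lifts_embed[OF assms] coker_class_zero_map[OF assms(1,2,2,3)]
  by (metis imageI mem_Collect_eq)

text \<open>The projection is represented by the identity of \<open>Y\<close>. A morphism
  represented by \<open>g\<close> kills \<open>f\<close> exactly if \<open>g f\<close> factors
  through the presentation of the target, which is the condition for the same \<open>g\<close> to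
  define a morphism out of \<open>(X, Y, f)\<close>.\<close>

lemma is_cokernel_embed:
  assumes o: "X \<in> Ob D" "Y \<in> Ob D" and f: "f \<in> Hom D X Y"
  shows "is_cokernel (fp_mod D) (embed X) (embed Y) {f} (X, Y, f) (coker_class D Y X Y f (Idm D Y))"
proof -
  note e = embed_in_Ob[OF o(1)] embed_in_Ob[OF o(2)]
  have C: "(X, Y, f) \<in> Ob (fp_mod D)" using o f by (simp add: Ob_fp_mod)
  have sf: "coker_class D X Y Y (Zer D Y Y) f = {f}" by (rule coker_class_zero_map[OF o(1,2,2) f])
  have id: "Idm D Y \<in> Hom D Y Y" by (rule closed(1)[OF o(2)])
  have lc: "lifts Y Y (Zer D Y Y) X Y f (Idm D Y)"
    unfolding lifts_def using o f closed(3)[OF o(2,1)]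
    by (auto simp: zero ident closed intro!: bexI[of _ "Zer D Y X"])
  have c: "coker_class D Y X Y f (Idm D Y) \<in> Hom (fp_mod D) (embed Y) (X, Y, f)"
    using lc by (simp add: Hom_fp_mod)
  have lf: "lifts X X (Zer D X X) Y Y (Zer D Y Y) f" by (rule lifts_embed[OF o f])
  have "Cmp (fp_mod D) (embed X) (embed Y) (X, Y, f) (coker_class D Y X Y f (Idm D Y)) {f} =
      coker_class D X X Y f f"
    using Cmp_fp_mod[OF e C lf lc] unfolding sf by (simp add: ident(2)[OF o f])
  also have "\<dots> = Zer (fp_mod D) (embed X) (X, Y, f)"
    unfolding Zer_fp_mod coker_class_zero_iff[OF o(1,1,2) f f]
    using ident(1)[OF o f] closed(1)[OF o(1)] by (intro bexI[of _ "Idm D X"]) simp_all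
  finally have cf: "Cmp (fp_mod D) (embed X) (embed Y) (X, Y, f) (coker_class D Y X Y f (Idm D Y)) {f} =
      Zer (fp_mod D) (embed X) (X, Y, f)" .
  have univ: "\<exists>!u. u \<in> Hom (fp_mod D) (X, Y, f) T \<and>
      Cmp (fp_mod D) (embed Y) (X, Y, f) T u (coker_class D Y X Y f (Idm D Y)) = t"
    if T: "T \<in> Ob (fp_mod D)" and t: "t \<in> Hom (fp_mod D) (embed Y) T"
      and tf: "Cmp (fp_mod D) (embed X) (embed Y) T t {f} = Zer (fp_mod D) (embed X) T" for T t
  proof -
    obtain X' Y' a where T': "T = (X', Y', a)" by (cases T)
    note T1 = T[unfolded T']
    have oT: "X' \<in> Ob D" "Y' \<in> Ob D" "a \<in> Hom D X' Y'" using T1 by (simp_all add: Ob_fp_mod)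
    obtain g where g: "lifts Y Y (Zer D Y Y) X' Y' a g" "t = coker_class D Y X' Y' a g"
      using t unfolding T' Hom_fp_mod by blast
    have gH: "g \<in> Hom D Y Y'" using g(1) by (simp add: lifts_def)
    have "coker_class D X X' Y' a (Cmp D X Y Y' g f) = coker_class D X X' Y' a (Zer D X Y')"
      using tf Cmp_fp_mod[OF e T1 lf g(1)] unfolding T' g(2) sf Zer_fp_mod by simp
    then obtain s where s: "s \<in> Hom D X X'" "Cmp D X Y Y' g f = Cmp D X X' Y' a s"
      using coker_class_zero_iff[OF o(1) oT closed(2)[OF o oT(2) f gH]] by blast
    have comp: "Cmp (fp_mod D) (embed Y) (X, Y, f) T (coker_class D Y X' Y' a h)
        (coker_class D Y X Y f (Idm D Y)) = coker_class D Y X' Y' a h" if h: "lifts X Y f X' Y' a h" for h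
    proof -
      have "h \<in> Hom D Y Y'" using h by (simp add: lifts_def)
      then show ?thesis unfolding T' Cmp_fp_mod[OF e(2) C T1 lc h] by (simp add: ident(1)[OF o(2) oT(2)])
    qed
    have lg: "lifts X Y f X' Y' a g" unfolding lifts_def using gH s by blast
    show ?thesis
    proof (intro ex1I conjI)
      show "t \<in> Hom (fp_mod D) (X, Y, f) T" unfolding g(2) T' Hom_fp_mod using lg by blast
      show "Cmp (fp_mod D) (embed Y) (X, Y, f) T t (coker_class D Y X Y f (Idm D Y)) = t"
        unfolding g(2) by (rule comp[OF lg])
      fix u assume u: "u \<in> Hom (fp_mod D) (X, Y, f) T \<and>
        Cmp (fp_mod D) (embed Y) (X, Y, f) T u (coker_class D Y X Y f (Idm D Y)) = t"
      then obtain h where "lifts X Y f X' Y' a h" "u = coker_class D Y X' Y' a h"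
        unfolding T' Hom_fp_mod by blast
      then show "u = t" using comp u by simp
    qed
  qed
  show ?thesis
    unfolding is_cokernel_def is_kernel_def Ob_opposite Hom_opposite Cmp_opposite Zer_opposite
    using singleton_in_Hom_embed[OF o f] C c cf univ by blast
qed

text \<open>A morphism from the formal cokernel of \<open>a\<close> into an embedded object is a map
  \<open>g\<close> with \<open>g a = 0\<close>; it factors through \<open>k\<close> in
  \<open>D\<close>, and \<open>k\<close> being a monomorphism, the factor kills \<open>a\<close>
  too. For the opposite category this says that cokernels stay cokernels under the second
  embedding.\<close>

lemma is_kernel_embed:
  assumes o: "X \<in> Ob D" "Y \<in> Ob D" and k: "is_kernel D X Y f K k"
  shows "is_kernel (fp_mod D) (embed X) (embed Y) {f} (embed K) {k}"
proof -
  have oK: "K \<in> Ob D" "k \<in> Hom D K X" "f \<in> Hom D X Y" "Cmp D K X Y f k = Zer D K Y"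
    using k by (simp_all add: is_kernel_def)
  have univ: "\<exists>!u. u \<in> Hom D T K \<and> Cmp D T K X k u = t"
    if "T \<in> Ob D" "t \<in> Hom D T X" "Cmp D T X Y f t = Zer D T Y" for T t
    using k that unfolding is_kernel_def by blast
  have mono: "u = u'" if T: "T \<in> Ob D" "u \<in> Hom D T K" "u' \<in> Hom D T K" "Cmp D T K X k u = Cmp D T K X k u'" for T u u'
  proof -
    have "Cmp D T X Y f (Cmp D T K X k u) = Zer D T Y"
      using T o oK by (simp add: assoc zero)
    from univ[OF T(1) closed(2)[OF T(1) oK(1) o(1) T(2) oK(2)] this] show ?thesis using T by metis
  qed
  note e = embed_in_Ob[OF o(1)] embed_in_Ob[OF o(2)] embed_in_Ob[OF oK(1)]
  note lf = lifts_embed[OF o oK(3)] and lk = lifts_embed[OF oK(1) o(1) oK(2)]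
  have sing: "coker_class D Z Y' Y' (Zer D Y' Y') g = {g}" if "Z \<in> Ob D" "Y' \<in> Ob D" "g \<in> Hom D Z Y'" for Z Y' g
    by (rule coker_class_zero_map[OF that(1,2,2,3)])
  have fk: "Cmp (fp_mod D) (embed K) (embed X) (embed Y) {f} {k} = Zer (fp_mod D) (embed K) (embed Y)"
    using Cmp_fp_mod[OF e(3,1,2) lk lf] oK o by (simp add: sing Zer_fp_mod)
  have univ': "\<exists>!u. u \<in> Hom (fp_mod D) T (embed K) \<and> Cmp (fp_mod D) T (embed K) (embed X) {k} u = t"
    if T: "T \<in> Ob (fp_mod D)" and t: "t \<in> Hom (fp_mod D) T (embed X)"
      and ft: "Cmp (fp_mod D) T (embed X) (embed Y) {f} t = Zer (fp_mod D) T (embed Y)" for T t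
  proof -
    obtain X' Y' a where T': "T = (X', Y', a)" by (cases T)
    note T1 = T[unfolded T']
    have oT: "X' \<in> Ob D" "Y' \<in> Ob D" "a \<in> Hom D X' Y'" using T1 by (simp_all add: Ob_fp_mod)
    obtain g where g: "lifts X' Y' a X X (Zer D X X) g" "t = coker_class D Y' X X (Zer D X X) g"
      using t unfolding T' Hom_fp_mod by blast
    have gH: "g \<in> Hom D Y' X" using g(1) by (simp add: lifts_def)
    have tg: "t = {g}" using g(2) sing[OF oT(2) o(1) gH] by simp
    obtain h where h: "h \<in> Hom D X' X" "Cmp D X' Y' X g a = Cmp D X' X X (Zer D X X) h"
      using g(1) unfolding lifts_def by blast
    have ga: "Cmp D X' Y' X g a = Zer D X' X" using h oT o by (simp add: zero)
    have fg: "Cmp D Y' X Y f g \<in> Hom D Y' Y" by (rule closed(2)[OF oT(2) o gH oK(3)])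
    have "{Cmp D Y' X Y f g} = {Zer D Y' Y}"
      using ft Cmp_fp_mod[OF T1 e(1,2) g(1) lf] closed(3)[OF oT(2) o(2)]
      unfolding T' tg by (simp add: sing oT o gH oK(3) Zer_fp_mod fg)
    then have "Cmp D Y' X Y f g = Zer D Y' Y" by simp
    then obtain u where u: "u \<in> Hom D Y' K" "Cmp D Y' K X k u = g" using univ[OF oT(2) gH] by blast
    \<comment> \<open>Both sides are zero since \<open>k u = g\<close> and \<open>g a = 0\<close>;
      cancelling \<open>k\<close> lets \<open>u\<close> descend to the formal cokernel of
      \<open>a\<close>.\<close>
    have "Cmp D X' K X k (Cmp D X' Y' K u a) = Cmp D X' K X k (Zer D X' K)"
      using assoc[OF oT(1,2) oK(1) o(1) oT(3) u(1) oK(2)] u(2) ga oT oK o by (simp add: zero)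
    then have ua: "Cmp D X' Y' K u a = Zer D X' K"
      using mono[OF oT(1) closed(2)[OF oT(1,2) oK(1) oT(3) u(1)] closed(3)[OF oT(1) oK(1)]] by simp
    have lu: "lifts X' Y' a K K (Zer D K K) u"
      unfolding lifts_def using u(1) ua closed(3)[OF oT(1) oK(1)]
      by (auto simp: zero oT oK intro!: bexI[of _ "Zer D X' K"])
    have comp: "Cmp (fp_mod D) T (embed K) (embed X) {k} (coker_class D Y' K K (Zer D K K) w) = {Cmp D Y' K X k w}"
      if w: "lifts X' Y' a K K (Zer D K K) w" for w
    proof -
      have wH: "w \<in> Hom D Y' K" using w by (simp add: lifts_def)
      show ?thesis using Cmp_fp_mod[OF T1 e(3,1) w lk]
        unfolding T' by (simp add: sing oT oK o wH closed)
    qed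
    show ?thesis
    proof (intro ex1I conjI)
      show "{u} \<in> Hom (fp_mod D) T (embed K)"
        unfolding T' Hom_fp_mod using lu sing[OF oT(2) oK(1) u(1)] by (metis imageI mem_Collect_eq)
      show "Cmp (fp_mod D) T (embed K) (embed X) {k} {u} = t"
        using comp[OF lu] unfolding sing[OF oT(2) oK(1) u(1)] u(2) tg .
      fix U assume U: "U \<in> Hom (fp_mod D) T (embed K) \<and> Cmp (fp_mod D) T (embed K) (embed X) {k} U = t"
      then obtain w where w: "lifts X' Y' a K K (Zer D K K) w" "U = coker_class D Y' K K (Zer D K K) w"
        unfolding T' Hom_fp_mod by blast
      have wH: "w \<in> Hom D Y' K" using w(1) by (simp add: lifts_def)
      have "{Cmp D Y' K X k w} = {g}" using U comp[OF w(1)] w(2) tg by simp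
      then have "w = u" using mono[OF oT(2) wH u(1)] u(2) by simp
      then show "U = {u}" using w(2) sing[OF oT(2) oK(1) u(1)] by simp
    qed
  qed
  show ?thesis
    unfolding is_kernel_def
    using singleton_in_Hom_embed[OF o oK(3)] singleton_in_Hom_embed[OF oK(1) o(1) oK(2)] e fk univ' by blast
qed

end

section \<open>Fractions in the Serre quotient\<close>

context exact_functor
begin

text \<open>The relation of a zigzag depends only on its class in the quotient, so fractions with
  different relations are different morphisms.\<close>

lemma lepoll_Hom_serre_quotient:
  assumes o: "x \<in> Ob D" "z \<in> Ob D" "\<And>i. i \<in> I \<Longrightarrow> y i \<in> Ob D"
    and s: "\<And>i. i \<in> I \<Longrightarrow> s i \<in> Hom D (y i) x" and t: "\<And>i. i \<in> I \<Longrightarrow> t i \<in> Hom D (y i) z"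
    and ker: "\<And>i. i \<in> I \<Longrightarrow> \<exists>K\<in>acyclic. \<exists>k. is_kernel D (y i) x (s i) K k"
    and coker: "\<And>i. i \<in> I \<Longrightarrow> \<exists>C\<in>acyclic. \<exists>c. is_cokernel D (y i) x (s i) C c"
    and inj: "inj_on (\<lambda>i. arrow_rel (Bwd (y i) x (s i)) O arrow_rel (Fwd (y i) z (t i))) I"
  shows "I \<lesssim> Hom (serre_quotient D acyclic) x z"
proof -
  define W where "W = (\<lambda>X Y. {f \<in> Hom D X Y. (\<exists>K\<in>acyclic. \<exists>k. is_kernel D X Y f K k) \<and>
    (\<exists>C\<in>acyclic. \<exists>c. is_cokernel D X Y f C c)})"
  have W: "W X Y \<subseteq> Hom D X Y" for X Y by (auto simp: W_def)
  note C = preadditiveD(1)[OF D]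
  \<comment> \<open>The zigzag of the fraction: back along \<open>s i\<close>, then forth along
    \<open>t i\<close>.\<close>
  define p where "p i = [Bwd (y i) x (s i), Fwd (y i) z (t i)]" for i
  define r where "r = {(p, q). loc_rel D W x z p q}"
  have path: "is_path (zquiver D W) x (p i) z" if "i \<in> I" for i
    using that o s[OF that] t[OF that] ker[OF that] coker[OF that]
    by (simp add: p_def zquiver_def W_def)
  have rel: "path_rel x (p i) = arrow_rel (Bwd (y i) x (s i)) O arrow_rel (Fwd (y i) z (t i))"
    if i: "i \<in> I" for i
    using Fwd_mod_rel(2)[OF o(3)[OF i] o(2) t[OF i]] by (simp add: p_def del: arrow_rel.simps)
  have eq: "path_rel x p = path_rel x q" if "loc_rel D W x z p q" for p q
  proof (rule path_rel_loc_rel[OF W _ _ that])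
    fix X Y f v assume "X \<in> Ob D" "Y \<in> Ob D" "f \<in> W X Y" "v \<in> V X" "act X Y f v \<in> N Y"
    then show "v \<in> N X" using injective_if_acyclic_kernel unfolding W_def by blast
  next
    fix X Y f v assume "X \<in> Ob D" "Y \<in> Ob D" "f \<in> W X Y" "v \<in> V Y"
    then show "\<exists>u\<in>V X. act X Y f u - v \<in> N Y"
      using surjective_if_acyclic_cokernel unfolding W_def by blast
  qed
  have "inj_on (\<lambda>i. r `` {p i}) I"
  proof (rule inj_onI)
    fix i j assume i: "i \<in> I" and j: "j \<in> I" and "r `` {p i} = r `` {p j}"
    then have "(p i, p j) \<in> r"
      using eq_equiv_class[OF _ equiv_loc_rel[OF C W]] path[OF j] unfolding r_def by blast
    then have "path_rel x (p i) = path_rel x (p j)" using eq by (simp add: r_def)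
    then show "i = j" using inj_onD[OF inj _ i j] rel[OF i] rel[OF j] by simp
  qed
  moreover have "(\<lambda>i. r `` {p i}) ` I \<subseteq> Hom (serre_quotient D acyclic) x z"
    using path by (auto simp: serre_quotient_def localisation_def W_def[symmetric] r_def[symmetric]
        intro: quotientI)
  ultimately show ?thesis unfolding lepoll_def by blast
qed

end

section \<open>Application to the abelian hull\<close>

context additive_functor
begin

lemma fp_N_embed: "X \<in> Ob D \<Longrightarrow> fp_N (embed X) = {0}"
  using strict.act_Zer[of X X] subgroup_setD(1)[OF V] by (auto simp: fp_N_def image_iff)

text \<open>On doubly embedded objects the extended functor is still \<open>act\<close>. The
  fraction of \<open>i\<close> therefore lifts \<open>w\<close> to its only preimage
  \<open>e i\<close> under \<open>s i\<close> and maps that by \<open>t i\<close>; by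
  \<open>inj\<close> the results differ.\<close>

lemma serre_quotient_abelian_hull:
  assumes sums: "has_direct_sums D" and I: "I \<noteq> {}"
    and o: "x \<in> Ob D" "z \<in> Ob D" "\<And>i. i \<in> I \<Longrightarrow> y i \<in> Ob D"
    and s: "\<And>i. i \<in> I \<Longrightarrow> s i \<in> Hom D (y i) x" and t: "\<And>i. i \<in> I \<Longrightarrow> t i \<in> Hom D (y i) z"
    and bij: "\<And>i. i \<in> I \<Longrightarrow> bij_betw (act (y i) x (s i)) (V (y i)) (V x)"
    and e: "\<And>i. i \<in> I \<Longrightarrow> e i \<in> V (y i)" "\<And>i. i \<in> I \<Longrightarrow> act (y i) x (s i) (e i) = w"
    and inj: "inj_on (\<lambda>i. act (y i) z (t i) (e i)) I"
  shows "\<exists>S. serre_subcategory (abelian_hull D) S \<and>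
    (\<exists>X\<in>Ob (abelian_hull D). \<exists>Z\<in>Ob (abelian_hull D). I \<lesssim> Hom (serre_quotient (abelian_hull D) S) X Z)"
proof -
  interpret B: exact_subquotient_functor "fp_mod D" fp_V fp_N fp_act
    by (rule exact_subquotient_functor_fp_mod[OF sums])
  interpret A: exact_functor "abelian_hull D" B.cp_V B.cp_N B.cp_act
    unfolding abelian_hull_def by (rule B.exact_functor_copresented)
  let ?e = "\<lambda>X. B.opp.embed (embed X)"
  have hull: "abelian_hull D = opposite (fp_mod (opposite (fp_mod D)))" by (simp add: abelian_hull_def)
  have Ob: "?e X \<in> Ob (abelian_hull D)" if "X \<in> Ob D" for X
    using B.opp.embed_in_Ob[of "embed X"] embed_in_Ob[OF that] by (simp add: hull)
  have sing: "{f} \<in> Hom (fp_mod D) (embed X) (embed Y)" if "X \<in> Ob D" "Y \<in> Ob D" "f \<in> Hom D X Y" for X Y f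
    by (rule singleton_in_Hom_embed[OF that])
  have Hom: "{{f}} \<in> Hom (abelian_hull D) (?e X) (?e Y)" if "X \<in> Ob D" "Y \<in> Ob D" "f \<in> Hom D X Y" for X Y f
    using B.opp.singleton_in_Hom_embed[of "embed Y" "embed X" "{f}"] sing[OF that]
      embed_in_Ob[OF that(1)] embed_in_Ob[OF that(2)] by (simp add: hull)
  have act: "B.cp_act (?e X) (?e Y) {{f}} v = act X Y f v" for X Y f v
    by (simp add: B.cp_act_def) (simp add: fp_act_def)
  have fact: "fp_act (X, Y, a) (X', Y', a') {f} v = act Y Y' f v" for X Y a X' Y' a' f v
    by (simp add: fp_act_def)
  have N: "B.cp_N (?e X) = {0}" if "X \<in> Ob D" for X using fp_N_embed[OF that] by (simp add: B.cp_N_def)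
  have V': "B.cp_V (?e X) = V X" if "X \<in> Ob D" for X
    using B.act_Zer[OF embed_in_Ob[OF that] embed_in_Ob[OF that]] unfolding B.cp_V_def by (auto simp: fp_V_def)
  have ker: "\<exists>K\<in>A.acyclic. \<exists>k. is_kernel (abelian_hull D) (?e (y i)) (?e x) {{s i}} K k" if i: "i \<in> I" for i
  proof -
    \<comment> \<open>The formal kernel of the embedded \<open>s i\<close>; its value is the kernel
      of the action of \<open>s i\<close>, zero by injectivity.\<close>
    let ?K = "(embed x, embed (y i), {s i})"
    have e2: "embed x \<in> Ob (opposite (fp_mod D))" "embed (y i) \<in> Ob (opposite (fp_mod D))"
      "{s i} \<in> Hom (opposite (fp_mod D)) (embed x) (embed (y i))"
      using embed_in_Ob o i sing[OF o(3) o(1) s] by auto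
    obtain c where c: "is_kernel (abelian_hull D) (?e (y i)) (?e x) {{s i}} ?K c"
      using B.opp.is_cokernel_embed[OF e2] unfolding is_cokernel_def hull by blast
    have "B.cp_V ?K \<subseteq> B.cp_N ?K"
    proof
      fix v assume "v \<in> B.cp_V ?K"
      then have v: "v \<in> V (y i)" "act (y i) x (s i) v = 0"
        using fp_N_embed[OF o(1)] unfolding B.cp_V_def by (simp_all add: fp_V_def fact)
      have "v = 0"
        using inj_onD[OF bij_betw_imp_inj_on[OF bij[OF i]] _ v(1) subgroup_setD(1)[OF V[OF o(3)[OF i]]]]
          v(2) strict.act_zero[OF o(3)[OF i] o(1) s[OF i]] by simp
      then show "v \<in> B.cp_N ?K" using fp_N_embed[OF o(3)[OF i]] by (simp add: B.cp_N_def)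
    qed
    moreover have "?K \<in> Ob (abelian_hull D)" using c by (simp add: is_kernel_def)
    ultimately show ?thesis using c unfolding A.acyclic_def by blast
  qed
  have coker: "\<exists>C\<in>A.acyclic. \<exists>c. is_cokernel (abelian_hull D) (?e (y i)) (?e x) {{s i}} C c" if i: "i \<in> I" for i
  proof -
    \<comment> \<open>The formal cokernel of \<open>s i\<close> arises in the first completion and
      the second embedding preserves it. Its value is the cokernel of the action, zero by
      surjectivity.\<close>
    let ?K = "(y i, x, s i)"
    let ?C = "B.opp.embed ?K"
    obtain k where k: "is_kernel (opposite (fp_mod D)) (embed x) (embed (y i)) {s i} ?K k"
      using is_cokernel_embed[OF o(3)[OF i] o(1) s[OF i]] unfolding is_cokernel_def by blast
    obtain c where c: "is_cokernel (abelian_hull D) (?e (y i)) (?e x) {{s i}} ?C c"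
      using B.opp.is_kernel_embed[OF _ _ k] embed_in_Ob[OF o(1)] embed_in_Ob[OF o(3)[OF i]]
      unfolding is_cokernel_def hull opposite_opposite Ob_opposite by blast
    have "B.cp_V ?C \<subseteq> B.cp_N ?C"
      using bij_betw_imp_surj_on[OF bij[OF i]] unfolding B.cp_V_def B.cp_N_def by (auto simp: fp_V_def fp_N_def)
    moreover have "?C \<in> Ob (abelian_hull D)" using c by (simp add: is_cokernel_def is_kernel_def)
    ultimately show ?thesis using c unfolding A.acyclic_def by blast
  qed
  \<comment> \<open>Embedded objects have denominator zero, so here the relations are honest graphs
    and their converses.\<close>
  have rel: "A.arrow_rel (Fwd (?e X) (?e Y) {{f}}) = {(v, w). v \<in> V X \<and> w \<in> V Y \<and> act X Y f v = w}"
    "A.arrow_rel (Bwd (?e X) (?e Y) {{f}}) = {(w, v). v \<in> V X \<and> w \<in> V Y \<and> act X Y f v = w}"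
    if "X \<in> Ob D" "Y \<in> Ob D" for X Y f
    unfolding A.arrow_rel.simps act N[OF that(2)] V'[OF that(1)] V'[OF that(2)] by auto
  have "inj_on (\<lambda>i. A.arrow_rel (Bwd (?e (y i)) (?e x) {{s i}}) O A.arrow_rel (Fwd (?e (y i)) (?e z) {{t i}})) I"
  proof (rule inj_onI)
    fix i j assume i: "i \<in> I" and j: "j \<in> I"
      and eq: "A.arrow_rel (Bwd (?e (y i)) (?e x) {{s i}}) O A.arrow_rel (Fwd (?e (y i)) (?e z) {{t i}}) =
        A.arrow_rel (Bwd (?e (y j)) (?e x) {{s j}}) O A.arrow_rel (Fwd (?e (y j)) (?e z) {{t j}})"
    have "(w, act (y i) z (t i) (e i)) \<in>
        A.arrow_rel (Bwd (?e (y i)) (?e x) {{s i}}) O A.arrow_rel (Fwd (?e (y i)) (?e z) {{t i}})"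
      unfolding rel[OF o(3)[OF i] o(1)] rel[OF o(3)[OF i] o(2)]
      using e(1)[OF i] e(2)[OF i] act_V[OF o(3)[OF i] o(1) s[OF i]] act_V[OF o(3)[OF i] o(2) t[OF i]]
      by (intro relcompI[of _ "e i"]) auto
    then obtain v where v: "v \<in> V (y j)" "act (y j) x (s j) v = w"
      "act (y j) z (t j) v = act (y i) z (t i) (e i)"
      unfolding eq rel[OF o(3)[OF j] o(1)] rel[OF o(3)[OF j] o(2)] by auto
    \<comment> \<open>Both are preimages of \<open>w\<close> under the injective action of
      \<open>s j\<close>.\<close>
    have "v = e j" using inj_onD[OF bij_betw_imp_inj_on[OF bij[OF j]]] v e[OF j] by simp
    then show "i = j" using inj_onD[OF inj _ i j] v(3) by simp
  qed
  from A.lepoll_Hom_serre_quotient[of "?e x" "?e z" I "\<lambda>i. ?e (y i)" "\<lambda>i. {{s i}}" "\<lambda>i. {{t i}}",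
      OF Ob[OF o(1)] Ob[OF o(2)] Ob[OF o(3)] Hom[OF o(3) o(1) s] Hom[OF o(3) o(2) t] ker coker this]
  have "I \<lesssim> Hom (serre_quotient (abelian_hull D) A.acyclic) (?e x) (?e z)" by simp
  moreover obtain K where "K \<in> A.acyclic" using I ker by blast
  ultimately show ?thesis using A.serre_subcategory_acyclic Ob o(1,2) by blast
qed

end

section \<open>The functor given by a weighted quiver\<close>

text \<open>The block matrices of the inclusions and projections of \<open>xs @ ys\<close>.\<close>

definition select :: "('o, 'm) addcat \<Rightarrow> 'o list \<Rightarrow> 'o list \<Rightarrow> (nat \<Rightarrow> nat \<Rightarrow> bool) \<Rightarrow> nat \<times> nat \<Rightarrow> 'm" where
  "select D xs ys r = (\<lambda>(i, j)\<in>{..<length ys} \<times> {..<length xs}.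
     if r i j then Idm D (ys ! i) else Zer D (xs ! j) (ys ! i))"

lemma Ob_direct_sums: "Ob (direct_sums D) = lists (Ob D)"
  and Hom_direct_sums: "Hom (direct_sums D) xs ys =
    (\<Pi>\<^sub>E (i, j)\<in>{..<length ys} \<times> {..<length xs}. Hom D (xs ! j) (ys ! i))"
  by (simp_all add: direct_sums_def)

lemma select_eq: "i < length ys \<Longrightarrow> j < length xs \<Longrightarrow>
    select D xs ys r (i, j) = (if r i j then Idm D (ys ! i) else Zer D (xs ! j) (ys ! i))"
  by (simp add: select_def)

context preadditive_category
begin

lemma select_in_Hom:
  assumes xs: "xs \<in> lists (Ob D)" and ys: "ys \<in> lists (Ob D)"
    and r: "\<And>i j. \<lbrakk>i < length ys; j < length xs; r i j\<rbrakk> \<Longrightarrow> xs ! j = ys ! i"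
  shows "select D xs ys r \<in> Hom (direct_sums D) xs ys"
proof -
  have "(if r i j then Idm D (ys ! i) else Zer D (xs ! j) (ys ! i)) \<in> Hom D (xs ! j) (ys ! i)"
    if "i < length ys" "j < length xs" for i j
    using that r[OF that] xs ys by (auto simp: closed in_lists_conv_set)
  then show ?thesis unfolding Hom_direct_sums select_def by auto
qed

text \<open>Column \<open>k\<close> of the right factor has its only identity entry in row
  \<open>c k\<close>, so each sum in the matrix product collapses to one term.\<close>

lemma select_comp:
  assumes o: "xs \<in> lists (Ob D)" "ys \<in> lists (Ob D)" "zs \<in> lists (Ob D)"
    and r: "\<And>i j. \<lbrakk>i < length zs; j < length ys; r i j\<rbrakk> \<Longrightarrow> ys ! j = zs ! i"
    and s: "\<And>j k. \<lbrakk>j < length ys; k < length xs\<rbrakk> \<Longrightarrow> s j k \<longleftrightarrow> j = c k"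
    and c: "\<And>k. k < length xs \<Longrightarrow> c k < length ys" "\<And>k. k < length xs \<Longrightarrow> xs ! k = ys ! c k"
  shows "Cmp (direct_sums D) xs ys zs (select D ys zs r) (select D xs ys s) =
    select D xs zs (\<lambda>i k. r i (c k))"
proof -
  have "hom_sum D (xs ! k) (zs ! i) (\<lambda>j. Cmp D (xs ! k) (ys ! j) (zs ! i)
      (select D ys zs r (i, j)) (select D xs ys s (j, k))) (length ys) =
    (if r i (c k) then Idm D (zs ! i) else Zer D (xs ! k) (zs ! i))" (is "hom_sum D _ _ ?f _ = ?rhs")
    if i: "i < length zs" and k: "k < length xs" for i k
  proof -
    have ob: "xs ! k \<in> Ob D" "zs ! i \<in> Ob D" "\<And>j. j < length ys \<Longrightarrow> ys ! j \<in> Ob D"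
      using o i k by (auto simp: in_lists_conv_set)
    have sel: "select D ys zs r (i, j) \<in> Hom D (ys ! j) (zs ! i)" if "j < length ys" for j
      using r[OF i that] that ob by (auto simp: select_eq i closed)
    have fc: "?f (c k) = ?rhs"
      using ident(1)[OF ob(3) ob(2) sel] c[OF k] r[OF i] i k ob
      by (simp add: select_eq s closed ident)
    have "hom_sum D (xs ! k) (zs ! i) ?f (length ys) = ?f (c k)"
    proof (rule hom_sum_single[OF D ob(1,2) c(1)[OF k]])
      show "?f (c k) \<in> Hom D (xs ! k) (zs ! i)"
        unfolding fc using ob r[OF i c(1)[OF k]] c(2)[OF k] by (auto simp: closed)
      show "?f j = Zer D (xs ! k) (zs ! i)" if "j < length ys" "j \<noteq> c k" for j
        using that k zero(4)[OF ob(1) ob(3)[OF that(1)] ob(2) sel[OF that(1)]] by (simp add: select_eq[of j] s)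
    qed
    then show ?thesis using fc by simp
  qed
  then show ?thesis by (auto simp: direct_sums_def select_def[of D xs zs] intro!: restrict_ext)
qed

lemma has_direct_sums_direct_sums: "has_direct_sums (direct_sums D)"
  unfolding has_direct_sums_def Ob_direct_sums
proof (intro ballI)
  fix xs ys assume o: "xs \<in> lists (Ob D)" "ys \<in> lists (Ob D)"
  let ?zs = "xs @ ys" and ?n = "length xs"
  have zs: "?zs \<in> lists (Ob D)" using o by simp
  define i where "i = select D xs ?zs (=)"
  define j where "j = select D ys ?zs (\<lambda>a b. a = b + ?n)"
  define p where "p = select D ?zs xs (=)"
  define q where "q = select D ?zs ys (\<lambda>a b. b = a + ?n)"
  have id: "select D us us (=) = Idm (direct_sums D) us" for us
    by (auto simp: select_def direct_sums_def intro!: restrict_ext)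
  have zer: "select D us vs r = Zer (direct_sums D) us vs"
    if "\<And>i k. i < length vs \<Longrightarrow> k < length us \<Longrightarrow> \<not> r i k" for us vs r
    using that by (auto simp: select_def direct_sums_def intro!: restrict_ext)
  have H: "i \<in> Hom (direct_sums D) xs ?zs" "j \<in> Hom (direct_sums D) ys ?zs"
    "p \<in> Hom (direct_sums D) ?zs xs" "q \<in> Hom (direct_sums D) ?zs ys"
    unfolding i_def j_def p_def q_def using o zs
    by (auto intro!: select_in_Hom simp: nth_append)
  have ci: "Cmp (direct_sums D) xs ?zs vs (select D ?zs vs r) i = select D xs vs (\<lambda>i k. r i k)"
    if "vs \<in> lists (Ob D)" "\<And>i j. \<lbrakk>i < length vs; j < length ?zs; r i j\<rbrakk> \<Longrightarrow> ?zs ! j = vs ! i" for vs r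
    unfolding i_def using o zs that by (intro select_comp) (auto simp: nth_append)
  have cj: "Cmp (direct_sums D) ys ?zs vs (select D ?zs vs r) j = select D ys vs (\<lambda>i k. r i (k + ?n))"
    if "vs \<in> lists (Ob D)" "\<And>i j. \<lbrakk>i < length vs; j < length ?zs; r i j\<rbrakk> \<Longrightarrow> ?zs ! j = vs ! i" for vs r
    unfolding j_def using o zs that by (intro select_comp) (auto simp: nth_append)
  have "Cmp (direct_sums D) xs ?zs xs p i = Idm (direct_sums D) xs"
    unfolding p_def by (subst ci) (use o in \<open>auto simp: id nth_append\<close>)
  moreover have "Cmp (direct_sums D) ys ?zs ys q j = Idm (direct_sums D) ys"
    unfolding q_def by (subst cj) (use o in \<open>auto simp: id nth_append eq_commute[of _ "_ :: nat"]\<close>)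
  moreover have "Cmp (direct_sums D) xs ?zs ys q i = Zer (direct_sums D) xs ys"
    unfolding q_def by (subst ci) (use o in \<open>auto intro!: zer simp: nth_append\<close>)
  moreover have "Cmp (direct_sums D) ys ?zs xs p j = Zer (direct_sums D) ys xs"
    unfolding p_def by (subst cj) (use o in \<open>auto intro!: zer simp: nth_append\<close>)
  ultimately show "\<exists>Z\<in>lists (Ob D). \<exists>i\<in>Hom (direct_sums D) xs Z. \<exists>j\<in>Hom (direct_sums D) ys Z.
      \<exists>p\<in>Hom (direct_sums D) Z xs. \<exists>q\<in>Hom (direct_sums D) Z ys.
        Cmp (direct_sums D) xs Z xs p i = Idm (direct_sums D) xs \<and>
        Cmp (direct_sums D) ys Z ys q j = Idm (direct_sums D) ys \<and>
        Cmp (direct_sums D) xs Z ys q i = Zer (direct_sums D) xs ys \<and>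
        Cmp (direct_sums D) ys Z xs p j = Zer (direct_sums D) ys xs"
    using zs H by blast
qed

end

text \<open>The type \<open>'c \<Rightarrow>\<^sub>0 int\<close> is the monoid ring of the
  additively written monoid \<open>'c\<close>, with \<open>frag_of c\<close> the monomial of
  exponent \<open>c\<close>. A path is sent to the product of the monomials of its arrows, that is,
  to the sum of their exponents.\<close>

definition path_weight :: "('a \<Rightarrow> 'c::comm_monoid_add) \<Rightarrow> ('a list \<Rightarrow>\<^sub>0 int) \<Rightarrow> ('c \<Rightarrow>\<^sub>0 int)" where
  "path_weight wt = frag_extend (\<lambda>p. frag_of (sum_list (map wt p)))"

lemma single_inject: "c \<noteq> 0 \<Longrightarrow> Poly_Mapping.single a c = Poly_Mapping.single b c \<Longrightarrow> a = b"
  by (metis keys_single singleton_inject)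

lemma path_weight_0: "path_weight wt 0 = 0"
  by (simp add: path_weight_def)

lemma path_weight_of: "path_weight wt (frag_of p) = frag_of (sum_list (map wt p))"
  by (simp add: path_weight_def)

lemma path_weight_add: "path_weight wt (p + q) = path_weight wt p + path_weight wt q"
  by (simp add: path_weight_def frag_extend_add)

lemma path_weight_diff: "path_weight wt (p - q) = path_weight wt p - path_weight wt q"
  by (simp add: path_weight_def frag_extend_diff)

lemma path_weight_Idm: "path_weight wt (Idm (linearisation (path_category Q)) X) = 1"
  by (simp add: linearisation_def path_category_def path_weight_of)

text \<open>Both sides are additive in \<open>p\<close> and in \<open>q\<close>, which reduces the
  claim to two single paths. There concatenation adds exponents, and commutativity absorbs the
  reversed order of composition.\<close>

lemma path_weight_Cmp:
  fixes wt :: "'a \<Rightarrow> 'c::comm_monoid_add"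
  shows "path_weight wt (Cmp (linearisation (path_category Q)) X Y Z q p) = path_weight wt q * path_weight wt p"
proof -
  define cmp where "cmp q p = frag_extend (\<lambda>f. frag_extend (\<lambda>g. frag_of (f @ g)) q) p"
    for q p :: "'a list \<Rightarrow>\<^sub>0 int"
  have l: "cmp (a - b) (frag_of f) = cmp a (frag_of f) - cmp b (frag_of f)" for a b f
    by (simp add: cmp_def frag_extend_diff)
  have r: "cmp q (a - b) = cmp q a - cmp q b" for a b q
    by (simp add: cmp_def frag_extend_diff)
  have of_one: "path_weight wt (cmp q (frag_of f)) = path_weight wt q * path_weight wt (frag_of f)" for q f
    using subset_UNIV
  proof (induction q rule: frag_induction)
    case zero then show ?case by (simp add: cmp_def path_weight_0)
  next
    case (one g)
    then show ?case
      by (simp add: cmp_def path_weight_of) (simp add: mult_single add.commute)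
  next
    case (diff a b) then show ?case by (simp add: l path_weight_diff left_diff_distrib)
  qed
  have "path_weight wt (cmp q p) = path_weight wt q * path_weight wt p"
    using subset_UNIV
  proof (induction p rule: frag_induction)
    case zero then show ?case by (simp add: cmp_def path_weight_0)
  next
    case (one f) show ?case by (rule of_one)
  next
    case (diff a b) then show ?case by (simp add: r path_weight_diff right_diff_distrib)
  qed
  then show ?thesis by (simp add: cmp_def linearisation_def path_category_def)
qed

text \<open>The free module of rank \<open>length xs\<close> over the monoid ring. Padding with
  zeros places all ranks in one group, as the locale demands, and \<open>weight_act\<close> is
  matrix times vector with the same padding.\<close>

definition weight_V :: "'o list \<Rightarrow> (nat \<Rightarrow> 'c::comm_monoid_add \<Rightarrow>\<^sub>0 int) set" where
  "weight_V xs = {v. \<forall>i\<ge>length xs. v i = 0}"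

definition weight_act :: "('a \<Rightarrow> 'c::comm_monoid_add) \<Rightarrow> 'o list \<Rightarrow> 'o list \<Rightarrow>
    (nat \<times> nat \<Rightarrow> 'a list \<Rightarrow>\<^sub>0 int) \<Rightarrow> (nat \<Rightarrow> 'c \<Rightarrow>\<^sub>0 int) \<Rightarrow> nat \<Rightarrow> 'c \<Rightarrow>\<^sub>0 int" where
  "weight_act wt xs ys M v =
     (\<lambda>i. if i < length ys then \<Sum>j<length xs. path_weight wt (M (i, j)) * v j else 0)"

lemma path_weight_hom_sum:
  "path_weight wt (hom_sum (linearisation C) X Y f n) = (\<Sum>j<n. path_weight wt (f j))"
  by (induction n) (simp_all add: linearisation_def path_weight_0 path_weight_add)

lemma additive_functor_weight:
  fixes Q :: "('b, 'a) quiver" and wt :: "'a \<Rightarrow> 'c::comm_monoid_add"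
  shows "additive_functor (additive_hull (path_category Q)) weight_V (weight_act wt)"
proof (intro additive_functor.intro additive_functor_axioms.intro)
  let ?L = "linearisation (path_category Q)"
  show "preadditive_category (additive_hull (path_category Q))"
    by unfold_locales (rule preadditive_additive_hull[OF category_path_category])
  show "subgroup_set (weight_V X)" for X :: "'b list" by (simp add: subgroup_set_def weight_V_def)
  show "weight_act wt X Y f v \<in> weight_V Y" for X Y :: "'b list" and f v
    by (simp add: weight_V_def weight_act_def)
  show "weight_act wt X Y f (v + w) = weight_act wt X Y f v + weight_act wt X Y f w" for X Y :: "'b list" and f v w
    by (auto simp: weight_act_def fun_eq_iff distrib_left sum.distrib)
  show "weight_act wt X X (Idm (additive_hull (path_category Q)) X) v = v" if v: "v \<in> weight_V X" for X v
  proof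
    fix i
    have "(\<Sum>j<length X. path_weight wt (Idm (direct_sums ?L) X (i, j)) * v j) = v i" if i: "i < length X"
    proof -
      have "(\<Sum>j<length X. path_weight wt (Idm (direct_sums ?L) X (i, j)) * v j) =
          (\<Sum>j<length X. if i = j then v j else 0)"
        using i by (intro sum.cong)
          (auto simp: direct_sums_def path_weight_Idm, simp add: linearisation_def path_weight_0)
      then show ?thesis using i by simp
    qed
    then show "weight_act wt X X (Idm (additive_hull (path_category Q)) X) v i = v i"
      using v by (simp add: weight_act_def additive_hull_def weight_V_def)
  qed
  show "weight_act wt X Z (Cmp (additive_hull (path_category Q)) X Y Z g f) v =
      weight_act wt Y Z g (weight_act wt X Y f v)" for X Y Z g f v
  proof
    fix i
    have "(\<Sum>k<length X. path_weight wt (Cmp (direct_sums ?L) X Y Z g f (i, k)) * v k) =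
        (\<Sum>j<length Y. path_weight wt (g (i, j)) * (\<Sum>k<length X. path_weight wt (f (j, k)) * v k))"
      if i: "i < length Z"
    proof -
      have "(\<Sum>k<length X. path_weight wt (Cmp (direct_sums ?L) X Y Z g f (i, k)) * v k) =
          (\<Sum>k<length X. \<Sum>j<length Y. path_weight wt (g (i, j)) * path_weight wt (f (j, k)) * v k)"
        using i by (intro sum.cong)
          (simp_all add: direct_sums_def path_weight_hom_sum path_weight_Cmp sum_distrib_right)
      also have "\<dots> = (\<Sum>j<length Y. \<Sum>k<length X. path_weight wt (g (i, j)) * path_weight wt (f (j, k)) * v k)"
        by (rule sum.swap)
      finally show ?thesis by (simp add: sum_distrib_left mult.assoc)
    qed
    then show "weight_act wt X Z (Cmp (additive_hull (path_category Q)) X Y Z g f) v i =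
        weight_act wt Y Z g (weight_act wt X Y f v) i"
      by (simp add: weight_act_def additive_hull_def)
  qed
  show "weight_act wt X Y (Pls (additive_hull (path_category Q)) X Y f g) v =
      weight_act wt X Y f v + weight_act wt X Y g v" for X Y f g v
  proof
    fix i
    have "path_weight wt (Pls (direct_sums ?L) X Y f g (i, j)) = path_weight wt (f (i, j)) + path_weight wt (g (i, j))"
      if "i < length Y" "j < length X" for j
      using that by (simp add: direct_sums_def linearisation_def path_weight_add)
    then show "weight_act wt X Y (Pls (additive_hull (path_category Q)) X Y f g) v i =
        (weight_act wt X Y f v + weight_act wt X Y g v) i"
      by (simp add: weight_act_def additive_hull_def distrib_right sum.distrib)
  qed
qed

section \<open>Countability of the Hom-sets, and smallness\<close>

lemma countable_PiE_finite:
  fixes F :: "'i \<Rightarrow> 'a set"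
  assumes I: "finite I" and F: "\<And>i. i \<in> I \<Longrightarrow> countable (F i)"
  shows "countable (Pi\<^sub>E I F)"
proof -
  obtain xs where xs: "set xs = I" using finite_list[OF I] by blast
  have "inj_on (\<lambda>f. map f xs) (Pi\<^sub>E I F)"
    by (rule inj_onI, rule PiE_ext) (auto simp: xs)
  moreover have "(\<lambda>f. map f xs) ` Pi\<^sub>E I F \<subseteq> lists (\<Union>i\<in>I. F i)" using xs by (fastforce simp: PiE_def Pi_def)
  moreover have "countable (lists (\<Union>i\<in>I. F i))" by (intro countable_lists countable_UN F countable_finite[OF I])
  ultimately show ?thesis using countable_image_inj_on countable_subset by metis
qed

lemma (in preadditive_category) countable_Hom_fp_mod:
  assumes "\<And>X Y. X \<in> Ob D \<Longrightarrow> Y \<in> Ob D \<Longrightarrow> countable (Hom D X Y)"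
    and "P \<in> Ob (fp_mod D)" "Q \<in> Ob (fp_mod D)"
  shows "countable (Hom (fp_mod D) P Q)"
proof -
  obtain X Y a X' Y' a' where P: "P = (X, Y, a)" "Q = (X', Y', a')" by (metis prod_cases3)
  have "Collect (lifts X Y a X' Y' a') \<subseteq> Hom D Y Y'" by (auto simp: lifts_def)
  then show ?thesis using assms unfolding P Hom_fp_mod Ob_fp_mod
    by (intro countable_image) (blast intro: countable_subset)
qed

lemma countable_Hom_abelian_hull:
  assumes D: "preadditive D" and c: "\<And>X Y. X \<in> Ob D \<Longrightarrow> Y \<in> Ob D \<Longrightarrow> countable (Hom D X Y)"
    and X: "X \<in> Ob (abelian_hull D)" and Y: "Y \<in> Ob (abelian_hull D)"
  shows "countable (Hom (abelian_hull D) X Y)"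
proof -
  interpret D: preadditive_category D by unfold_locales (rule D)
  interpret E: preadditive_category "opposite (fp_mod D)"
    by unfold_locales (intro preadditive_opposite preadditive_fp_mod D)
  show ?thesis
    unfolding abelian_hull_def Hom_opposite
    by (rule E.countable_Hom_fp_mod) (use X Y D.countable_Hom_fp_mod[OF c] in \<open>simp_all add: abelian_hull_def\<close>)
qed

lemma countable_Hom_additive_hull:
  assumes sub: "\<And>X Y. X \<in> Ob C \<Longrightarrow> Y \<in> Ob C \<Longrightarrow> \<exists>f. Hom C X Y \<subseteq> {f}"
    and o: "xs \<in> Ob (additive_hull C)" "ys \<in> Ob (additive_hull C)"
  shows "countable (Hom (additive_hull C) xs ys)"
proof -
  have "countable {p :: 'b \<Rightarrow>\<^sub>0 int. Poly_Mapping.keys p \<subseteq> Hom C X Y}" if "X \<in> Ob C" "Y \<in> Ob C" for X Y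
  proof -
    obtain f where f: "Hom C X Y \<subseteq> {f}" using sub \<open>X \<in> Ob C\<close> \<open>Y \<in> Ob C\<close> by blast
    \<comment> \<open>A linear combination supported on a single morphism is determined by one
      integer coefficient.\<close>
    have "inj_on (\<lambda>p :: 'b \<Rightarrow>\<^sub>0 int. Poly_Mapping.lookup p f) {p. Poly_Mapping.keys p \<subseteq> Hom C X Y}"
    proof (rule inj_onI, rule poly_mapping_eqI)
      fix p q :: "'b \<Rightarrow>\<^sub>0 int" and k
      assume "p \<in> {p. Poly_Mapping.keys p \<subseteq> Hom C X Y}" "q \<in> {p. Poly_Mapping.keys p \<subseteq> Hom C X Y}"
        and eq: "Poly_Mapping.lookup p f = Poly_Mapping.lookup q f"
      then have "Poly_Mapping.keys p \<subseteq> {f}" "Poly_Mapping.keys q \<subseteq> {f}" using f by blast+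
      then have "Poly_Mapping.lookup p k = 0 \<and> Poly_Mapping.lookup q k = 0" if "k \<noteq> f"
        using that by (meson in_keys_iff singletonD subsetD)
      then show "Poly_Mapping.lookup p k = Poly_Mapping.lookup q k" using eq by (cases "k = f") auto
    qed
    then show ?thesis by (rule countable_image_inj_on[rotated]) simp
  qed
  moreover have "xs ! j \<in> Ob C" "ys ! i \<in> Ob C" if "i < length ys" "j < length xs" for i j
    using o that by (auto simp: additive_hull_def Ob_direct_sums linearisation_def in_lists_conv_set)
  ultimately show ?thesis
    unfolding additive_hull_def Hom_direct_sums
    by (intro countable_PiE_finite) (auto simp: linearisation_def)
qed

text \<open>No arrow starts at \<open>Vx\<close> or \<open>Vz\<close>, so a path ends after its
  first arrow.\<close>

lemma span_quiver_paths:
  assumes "is_path (span_quiver I) x p y"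
  shows "x = y \<and> p = [] \<or> (\<exists>i. x = Vy i \<and> (y = Vx \<and> p = [Sigma i] \<or> y = Vz \<and> p = [Tau i]))"
proof (cases p)
  case Nil then show ?thesis using assms by simp
next
  case (Cons a q)
  then show ?thesis using assms by (cases a; cases q) (auto simp: span_quiver_def split: arrow.splits elim: arrow_src.elims)
qed

text \<open>The two arrows that leave a vertex \<open>Vy i\<close> are told apart by their
  targets.\<close>

lemma span_quiver_Hom_subsingleton: "\<exists>p. Hom (path_category (span_quiver I)) x y \<subseteq> {p}"
proof -
  have "p = q" if "is_path (span_quiver I) x p y" "is_path (span_quiver I) x q y" for p q
    using span_quiver_paths[OF that(1)] span_quiver_paths[OF that(2)] by auto
  then have "{p. is_path (span_quiver I) x p y} \<subseteq> {SOME p. is_path (span_quiver I) x p y}"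
    by (metis (mono_tags) mem_Collect_eq singletonI someI subsetI)
  then show ?thesis by (auto simp: path_category_def)
qed

text \<open>Up to bijection \<open>B\<close> is a subset of a member of \<open>U\<close>, hence an
  element of its power set, which is in \<open>U\<close>; and \<open>U\<close> is
  transitive.\<close>

lemma small_lepoll:
  assumes "set_theory elts" "grothendieck_universe elts U" "small elts U A" "B \<lesssim> A"
  shows "small elts U B"
proof -
  interpret set_theory elts by fact
  obtain u where u: "u \<in> elts U" "elts u \<approx> A" using assms(3) by (auto simp: small_def)
  have "B \<lesssim> elts u" using assms(4) u(2) eqpoll_sym lepoll_trans2 by blast
  then obtain S where S: "S \<subseteq> elts u" "B \<approx> S"
    unfolding lepoll_def by (metis inj_on_image_eqpoll_self eqpoll_sym)
  obtain y where y: "elts y = S" using separation[OF S(1)] by blast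
  have "elts U \<noteq> {} \<and> (\<forall>x\<in>elts U. elts x \<subseteq> elts U) \<and> (\<forall>x\<in>elts U. \<exists>p\<in>elts U. elts p = {y. elts y \<subseteq> elts x})"
    using assms(2) unfolding grothendieck_universe_def by (elim conjE) (intro conjI)
  then obtain p where p: "p \<in> elts U" "elts p = {y. elts y \<subseteq> elts u}" "elts p \<subseteq> elts U" using u(1) by blast
  then have "y \<in> elts U" using y S(1) by blast
  then show ?thesis using y S(2) eqpoll_sym unfolding small_def by blast
qed

theorem proposition7:
  fixes elts :: "'v \<Rightarrow> 'v set" and U V I :: 'v
  assumes "set_theory elts"
    and "grothendieck_universe elts U" and "small elts U (UNIV :: int set)"
    and "grothendieck_universe elts V" and "elts U \<subset> elts V"
    and "I \<in> elts V" and "\<not> small elts U (elts I)"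
  shows "universe_category elts U
           (abelian_hull (additive_hull (path_category (span_quiver (elts I))))) \<and>
         (\<exists>S. serre_subcategory
                (abelian_hull (additive_hull (path_category (span_quiver (elts I))))) S \<and>
              \<not> universe_category elts U
                (serre_quotient
                  (abelian_hull (additive_hull (path_category (span_quiver (elts I))))) S))"
proof
  let ?C = "path_category (span_quiver (elts I))"
  let ?D = "additive_hull ?C"
  note small = small_lepoll[OF assms(1,2)]
  have countable_small: "small elts U A" if A: "countable A" for A :: "'b set"
  proof (rule small[OF assms(3)])
    obtain f :: "'b \<Rightarrow> nat" where "inj_on f A" using A by (rule countableE)
    then have "inj_on (\<lambda>a. int (f a)) A" by (auto simp: inj_on_def)
    then show "A \<lesssim> (UNIV :: int set)" by (auto simp: lepoll_def)
  qed
  have "countable (Hom (abelian_hull ?D) X Y)" if "X \<in> Ob (abelian_hull ?D)" "Y \<in> Ob (abelian_hull ?D)" for X Y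
    using countable_Hom_abelian_hull[OF preadditive_additive_hull[OF category_path_category]
        countable_Hom_additive_hull[OF span_quiver_Hom_subsingleton] that] by blast
  then show "universe_category elts U (abelian_hull ?D)"
    unfolding universe_category_def using countable_small by blast
  \<comment> \<open>Weights are exponents: \<open>0\<close> is the exponent of the monomial
    \<open>1\<close>, and \<open>Poly_Mapping.single i 1\<close> that of the variable attached to
    \<open>i\<close>.\<close>
  define wt :: "'v arrow \<Rightarrow> 'v \<Rightarrow>\<^sub>0 nat" where
    "wt a = (case a of Sigma i \<Rightarrow> 0 | Tau i \<Rightarrow> Poly_Mapping.single i 1)" for a
  interpret M: additive_functor ?D weight_V "weight_act wt" by (rule additive_functor_weight)
  define entry where "entry p = (\<lambda>(a, b)\<in>{..<1::nat} \<times> {..<1::nat}. frag_of p)" for p :: "'v arrow list"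
  have entry: "entry p \<in> Hom ?D [X] [Y]" if "is_path (span_quiver (elts I)) X p Y" for p X Y
    using that by (auto simp: entry_def additive_hull_def Hom_direct_sums linearisation_def path_category_def)
  have act: "weight_act wt [X] [Y] (entry p) v =
      (\<lambda>k. if k = 0 then frag_of (sum_list (map wt p)) * v 0 else 0)" for X Y :: "'v vertex" and p v
    by (auto simp: weight_act_def entry_def path_weight_of)
  \<comment> \<open>The element \<open>1\<close> of the ring, seen in the free module of rank
    one.\<close>
  let ?e = "\<lambda>k::nat. if k = 0 then 1 else (0 :: ('v \<Rightarrow>\<^sub>0 nat) \<Rightarrow>\<^sub>0 int)"
  have V1: "weight_V [X] = {v. \<forall>k>0. v k = 0}" for X :: "'v vertex" by (auto simp: weight_V_def Suc_le_eq)
  have Ob: "[X] \<in> Ob ?D" if "X \<in> {Vx, Vz} \<union> Vy ` elts I" for X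
    using that by (auto simp: additive_hull_def Ob_direct_sums linearisation_def path_category_def span_quiver_def)
  have sigma: "weight_act wt [Vy i] [Vx] (entry [Sigma i]) v = v" if "v \<in> weight_V [Vx :: 'v vertex]" for i :: 'v and v
    using that by (auto simp: act wt_def V1 fun_eq_iff)
  \<comment> \<open>The empty set embeds into the integers and is small. Nonemptiness is what later
    supplies an acyclic object.\<close>
  have "elts I \<noteq> {}" using assms(7) small[OF assms(3) empty_lepoll] by auto
  have "\<exists>S. serre_subcategory (abelian_hull ?D) S \<and> (\<exists>X\<in>Ob (abelian_hull ?D). \<exists>Z\<in>Ob (abelian_hull ?D).
      elts I \<lesssim> Hom (serre_quotient (abelian_hull ?D) S) X Z)"
  proof (rule M.serre_quotient_abelian_hull)
    show "has_direct_sums ?D"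
      unfolding additive_hull_def
      by (intro preadditive_category.has_direct_sums_direct_sums preadditive_category.intro
          preadditive_linearisation category_path_category)
    show "elts I \<noteq> {}" by fact
    show "[Vx] \<in> Ob ?D" "[Vz] \<in> Ob ?D" by (intro Ob; simp)+
    show "[Vy i] \<in> Ob ?D" if "i \<in> elts I" for i using that by (intro Ob) simp
    show "entry [Sigma i] \<in> Hom ?D [Vy i] [Vx]" if "i \<in> elts I" for i
      using that by (intro entry) (simp add: span_quiver_def)
    show "entry [Tau i] \<in> Hom ?D [Vy i] [Vz]" if "i \<in> elts I" for i
      using that by (intro entry) (simp add: span_quiver_def)
    show "bij_betw (weight_act wt [Vy i] [Vx] (entry [Sigma i])) (weight_V [Vy i])
        (weight_V [Vx :: 'v vertex])" for i :: 'v
      using sigma by (intro bij_betwI[where g = id]) (auto simp: V1)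
    show "?e \<in> weight_V [Vy i]" for i :: 'v by (simp add: V1)
    show "weight_act wt [Vy i] [Vx] (entry [Sigma i]) ?e = ?e" for i :: 'v by (rule sigma) (simp add: V1)
    show "inj_on (\<lambda>i. weight_act wt [Vy i] [Vz] (entry [Tau i]) ?e) (elts I)"
    proof (rule inj_onI)
      fix i j :: 'v
      assume "weight_act wt [Vy i] [Vz] (entry [Tau i]) ?e = weight_act wt [Vy j] [Vz] (entry [Tau j]) ?e"
      \<comment> \<open>Coordinate \<open>0\<close> is the only one that can be nonzero in rank one;
        it holds the variable itself.\<close>
      from fun_cong[OF this, of 0]
      have "frag_of (Poly_Mapping.single i (1::nat)) = frag_of (Poly_Mapping.single j 1)"
        by (simp add: act wt_def)
      then show "i = j" by (auto dest!: single_inject[rotated])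
    qed
  qed
  \<comment> \<open>If this Hom-set were small, \<open>small_lepoll\<close> would make
    \<open>elts I\<close> small.\<close>
  then show "\<exists>S. serre_subcategory (abelian_hull ?D) S \<and>
      \<not> universe_category elts U (serre_quotient (abelian_hull ?D) S)"
    using small assms(7) by (fastforce simp: universe_category_def serre_quotient_def localisation_def)
qed

end
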